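(* There exists a constant $\sigma\in(0,1)$, depending only on $n,g_0,g_1,\nu,L$, such that the following holds. Let $(x_0,t_0)\in\Omega_T$, $k>0$, and let $\rho,\theta>0$ be such that $Q(\rho,\theta):=B_\rho(x_0)\times(t_0-\theta,t_0)\Subset\Omega_T$ and $$\theta=k^2\,G\!\left(\frac{k}{\rho}\right)^{-1}.$$ If $u$ is a nonnegative weak subsolution of $\partial_t u-\operatorname{div}\mathcal A(Du)=0$ in $\Omega_T$ and $$\frac{1}{|Q(\rho,\theta)|}\int_{Q(\rho,\theta)}\left(G\!\left(\frac{u}{\rho}\right)+\frac{u^2}{\theta}\right)dx\,dt\le \sigma\, G\!\left(\frac{k}{\rho}\right),$$ then $$\operatorname*{ess\,sup}_{Q(\rho/2,\theta/2)}u\le k,$$ where $Q(\rho/2,\theta/2)=B_{\rho/2}(x_0)\times(t_0-\theta/2,t_0)$.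
   Context: Standing setting. $n\ge 2$, $\Omega\subset\mathbb R^n$ is a bounded domain, $T>0$, $\Omega_T=\Omega\times(0,T)$. The function $g:[0,\infty)\to[0,\infty)$ is $C^1$, positive on $(0,\infty)$, and satisfies $g_0-1\le \frac{s g'(s)}{g(s)}\le g_1-1$ for all $s>0$, where $\frac{2n}{n+2}<g_0\le g_1<\infty$; it is normalized by $\int_0^1 g(\rho)\,d\rho=1$. Put $G(s)=\int_0^s g(r)\,dr$. The vector field $\mathcal A:\mathbb R^n\to\mathbb R^n$ is $C^1$ with $\mathcal A(0)=0$, and for some $0<\nu\le 1\le L$ it satisfies $\langle D\mathcal A(\xi)\zeta,\zeta\rangle\ge \nu\frac{g(|\xi|)}{|\xi|}|\zeta|^2$ and $|D\mathcal A(\xi)|\le L\frac{g(|\xi|)}{|\xi|}$ for all $\xi\in\mathbb R^n\setminus\{0\}$, $\zeta\in\mathbb R^n$. For a cylinder, $D\times(t_1,t_2)\Subset\Omega_T$ means that $D\Subset\Omega$ and $0<t_1<t_2\le T$. Function spaces. $L^G(E)$ is the space of measurable $u$ on $E$ with $\int_E G(|u|)<\infty$. For a cylinder $\mathcal K=D\times(t_1,t_2)$, $V^G(\mathcal K)$ is the space of $u\in L^G(\mathcal K)\cap L^1(t_1,t_2;W^{1,1}(D))$ whose weak spatial gradient $Du$ lies in $L^G(\mathcal K)$, and $V^{2,G}(\mathcal K)=L^\infty(t_1,t_2;L^2(D))\cap V^G(\mathcal K)$. $u\in V^{2,G}_{\rm loc}(\Omega_T)$ means $u\in V^{2,G}(\mathcal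 K)$ for every cylinder $\mathcal K$ whose closure is a compact subset of $\Omega_T$. Weak subsolution in $\Omega_T$: $u\in V^{2,G}_{\rm loc}(\Omega_T)$ and $-\int_{\Omega_T} u\,\partial_t\eta\,dx\,dt+\int_{\Omega_T} \mathcal A(Du)\cdot D\eta\,dx\,dt\le 0$ for every nonnegative $\eta\in C_c^\infty(\Omega_T)$. *)

theory Defs
  imports "HOL-Analysis.Analysis" "HOL-Probability.Essential_Supremum"
begin

text \<open>
  Points of space-time are pairs \<open>(x, t)\<close> of type \<open>(real ^ 'n) \<times> real\<close>, with Lebesgue
  measure on the product type. Functions on a subset of space or space-time are total functions
  whose values outside the set are irrelevant.
\<close>

definition growth_function :: "real \<Rightarrow> real \<Rightarrow> (real \<Rightarrow> real) \<Rightarrow> bool" where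
  "growth_function g0 g1 g \<longleftrightarrow>
     (\<forall>s\<ge>0. 0 \<le> g s) \<and> (\<forall>s>0. 0 < g s) \<and>
     (\<exists>g'. (\<forall>s\<ge>0. (g has_real_derivative g' s) (at s within {0..})) \<and>
           continuous_on {0..} g' \<and>
           (\<forall>s>0. g0 - 1 \<le> s * g' s / g s \<and> s * g' s / g s \<le> g1 - 1)) \<and>
     integral {0..1} g = 1"

definition primitive :: "(real \<Rightarrow> real) \<Rightarrow> real \<Rightarrow> real" where
  "primitive g s = integral {0..s} g"

text \<open>The norm of \<open>DA \<xi>\<close>, a bounded linear function, is the operator norm.\<close>

definition vector_field_structure ::
    "real \<Rightarrow> real \<Rightarrow> (real \<Rightarrow> real) \<Rightarrow> (real ^ 'n \<Rightarrow> real ^ 'n) \<Rightarrow> bool" where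
  "vector_field_structure \<nu> L g A \<longleftrightarrow>
     A 0 = 0 \<and>
     (\<exists>DA :: real ^ 'n \<Rightarrow> (real ^ 'n) \<Rightarrow>\<^sub>L (real ^ 'n).
        (\<forall>\<xi>. (A has_derivative blinfun_apply (DA \<xi>)) (at \<xi>)) \<and>
        continuous_on UNIV DA \<and>
        (\<forall>\<xi>. \<xi> \<noteq> 0 \<longrightarrow>
           (\<forall>\<zeta>. blinfun_apply (DA \<xi>) \<zeta> \<bullet> \<zeta> \<ge> \<nu> * (g (norm \<xi>) / norm \<xi>) * (norm \<zeta>)\<^sup>2) \<and>
           norm (DA \<xi>) \<le> L * (g (norm \<xi>) / norm \<xi>)))"

definition bounded_domain :: "'a::euclidean_space set \<Rightarrow> bool" where
  "bounded_domain \<Omega> \<longleftrightarrow> open \<Omega> \<and> connected \<Omega> \<and> \<Omega> \<noteq> {} \<and> bounded \<Omega>"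

definition compactly_contained :: "'a::euclidean_space set \<Rightarrow> 'a set \<Rightarrow> bool" where
  "compactly_contained D \<Omega> \<longleftrightarrow> compact (closure D) \<and> closure D \<subseteq> \<Omega>"

text \<open>
  This is the convention for \<open>D \<times> (t\<^sub>1, t\<^sub>2) \<Subset> \<Omega> \<times> (0, T)\<close>. The value \<open>t2 = T\<close> is allowed, so
  the closure of the cylinder need not lie in \<open>\<Omega> \<times> (0, T)\<close>.
\<close>

definition cylinder_contained ::
    "'a::euclidean_space set \<Rightarrow> real \<Rightarrow> real \<Rightarrow> 'a set \<Rightarrow> real \<Rightarrow> bool" where
  "cylinder_contained D t1 t2 \<Omega> T \<longleftrightarrow>
     compactly_contained D \<Omega> \<and> 0 < t1 \<and> t1 < t2 \<and> t2 \<le> T"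

primrec Ck :: "nat \<Rightarrow> ('a::euclidean_space \<Rightarrow> real) \<Rightarrow> bool" where
  "Ck 0 f \<longleftrightarrow> continuous_on UNIV f"
| "Ck (Suc k) f \<longleftrightarrow>
     f differentiable_on UNIV \<and> (\<forall>b\<in>Basis. Ck k (\<lambda>x. frechet_derivative f (at x) b))"

text \<open>An element of \<open>C\<^sub>c\<^sup>\<infinity>(E)\<close> is represented by its extension by zero.\<close>

definition test_functions :: "'a::euclidean_space set \<Rightarrow> ('a \<Rightarrow> real) set" where
  "test_functions E =
     {\<phi>. (\<forall>k. Ck k \<phi>) \<and> compact (closure {x. \<phi> x \<noteq> 0}) \<and> closure {x. \<phi> x \<noteq> 0} \<subseteq> E}"

definition gradient :: "(real ^ 'n \<Rightarrow> real) \<Rightarrow> real ^ 'n \<Rightarrow> real ^ 'n" where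
  "gradient \<phi> x = (\<chi> i. frechet_derivative \<phi> (at x) (axis i 1))"

text \<open>
  Weak gradients are determined only up to null sets, so the spaces below carry the gradient as
  an explicit argument: the last argument \<open>Du\<close> is the weak (spatial) gradient of \<open>u\<close>.
\<close>

definition W11 :: "(real ^ 'n) set \<Rightarrow> (real ^ 'n \<Rightarrow> real) \<Rightarrow> (real ^ 'n \<Rightarrow> real ^ 'n) \<Rightarrow> bool" where
  "W11 D v Dv \<longleftrightarrow>
     integrable (lebesgue_on D) v \<and> integrable (lebesgue_on D) Dv \<and>
     (\<forall>\<phi>\<in>test_functions D.
        (LINT x|lebesgue_on D. v x *\<^sub>R gradient \<phi> x) = - (LINT x|lebesgue_on D. \<phi> x *\<^sub>R Dv x))"

text \<open>
  By Tonelli, the integral over \<open>(t1, t2)\<close> of the \<open>W\<^sup>1\<^sup>,\<^sup>1(D)\<close>-norms of the time slices is finite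
  iff \<open>u\<close> and \<open>Du\<close> are integrable on the cylinder; and since \<open>W\<^sup>1\<^sup>,\<^sup>1(D)\<close> is separable, joint
  measurability of \<open>u\<close> and \<open>Du\<close> expresses strong measurability of the Banach-space valued map.
\<close>

definition L1_W11 ::
    "(real ^ 'n) set \<Rightarrow> real \<Rightarrow> real \<Rightarrow> ((real ^ 'n) \<times> real \<Rightarrow> real) \<Rightarrow>
     ((real ^ 'n) \<times> real \<Rightarrow> real ^ 'n) \<Rightarrow> bool" where
  "L1_W11 D t1 t2 u Du \<longleftrightarrow>
     integrable (lebesgue_on (D \<times> {t1<..<t2})) u \<and>
     integrable (lebesgue_on (D \<times> {t1<..<t2})) Du \<and>
     (AE t in lebesgue_on {t1<..<t2}. W11 D (\<lambda>x. u (x, t)) (\<lambda>x. Du (x, t)))"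

definition Linf_L2 ::
    "(real ^ 'n) set \<Rightarrow> real \<Rightarrow> real \<Rightarrow> ((real ^ 'n) \<times> real \<Rightarrow> real) \<Rightarrow> bool" where
  "Linf_L2 D t1 t2 u \<longleftrightarrow>
     u \<in> borel_measurable (lebesgue_on (D \<times> {t1<..<t2})) \<and>
     (\<exists>M. AE t in lebesgue_on {t1<..<t2}.
        (\<lambda>x. u (x, t)) \<in> borel_measurable (lebesgue_on D) \<and>
        (\<integral>\<^sup>+x. ennreal ((u (x, t))\<^sup>2) \<partial>lebesgue_on D) \<le> ennreal M)"

definition LG ::
    "(real \<Rightarrow> real) \<Rightarrow> 'a::euclidean_space set \<Rightarrow> ('a \<Rightarrow> 'b::euclidean_space) \<Rightarrow> bool" where
  "LG G E u \<longleftrightarrow>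
     u \<in> borel_measurable (lebesgue_on E) \<and>
     (\<integral>\<^sup>+z. ennreal (G (norm (u z))) \<partial>lebesgue_on E) < \<infinity>"

definition VG ::
    "(real \<Rightarrow> real) \<Rightarrow> (real ^ 'n) set \<Rightarrow> real \<Rightarrow> real \<Rightarrow> ((real ^ 'n) \<times> real \<Rightarrow> real) \<Rightarrow>
     ((real ^ 'n) \<times> real \<Rightarrow> real ^ 'n) \<Rightarrow> bool" where
  "VG G D t1 t2 u Du \<longleftrightarrow>
     LG G (D \<times> {t1<..<t2}) u \<and> L1_W11 D t1 t2 u Du \<and> LG G (D \<times> {t1<..<t2}) Du"

definition V2G ::
    "(real \<Rightarrow> real) \<Rightarrow> (real ^ 'n) set \<Rightarrow> real \<Rightarrow> real \<Rightarrow> ((real ^ 'n) \<times> real \<Rightarrow> real) \<Rightarrow>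
     ((real ^ 'n) \<times> real \<Rightarrow> real ^ 'n) \<Rightarrow> bool" where
  "V2G G D t1 t2 u Du \<longleftrightarrow> Linf_L2 D t1 t2 u \<and> VG G D t1 t2 u Du"

text \<open>
  One \<open>Du\<close> serves all cylinders: gradients on different cylinders agree almost everywhere on
  overlaps and can be glued along a countable exhaustion.
\<close>

definition V2G_loc ::
    "(real \<Rightarrow> real) \<Rightarrow> (real ^ 'n) set \<Rightarrow> real \<Rightarrow> ((real ^ 'n) \<times> real \<Rightarrow> real) \<Rightarrow>
     ((real ^ 'n) \<times> real \<Rightarrow> real ^ 'n) \<Rightarrow> bool" where
  "V2G_loc G \<Omega> T u Du \<longleftrightarrow>
     (\<forall>D t1 t2. open D \<longrightarrow> t1 < t2 \<longrightarrow>
        compactly_contained (D \<times> {t1<..<t2}) (\<Omega> \<times> {0<..<T}) \<longrightarrow> V2G G D t1 t2 u Du)"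

definition weak_subsolution ::
    "(real \<Rightarrow> real) \<Rightarrow> (real ^ 'n \<Rightarrow> real ^ 'n) \<Rightarrow> (real ^ 'n) set \<Rightarrow> real \<Rightarrow>
     ((real ^ 'n) \<times> real \<Rightarrow> real) \<Rightarrow> bool" where
  "weak_subsolution G A \<Omega> T u \<longleftrightarrow>
     (\<exists>Du. V2G_loc G \<Omega> T u Du \<and>
        (\<forall>\<eta>\<in>test_functions (\<Omega> \<times> {0<..<T}). (\<forall>z. 0 \<le> \<eta> z) \<longrightarrow>
           - (LINT (x, t)|lebesgue_on (\<Omega> \<times> {0<..<T}). u (x, t) * deriv (\<lambda>s. \<eta> (x, s)) t)
           + (LINT (x, t)|lebesgue_on (\<Omega> \<times> {0<..<T}).
                A (Du (x, t)) \<bullet> gradient (\<lambda>y. \<eta> (y, t)) x) \<le> 0))"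

end

theory Submission
  imports Defs
begin

text \<open>
  De Giorgi iteration over the levels \<open>k (1 - 2\<^sup>-\<^sup>j)\<close> and cylinders shrinking from \<open>Q(\<rho>, \<theta>)\<close> to
  \<open>Q(\<rho>/2, \<theta>/2)\<close>. Convolving the equation with a space-time mollifier gives a smooth \<open>v\<close> with
  \<open>\<partial>\<^sub>t v \<le> div F\<close> pointwise, where \<open>F\<close> is the mollified flux; testing this with a \<open>C\<^sup>1\<close> truncation
  of \<open>v\<close> times a cutoff yields the Caccioppoli inequality up to the error \<open>F - A(Dv)\<close>.

  No Sobolev inequality is needed. If \<open>S\<close> bounds \<open>\<integral> f\<^sup>2\<close> on time slices, then by Chebyshev
  \<open>f\<close> falls below \<open>l\<close> at at least half of the points at distance less than \<open>h\<close>, as soon as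
  \<open>|B\<^sub>h| l\<^sup>2\<close> is a large multiple of \<open>S\<close>. Integrating the drop of \<open>f\<close> along segments gives
  \<open>|{f > 2 l}| G(l / h) \<le> 2 \<integral> G(|Df|)\<close>. Summing over dyadic levels \<open>l\<close> gains the power
  \<open>1 + g0/n\<close> of \<open>S\<close>, and the sum converges exactly because \<open>g0 > 2n/(n+2)\<close>.

  The error disappears with the mollification parameter: \<open>|F - A(Dv)| |Dv|\<close> is dominated by a
  multiple of the mollification of \<open>G(|Du|) + G(u)\<close>, which converges in \<open>L\<^sup>1\<close>.
\<close>

subsection \<open>Growth functions and the structure of the vector field\<close>

text \<open>The relation \<open>\<theta> * G (k / \<rho>) = k^2\<close> balances the two terms of
  the excess: at height \<open>k\<close> both \<open>G (u / \<rho>)\<close> and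
  \<open>u^2 / \<theta>\<close> equal \<open>G (k / \<rho>)\<close>. It also gives |Q| G(k/\<rho>) =
  \<omega> \<rho>^n k^2, with \<omega> the volume of the unit ball. All integrals of the iteration
  are therefore measured in the unit \<rho>^n k^2, and only numbers depending on n, g0, g1, \<nu>, L
  remain. The obstacle is that u has no time derivative and A is nonlinear, so the mollified flux is
  not the flux of the mollified function. Each step of the iteration is carried out for a fixed
  mollification, with this discrepancy as an additive error, and the mollification is removed before
  the next step. A strict inequality between the available and the admissible excess absorbs the
  error, and Fatou's lemma returns the estimate for u. Where the exponent of g0 comes from: relative
  to G, the quadratic term grows with the level l at most like l^(2 - g0), while Chebyshev's
  inequality gains l^(-2 g0 / n). The product is summable over dyadic levels once 2 - g0 - 2 g0 / n
  < 0.\<close>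

lemma mono_Ici_if_deriv_nonneg:
  fixes f :: "real \<Rightarrow> real"
  assumes "continuous_on {0..} f" "\<And>s. 0 < s \<Longrightarrow> \<exists>D. (f has_real_derivative D) (at s) \<and> 0 \<le> D"
    and "0 \<le> a" "a \<le> b"
  shows "f a \<le> f b"
proof (cases "a = b")
  case False
  show ?thesis
  proof (rule DERIV_nonneg_imp_increasing_open[of a b f])
    show "\<exists>y. (f has_real_derivative y) (at x) \<and> 0 \<le> y" if "a < x" "x < b" for x
      using assms(2)[of x] that assms(3) by auto
    show "continuous_on {a..b} f"
      by (rule continuous_on_subset[OF assms(1)]) (use assms in auto)
  qed (use assms in auto)
qed simp

text \<open>In dimension at least two, \<open>2 n / (n + 2) < g0\<close> forces
  \<open>1 < g0\<close>; this bound alone makes \<open>g\<close> nondecreasing and \<open>G\<close>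
  convex.\<close>

locale growth =
  fixes g0 g1 :: real and g :: "real \<Rightarrow> real"
  assumes g0_gt: "1 < g0" and g0_le: "g0 \<le> g1" and growth: "growth_function g0 g1 g"
begin

abbreviation G :: "real \<Rightarrow> real" where "G \<equiv> primitive g"

lemma g_nonneg: "0 \<le> s \<Longrightarrow> 0 \<le> g s" and g_pos: "0 < s \<Longrightarrow> 0 < g s"
  using growth unfolding growth_function_def by auto

lemma g_cont: "continuous_on {0..} g"
proof -
  obtain g' where "\<And>s. 0 \<le> s \<Longrightarrow> (g has_real_derivative g' s) (at s within {0..})"
    using growth unfolding growth_function_def by auto
  then show ?thesis by (intro DERIV_continuous_on) auto
qed

lemma g_deriv:
  "\<exists>g'. \<forall>s>0. (g has_real_derivative g' s) (at s) \<and>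
     (g0 - 1) * g s \<le> s * g' s \<and> s * g' s \<le> (g1 - 1) * g s"
proof -
  obtain g' where g': "\<And>s. 0 \<le> s \<Longrightarrow> (g has_real_derivative g' s) (at s within {0..})"
    "\<And>s. 0 < s \<Longrightarrow> g0 - 1 \<le> s * g' s / g s \<and> s * g' s / g s \<le> g1 - 1"
    using growth unfolding growth_function_def by auto
  have "(g has_real_derivative g' s) (at s)" if "0 < s" for s
    using g'(1)[of s] that at_within_interior[of s "{0..}"] by simp
  moreover have "(g0 - 1) * g s \<le> s * g' s \<and> s * g' s \<le> (g1 - 1) * g s" if "0 < s" for s
    using g'(2)[OF that] g_pos[OF that] by (simp add: pos_le_divide_eq pos_divide_le_eq)
  ultimately show ?thesis by blast
qed

lemma g_mono: assumes "0 \<le> a" "a \<le> b" shows "g a \<le> g b"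
proof (rule mono_Ici_if_deriv_nonneg[OF g_cont _ assms])
  fix s :: real assume s: "0 < s"
  obtain D where D: "(g has_real_derivative D) (at s)" "(g0 - 1) * g s \<le> s * D"
    using g_deriv s by blast
  have "0 \<le> (g0 - 1) * g s" using g_pos[OF s] g0_gt by simp
  then have "0 \<le> D" using D(2) s by (meson order_trans zero_le_mult_iff not_le)
  then show "\<exists>D. (g has_real_derivative D) (at s) \<and> 0 \<le> D" using D by auto
qed

text \<open>Integrals over empty or degenerate intervals vanish, so \<open>G\<close> is extended by
  zero to the left. The extension stays nondecreasing and convex on the whole line, which lets
  \<open>G ((t - a) / \<rho>)\<close> stand for \<open>G\<close> of a positive part.\<close>

lemma G_nonpos_arg: "s \<le> 0 \<Longrightarrow> G s = 0"
  unfolding primitive_def by (cases "s = 0") auto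

lemma G_zero [simp]: "G 0 = 0" by (simp add: G_nonpos_arg)

lemma g_cont_Icc: "continuous_on {0..b} g"
  by (rule continuous_on_subset[OF g_cont]) auto

lemma G_deriv: assumes "0 < s" shows "(G has_real_derivative g s) (at s)"
proof -
  have "((\<lambda>x. integral {0..x} g) has_real_derivative g s) (at s within {0..s + 1})"
    by (rule integral_has_real_derivative[OF g_cont_Icc]) (use assms in auto)
  then show ?thesis
    using assms at_within_interior[of s "{0..s + 1}"] unfolding primitive_def[abs_def] by simp
qed

lemma G_cont: "continuous_on A G"
proof -
  have "isCont G s" for s
  proof -
    let ?b = "max s 0 + 1"
    have 1: "continuous_on {0..?b} G"
      unfolding primitive_def[abs_def]
      by (rule indefinite_integral_continuous_1[OF integrable_continuous_interval[OF g_cont_Icc]])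
    have 2: "continuous_on {..0} G"
      by (rule continuous_on_cong[THEN iffD2, OF refl _ continuous_on_const]) (simp add: G_nonpos_arg)
    have "continuous_on ({..0} \<union> {0..?b}) G"
      by (rule continuous_on_closed_Un) (use 1 2 in auto)
    then have "continuous_on {..?b} G"
      by (rule continuous_on_subset) auto
    then show ?thesis by (rule continuous_on_interior) simp
  qed
  then show ?thesis by (simp add: continuous_at_imp_continuous_on)
qed

lemma G_measurable [measurable]: "G \<in> borel_measurable borel"
  by (rule borel_measurable_continuous_onI[OF G_cont])

lemma G_mono: assumes "a \<le> b" shows "G a \<le> G b"
proof -
  have "G (max 0 a) \<le> G (max 0 b)"
  proof (rule mono_Ici_if_deriv_nonneg[OF G_cont])
    show "\<exists>D. (G has_real_derivative D) (at s) \<and> 0 \<le> D" if "0 < s" for s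
      using G_deriv[OF that] g_pos[OF that] by (intro exI[of _ "g s"]) auto
  qed (use assms in auto)
  then show ?thesis by (auto simp: max_def G_nonpos_arg split: if_splits)
qed

lemma G_nonneg [simp]: "0 \<le> G s"
  using G_mono[of "min 0 s" s] by (simp add: G_nonpos_arg)

text \<open>The difference vanishes at 0, and its derivative \<open>s g' - (g0 - 1) g\<close> is
  nonnegative by the structure condition.\<close>

lemma G_le_sg: assumes "0 \<le> s" shows "g0 * G s \<le> s * g s"
proof -
  let ?f = "\<lambda>s. s * g s - g0 * G s"
  have "?f 0 \<le> ?f s"
  proof (rule mono_Ici_if_deriv_nonneg[OF _ _ _ assms])
    show "continuous_on {0..} ?f" by (intro continuous_intros g_cont G_cont)
    fix s :: real assume s: "0 < s"
    obtain D where D: "(g has_real_derivative D) (at s)" "(g0 - 1) * g s \<le> s * D"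
      using g_deriv s by blast
    have "(?f has_real_derivative (1 * g s + D * s - g0 * g s)) (at s)"
      using s by (auto intro!: derivative_eq_intros D G_deriv)
    then show "\<exists>D. (?f has_real_derivative D) (at s) \<and> 0 \<le> D"
      using D(2) by (intro exI conjI) (auto simp: algebra_simps)
  qed auto
  then show ?thesis by simp
qed

text \<open>The same comparison with the upper exponent: the difference has derivative
  \<open>(g1 - 1) g - s g'\<close>.\<close>

lemma sg_le_G: assumes "0 \<le> s" shows "s * g s \<le> g1 * G s"
proof -
  let ?f = "\<lambda>s. g1 * G s - s * g s"
  have "?f 0 \<le> ?f s"
  proof (rule mono_Ici_if_deriv_nonneg[OF _ _ _ assms])
    show "continuous_on {0..} ?f" by (intro continuous_intros g_cont G_cont)
    fix s :: real assume s: "0 < s"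
    obtain D where D: "(g has_real_derivative D) (at s)" "s * D \<le> (g1 - 1) * g s"
      using g_deriv s by blast
    have "(?f has_real_derivative (g1 * g s - (1 * g s + D * s))) (at s)"
      using s by (auto intro!: derivative_eq_intros D G_deriv)
    then show "\<exists>D. (?f has_real_derivative D) (at s) \<and> 0 \<le> D"
      using D(2) by (intro exI conjI) (auto simp: algebra_simps)
  qed auto
  then show ?thesis by simp
qed

lemma G_pos: assumes "0 < s" shows "0 < G s"
proof -
  have "0 < s * g s" using assms g_pos by simp
  also have "\<dots> \<le> g1 * G s" using sg_le_G assms by simp
  finally show ?thesis using g0_gt g0_le by (simp add: zero_less_mult_iff)
qed

text \<open>As a function of \<open>c\<close>, the logarithm of \<open>G (c * s)\<close> has a
  derivative between \<open>g0 / c\<close> and \<open>g1 / c\<close>; integrating from 1 yields both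
  powers.\<close>

lemma G_scale:
  assumes "1 \<le> c"
  shows G_scale_ge: "c powr g0 * G s \<le> G (c * s)" and G_scale_le: "G (c * s) \<le> c powr g1 * G s"
proof -
  have "c powr g0 * G s \<le> G (c * s) \<and> G (c * s) \<le> c powr g1 * G s" if s: "0 < s"
  proof -
    have D: "((\<lambda>c. ln (G (c * s)) - p * ln c) has_real_derivative
        (inverse (G (x * s)) * (g (x * s) * s) - p * inverse x)) (at x)" if "1 \<le> x" for x p
      using that s G_pos[of "x * s"]
      by (auto intro!: derivative_eq_intros DERIV_chain2[OF DERIV_ln] DERIV_chain2[OF G_deriv] simp: field_simps)
    have 1: "ln (G (1 * s)) - g0 * ln 1 \<le> ln (G (c * s)) - g0 * ln c"
    proof (rule DERIV_nonneg_imp_nondecreasing[OF assms])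
      fix x :: real assume x: "1 \<le> x" "x \<le> c"
      have "0 \<le> inverse (G (x * s)) * (g (x * s) * s) - g0 * inverse x"
        using G_le_sg[of "x * s"] G_pos[of "x * s"] x s by (auto simp: field_simps)
      then show "\<exists>y. ((\<lambda>c. ln (G (c * s)) - g0 * ln c) has_real_derivative y) (at x) \<and> 0 \<le> y"
        using D[OF x(1)] by blast
    qed
    have 2: "ln (G (1 * s)) - g1 * ln 1 \<ge> ln (G (c * s)) - g1 * ln c"
    proof (rule DERIV_nonpos_imp_nonincreasing[OF assms])
      fix x :: real assume x: "1 \<le> x" "x \<le> c"
      have "0 \<ge> inverse (G (x * s)) * (g (x * s) * s) - g1 * inverse x"
        using sg_le_G[of "x * s"] G_pos[of "x * s"] x s by (auto simp: field_simps)
      then show "\<exists>y. ((\<lambda>c. ln (G (c * s)) - g1 * ln c) has_real_derivative y) (at x) \<and> y \<le> 0"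
        using D[OF x(1)] by blast
    qed
    have c: "0 < c" using assms by simp
    have pos: "0 < G s" "0 < G (c * s)" using s c G_pos by auto
    have "ln (c powr g0 * G s) \<le> ln (G (c * s))"
      using 1 pos c by (simp add: ln_mult ln_powr)
    moreover have "ln (G (c * s)) \<le> ln (c powr g1 * G s)"
      using 2 pos c by (simp add: ln_mult ln_powr)
    ultimately show ?thesis using pos c by simp
  qed
  moreover have "G s = 0 \<and> G (c * s) = 0" if "s \<le> 0"
    using that assms by (auto intro!: G_nonpos_arg mult_nonneg_nonpos)
  ultimately show "c powr g0 * G s \<le> G (c * s)" "G (c * s) \<le> c powr g1 * G s"
    by (cases "0 < s"; simp)+
qed

text \<open>The derivative \<open>g\<close> of \<open>G\<close> is nondecreasing, so tangents lie
  below the graph. To the left of 0 the graph is flat while the tangent, of nonnegative slope, only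
  descends.\<close>

lemma G_tangent: "G a + g (max 0 a) * (b - a) \<le> G b" if "0 \<le> a"
proof -
  have pos: "G a + g a * (b - a) \<le> G b" if "0 \<le> b" for b
  proof (cases "a \<le> b")
    case True
    let ?f = "\<lambda>s. G s - g a * s"
    have "?f a \<le> ?f b"
    proof (cases "a = b")
      case False
      show ?thesis
      proof (rule DERIV_nonneg_imp_increasing_open[of a b ?f])
        show "\<exists>y. (?f has_real_derivative y) (at x) \<and> 0 \<le> y" if "a < x" "x < b" for x
          using that \<open>0 \<le> a\<close> g_mono[of a x]
          by (intro exI[of _ "g x - g a * 1"]) (auto intro!: derivative_intros G_deriv)
        show "continuous_on {a..b} ?f" by (intro continuous_intros G_cont)
      qed (use True False in auto)
    qed simp
    then show ?thesis by (simp add: algebra_simps)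
  next
    case False
    let ?f = "\<lambda>s. g a * s - G s"
    have "?f b \<le> ?f a"
    proof (rule DERIV_nonneg_imp_increasing_open[of b a ?f])
      show "\<exists>y. (?f has_real_derivative y) (at x) \<and> 0 \<le> y" if "b < x" "x < a" for x
        using that \<open>0 \<le> b\<close> g_mono[of x a]
        by (intro exI[of _ "g a * 1 - g x"]) (auto intro!: derivative_intros G_deriv)
      show "continuous_on {b..a} ?f" by (intro continuous_intros G_cont)
    qed (use False in auto)
    then show ?thesis by (simp add: algebra_simps)
  qed
  show ?thesis
  proof (cases "0 \<le> b")
    case True then show ?thesis using pos that by (simp add: max_def)
  next
    case False
    have "G a + g a * (b - a) \<le> G a + g a * (0 - a)"
      using False g_nonneg[OF that] by (intro add_left_mono mult_left_mono) auto
    also have "\<dots> \<le> G 0" using pos[of 0] by simp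
    finally show ?thesis using False that by (simp add: G_nonpos_arg max_def)
  qed
qed

text \<open>The supporting line that Jensen's inequality needs, both for convolutions and for
  averages along segments.\<close>

lemma G_support: "\<exists>c\<ge>0. \<forall>b. G a + c * (b - a) \<le> G b"
proof (cases "0 \<le> a")
  case True
  then show ?thesis using G_tangent[OF True] g_nonneg[of "max 0 a"] by (intro exI[of _ "g (max 0 a)"]) auto
qed (auto simp: G_nonpos_arg intro!: exI[of _ 0])

text \<open>This is convexity with \<open>G 0 = 0\<close>, read off from the lower scaling bound
  with factor \<open>1 / c\<close> and exponent \<open>g0 > 1\<close>. It later pulls cutoff factors
  out of \<open>G\<close>.\<close>

lemma G_mult_le: assumes "0 \<le> c" "c \<le> 1" shows "G (c * s) \<le> c * G s"
proof (cases "c = 0 \<or> s \<le> 0")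
  case False
  then have "1 \<le> 1 / c" "0 < c" "0 < s" using assms by auto
  have "1 / c * G (c * s) \<le> (1 / c) powr g0 * G (c * s)"
    using ge_one_powr_ge_zero[of "1 / c" "g0 - 1"] \<open>1 \<le> 1 / c\<close> g0_gt
      powr_mono[of 1 g0 "1 / c"] \<open>0 < c\<close> by (intro mult_right_mono) auto
  also have "\<dots> \<le> G (1 / c * (c * s))" by (rule G_scale_ge[OF \<open>1 \<le> 1 / c\<close>])
  finally show ?thesis using \<open>0 < c\<close> by (simp add: field_simps)
qed (use assms in \<open>auto simp: G_nonpos_arg mult_nonneg_nonpos\<close>)

lemma G_scale_all: assumes "0 \<le> c" shows "G (c * s) \<le> (max 1 c) powr g1 * G s"
proof (cases "c \<le> 1")
  case True
  have "G (c * s) \<le> c * G s" using G_mult_le[OF assms True] .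
  also have "\<dots> \<le> 1 * G s" by (rule mult_right_mono[OF True G_nonneg])
  finally show ?thesis using True by (simp add: max_def split: if_splits)
next
  case False then show ?thesis using G_scale_le[of c s] by (simp add: max_def)
qed

lemma G_add_le: assumes "0 \<le> a" "0 \<le> b" shows "G (a + b) \<le> 2 powr g1 * (G a + G b)"
proof -
  have "G (a + b) \<le> G (2 * max a b)" by (rule G_mono) auto
  also have "\<dots> \<le> 2 powr g1 * G (max a b)" by (rule G_scale_le) simp
  also have "\<dots> \<le> 2 powr g1 * (G a + G b)" by (intro mult_left_mono) (auto simp: max_def)
  finally show ?thesis .
qed

text \<open>Young's inequality without the conjugate function. If \<open>b <= e * a\<close>, the
  product is at most \<open>e * (a * g a)\<close>; otherwise \<open>a <= b / e\<close>, and
  monotonicity of \<open>g\<close> leaves \<open>(b / e) * g (b / e)\<close>. In both cases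
  \<open>s * g s <= g1 * G s\<close> finishes.\<close>

lemma g_young:
  assumes "0 \<le> a" "0 \<le> b" "0 < e" "e \<le> 1"
  shows "g a * b \<le> g1 * (e * G a + G (b / e))"
proof (cases "b \<le> e * a")
  case True
  have "g a * b \<le> g a * (e * a)" using True g_nonneg assms by (intro mult_left_mono) auto
  also have "\<dots> = e * (a * g a)" by simp
  also have "\<dots> \<le> e * (g1 * G a)" using sg_le_G assms by (intro mult_left_mono) auto
  also have "\<dots> \<le> g1 * (e * G a + G (b / e))"
    using g0_gt g0_le by (simp add: algebra_simps)
  finally show ?thesis .
next
  case False
  then have "a \<le> b / e" using assms by (simp add: field_simps)
  have "g a * b \<le> g (b / e) * b" using g_mono[OF assms(1) \<open>a \<le> b / e\<close>] assms by (intro mult_right_mono) auto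
  also have "\<dots> \<le> g (b / e) * (b / e)"
    using assms g_nonneg[of "b / e"] by (intro mult_left_mono) (auto simp: field_simps mult_left_le)
  also have "\<dots> \<le> g1 * G (b / e)" using sg_le_G[of "b / e"] assms by (simp add: mult.commute)
  also have "\<dots> \<le> g1 * (e * G a + G (b / e))"
    using g0_gt g0_le assms by (simp add: algebra_simps)
  finally show ?thesis .
qed

text \<open>Both bounds come from integrating \<open>DA\<close> along the ray from 0 to
  \<open>\<xi>\<close>. For the growth bound the integrand carries a factor \<open>1 / s\<close>; it
  is dominated by the derivative of \<open>g (s * norm \<xi>)\<close>, which is where
  \<open>1 / (g0 - 1)\<close> originates.\<close>

lemma vector_field_bounds:
  fixes A :: "real ^ 'n \<Rightarrow> real ^ 'n"
  assumes A: "vector_field_structure \<nu> L g A" and "0 < \<nu>" "0 < L"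
  shows "\<nu> * G (norm \<xi>) \<le> A \<xi> \<bullet> \<xi>" and "norm (A \<xi>) \<le> L / (g0 - 1) * g (norm \<xi>)"
    and "continuous_on S A" and "A 0 = 0"
proof -
  obtain DA :: "real ^ 'n \<Rightarrow> (real ^ 'n) \<Rightarrow>\<^sub>L (real ^ 'n)" where
    A0: "A 0 = 0" and DA: "\<And>\<xi>. (A has_derivative blinfun_apply (DA \<xi>)) (at \<xi>)"
    and ell: "\<And>\<xi> \<zeta>. \<xi> \<noteq> 0 \<Longrightarrow> blinfun_apply (DA \<xi>) \<zeta> \<bullet> \<zeta> \<ge> \<nu> * (g (norm \<xi>) / norm \<xi>) * (norm \<zeta>)\<^sup>2"
    and bd: "\<And>\<xi>. \<xi> \<noteq> 0 \<Longrightarrow> norm (DA \<xi>) \<le> L * (g (norm \<xi>) / norm \<xi>)"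
    using A unfolding vector_field_structure_def by blast
  show "A 0 = 0" by (rule A0)
  show cont: "continuous_on S A" for S
    using DA by (meson has_derivative_continuous continuous_at_imp_continuous_on)
  have dA: "((\<lambda>s. A (s *\<^sub>R \<xi>)) has_vector_derivative blinfun_apply (DA (s *\<^sub>R \<xi>)) \<xi>) (at s)" for s
  proof -
    have "((\<lambda>s. s *\<^sub>R \<xi>) has_derivative (\<lambda>h. h *\<^sub>R \<xi>)) (at s)"
      by (auto intro!: derivative_eq_intros)
    from has_derivative_compose[OF this DA] show ?thesis
      by (simp add: has_vector_derivative_def blinfun.scaleR_right)
  qed
  have "\<nu> * G (norm \<xi>) \<le> A \<xi> \<bullet> \<xi> \<and> norm (A \<xi>) \<le> L / (g0 - 1) * g (norm \<xi>)" if nz: "\<xi> \<noteq> 0"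
  proof
    have np: "0 < norm \<xi>" using nz by simp
    let ?f = "\<lambda>s. A (s *\<^sub>R \<xi>) \<bullet> \<xi> - \<nu> * G (s * norm \<xi>)"
    have "?f 0 \<le> ?f 1"
    proof (rule DERIV_nonneg_imp_increasing_open[of 0 1 ?f])
      show "continuous_on {0..1} ?f"
        by (intro continuous_intros continuous_on_compose2[OF cont[of UNIV]] continuous_on_compose2[OF G_cont[of UNIV]]) auto
      fix s :: real assume s: "0 < s" "s < 1"
      let ?d = "blinfun_apply (DA (s *\<^sub>R \<xi>)) \<xi> \<bullet> \<xi> - \<nu> * (g (s * norm \<xi>) * norm \<xi>)"
      have 1: "((\<lambda>s. A (s *\<^sub>R \<xi>) \<bullet> \<xi>) has_real_derivative blinfun_apply (DA (s *\<^sub>R \<xi>)) \<xi> \<bullet> \<xi>) (at s)"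
        using dA[of s] unfolding has_vector_derivative_def has_field_derivative_def
        by (auto intro!: derivative_eq_intros simp: fun_eq_iff)
      have 2: "((\<lambda>s. G (s * norm \<xi>)) has_real_derivative g (s * norm \<xi>) * norm \<xi>) (at s)"
        using s np by (auto intro!: derivative_eq_intros DERIV_chain2[OF G_deriv])
      have "(?f has_real_derivative ?d) (at s)"
        using DERIV_diff[OF 1 DERIV_cmult[OF 2]] .
      \<comment> \<open>Since \<open>s < 1\<close>, the factor \<open>1 / s\<close> in the
        ellipticity bound may be dropped, and what remains is the derivative of
        \<open>\<nu> * G (s * norm \<xi>)\<close>.\<close>
      moreover have "\<nu> * (g (s * norm \<xi>) * norm \<xi>) \<le> \<nu> * (g (norm (s *\<^sub>R \<xi>)) / norm (s *\<^sub>R \<xi>)) * (norm \<xi>)\<^sup>2"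
      proof -
        have "g (s * norm \<xi>) * norm \<xi> * s \<le> g (s * norm \<xi>) * norm \<xi> * 1"
          using s np g_nonneg[of "s * norm \<xi>"] by (intro mult_left_mono) auto
        then have "g (s * norm \<xi>) * norm \<xi> \<le> (g (norm (s *\<^sub>R \<xi>)) / norm (s *\<^sub>R \<xi>)) * (norm \<xi>)\<^sup>2"
          using s np by (simp add: field_simps power2_eq_square)
        from mult_left_mono[OF this, of \<nu>] show ?thesis
          using \<open>0 < \<nu>\<close> by (simp only: mult.assoc less_imp_le)
      qed
      moreover have "\<nu> * (g (norm (s *\<^sub>R \<xi>)) / norm (s *\<^sub>R \<xi>)) * (norm \<xi>)\<^sup>2 \<le> blinfun_apply (DA (s *\<^sub>R \<xi>)) \<xi> \<bullet> \<xi>"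
        using ell[of "s *\<^sub>R \<xi>" \<xi>] s nz by auto
      ultimately show "\<exists>y. (?f has_real_derivative y) (at s) \<and> 0 \<le> y" by fastforce
    qed simp
    then show "\<nu> * G (norm \<xi>) \<le> A \<xi> \<bullet> \<xi>" by (simp add: A0)
    let ?c = "L / (g0 - 1)"
    have "norm (A (1 *\<^sub>R \<xi>) - A (0 *\<^sub>R \<xi>)) \<le> ?c * g (1 * norm \<xi>) - ?c * g (0 * norm \<xi>)"
    proof (rule differentiable_bound_general[of 0 1 "\<lambda>s. A (s *\<^sub>R \<xi>)" "\<lambda>s. ?c * g (s * norm \<xi>)"])
      show "continuous_on {0..1} (\<lambda>s. A (s *\<^sub>R \<xi>))"
        by (intro continuous_intros continuous_on_compose2[OF cont[of UNIV]]) auto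
      show "continuous_on {0..1} (\<lambda>s. ?c * g (s * norm \<xi>))"
        by (intro continuous_intros continuous_on_compose2[OF g_cont]) auto
      fix s :: real assume s: "0 < s" "s < 1"
      show "((\<lambda>s. A (s *\<^sub>R \<xi>)) has_vector_derivative blinfun_apply (DA (s *\<^sub>R \<xi>)) \<xi>) (at s)" by (rule dA)
      define g' where "g' = (SOME g'. \<forall>s>0. (g has_real_derivative g' s) (at s) \<and>
          (g0 - 1) * g s \<le> s * g' s \<and> s * g' s \<le> (g1 - 1) * g s)"
      have g': "\<And>s. 0 < s \<Longrightarrow> (g has_real_derivative g' s) (at s)"
        "\<And>s. 0 < s \<Longrightarrow> (g0 - 1) * g s \<le> s * g' s"
        using someI_ex[OF g_deriv] unfolding g'_def by blast+
      have "((\<lambda>s. ?c * g (s * norm \<xi>)) has_real_derivative ?c * (g' (s * norm \<xi>) * norm \<xi>)) (at s)"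
        using s np by (auto simp: g0_gt[THEN less_imp_neq, symmetric] intro!: derivative_eq_intros DERIV_chain2[OF g'(1)])
      then show "((\<lambda>s. ?c * g (s * norm \<xi>)) has_vector_derivative ?c * (g' (s * norm \<xi>) * norm \<xi>)) (at s)"
        by (simp add: has_real_derivative_iff_has_vector_derivative)
      have "norm (blinfun_apply (DA (s *\<^sub>R \<xi>)) \<xi>) \<le> norm (DA (s *\<^sub>R \<xi>)) * norm \<xi>"
        by (rule norm_blinfun)
      also have "\<dots> \<le> L * (g (norm (s *\<^sub>R \<xi>)) / norm (s *\<^sub>R \<xi>)) * norm \<xi>"
        using bd[of "s *\<^sub>R \<xi>"] s nz by (intro mult_right_mono) auto
      also have "\<dots> = L * (g (s * norm \<xi>) / s)" using s np by simp
      \<comment> \<open>The inequality \<open>(g0 - 1) * g r <= r * g' r\<close> at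
        \<open>r = s * norm \<xi>\<close> removes the singular factor \<open>1 / s\<close>.\<close>
      also have "\<dots> \<le> L * (g' (s * norm \<xi>) * norm \<xi> / (g0 - 1))"
      proof -
        have "g (s * norm \<xi>) / s \<le> g' (s * norm \<xi>) * norm \<xi> / (g0 - 1)"
          using g'(2)[of "s * norm \<xi>"] s np g0_gt by (simp add: field_simps)
        then show ?thesis using \<open>0 < L\<close> by (intro mult_left_mono) auto
      qed
      finally show "norm (blinfun_apply (DA (s *\<^sub>R \<xi>)) \<xi>) \<le> ?c * (g' (s * norm \<xi>) * norm \<xi>)"
        using g0_gt by simp
    qed simp
    moreover have "0 \<le> ?c * g 0" using g_nonneg[of 0] \<open>0 < L\<close> g0_gt by simp
    ultimately show "norm (A \<xi>) \<le> ?c * g (norm \<xi>)" by (simp add: A0)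
  qed
  moreover have "0 \<le> L / (g0 - 1) * g 0" using g_nonneg[of 0] \<open>0 < L\<close> g0_gt by simp
  ultimately show "\<nu> * G (norm \<xi>) \<le> A \<xi> \<bullet> \<xi>" "norm (A \<xi>) \<le> L / (g0 - 1) * g (norm \<xi>)"
    by (cases "\<xi> = 0"; simp add: A0)+
qed

end

subsection \<open>A smooth bump function\<close>

lemma Ck_SucE:
  assumes "Ck (Suc k) f"
  shows "(f has_derivative frechet_derivative f (at x)) (at x)"
    and "b \<in> Basis \<Longrightarrow> Ck k (\<lambda>x. frechet_derivative f (at x) b)"
  using assms by (auto simp: differentiable_on_def frechet_derivative_works)

lemma Ck_SucI:
  assumes "\<And>x. (f has_derivative f' x) (at x)" "\<And>b. b \<in> Basis \<Longrightarrow> Ck k (\<lambda>x. f' x b)"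
  shows "Ck (Suc k) f"
  using assms frechet_derivative_at[OF assms(1)]
  by (auto simp: differentiable_on_def differentiable_def)

lemma Ck_Suc_imp: "Ck (Suc k) f \<Longrightarrow> Ck k f"
  by (induction k arbitrary: f) (auto intro: differentiable_imp_continuous_on)

lemma Ck_continuous: "Ck k f \<Longrightarrow> continuous_on A f"
  by (induction k) (auto intro: Ck_Suc_imp continuous_on_subset dest: differentiable_imp_continuous_on)

lemma Ck_const: "Ck k (\<lambda>_. c)"
  by (induction k arbitrary: c) (auto intro!: Ck_SucI[of _ "\<lambda>_ _. 0"] simp del: Ck.simps(2))

lemma Ck_add: "Ck k f \<Longrightarrow> Ck k h \<Longrightarrow> Ck k (\<lambda>x. f x + h x)"
proof (induction k arbitrary: f h)
  case (Suc k)
  show ?case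
    by (rule Ck_SucI[OF has_derivative_add[OF Ck_SucE(1)[OF Suc.prems(1)] Ck_SucE(1)[OF Suc.prems(2)]]])
      (intro Suc.IH Ck_SucE(2) Suc.prems)
qed (auto intro: continuous_intros)

lemma Ck_mult: "Ck k f \<Longrightarrow> Ck k h \<Longrightarrow> Ck k (\<lambda>x. f x * h x)"
proof (induction k arbitrary: f h)
  case (Suc k)
  show ?case
    by (rule Ck_SucI[OF has_derivative_mult[OF Ck_SucE(1)[OF Suc.prems(1)] Ck_SucE(1)[OF Suc.prems(2)]]])
      (intro Ck_add Suc.IH Ck_SucE(2) Suc.prems Ck_Suc_imp)
qed (auto intro: continuous_intros)

lemma Ck_sum: "(\<And>i. i \<in> I \<Longrightarrow> Ck k (f i)) \<Longrightarrow> Ck k (\<lambda>x. \<Sum>i\<in>I. f i x)"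
  by (induction I rule: infinite_finite_induct) (auto intro: Ck_const Ck_add)

lemma Ck_inner_const: "Ck k (\<lambda>z. z \<bullet> a)"
proof (cases k)
  case (Suc j)
  show ?thesis unfolding Suc
    by (rule Ck_SucI[of _ "\<lambda>_ h. h \<bullet> a"]) (auto intro!: derivative_eq_intros Ck_const)
qed (auto intro!: continuous_intros)

lemma Ck_inner_self: "Ck k (\<lambda>z::'a::euclidean_space. z \<bullet> z)"
proof -
  have "(\<lambda>z::'a. z \<bullet> z) = (\<lambda>z. \<Sum>b\<in>Basis. (z \<bullet> b) * (z \<bullet> b))"
    by (rule ext) (rule euclidean_inner)
  moreover have "Ck k (\<lambda>z::'a. \<Sum>b\<in>Basis. (z \<bullet> b) * (z \<bullet> b))"
    by (intro Ck_sum Ck_mult Ck_inner_const)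
  ultimately show ?thesis by (simp only:)
qed

text \<open>The whole sequence of successive derivatives \<open>h j\<close> enters, because
  differentiating the composition replaces \<open>h j\<close> by \<open>h (Suc j)\<close>;
  generalising over \<open>j\<close> closes the induction.\<close>

lemma Ck_compose_real:
  assumes "\<And>j x. (h j has_real_derivative h (Suc j) x) (at x)" and "\<And>k. Ck k p"
  shows "Ck k (\<lambda>z. h j (p z))"
proof (induction k arbitrary: j)
  case 0
  have "continuous_on UNIV (h j)" by (rule DERIV_continuous_on) (use assms(1) in auto)
  then show ?case using Ck_continuous[OF assms(2)] by (auto intro: continuous_on_compose2)
next
  case (Suc k)
  have "((\<lambda>z. h j (p z)) has_derivative (\<lambda>b. h (Suc j) (p x) * frechet_derivative p (at x) b)) (at x)" for x
    using has_derivative_compose[OF Ck_SucE(1)[OF assms(2)] assms(1)[unfolded has_field_derivative_def]] .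
  then show ?case
    by (rule Ck_SucI) (intro Ck_mult Suc Ck_SucE(2) assms)
qed

text \<open>Needed because a convolution at \<open>z\<close> tests with the reflected kernel
  \<open>w \<mapsto> \<kappa> (z - w)\<close>.\<close>

lemma Ck_reflect: "Ck k f \<Longrightarrow> Ck k (\<lambda>w. f (z - w))"
proof (induction k arbitrary: f)
  case 0 then show ?case by (auto intro!: continuous_intros intro: continuous_on_compose2)
next
  case (Suc k)
  have 1: "((\<lambda>w. z - w) has_derivative (\<lambda>h. - h)) (at w)" for w
    by (auto intro!: derivative_eq_intros)
  have 2: "((\<lambda>w. f (z - w)) has_derivative (\<lambda>h. frechet_derivative f (at (z - w)) (- h))) (at w)" for w
    by (rule has_derivative_compose[OF 1 Ck_SucE(1)[OF Suc.prems]])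
  have 3: "frechet_derivative f (at (z - w)) (- h) = - 1 * frechet_derivative f (at (z - w)) h" for w h
    using linear_neg[OF has_derivative_linear[OF Ck_SucE(1)[OF Suc.prems]]] by simp
  show ?case
    by (rule Ck_SucI[OF 2[unfolded 3]]) (intro Ck_mult Ck_const Suc.IH Ck_SucE(2)[OF Suc.prems])
qed

text \<open>The recursion is the product rule: the derivative of
  \<open>p (1 / s) * exp (- 1 / s)\<close> is
  \<open>(1 / s)^2 * (p - p') (1 / s) * exp (- 1 / s)\<close>.\<close>

primrec flat_poly :: "nat \<Rightarrow> real poly" where
  "flat_poly 0 = 1"
| "flat_poly (Suc j) = [:0, 0, 1:] * (flat_poly j - pderiv (flat_poly j))"

text \<open>The \<open>j\<close>-th derivative of \<open>exp (- 1 / s)\<close>, extended by zero to \<open>s \<le> 0\<close>.\<close>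

definition flat :: "nat \<Rightarrow> real \<Rightarrow> real" where
  "flat j s = (if 0 < s then poly (flat_poly j) (1 / s) * exp (- (1 / s)) else 0)"

lemma poly_exp_minus_tendsto: "((\<lambda>y. poly p y * exp (- y)) \<longlongrightarrow> (0::real)) at_top"
proof -
  have "((\<lambda>y. \<Sum>i\<le>degree p. coeff p i * (y ^ i / exp y)) \<longlongrightarrow> (\<Sum>i\<le>degree p. coeff p i * 0)) at_top"
    by (intro tendsto_intros tendsto_power_div_exp_0)
  then show ?thesis by (simp add: poly_altdef sum_distrib_right exp_minus sum_divide_distrib field_simps)
qed

lemma flat_deriv: "(flat j has_real_derivative flat (Suc j) x) (at x)"
proof -
  consider "x < 0" | "x = 0" | "0 < x" by linarith
  then show ?thesis
  proof cases
    case 1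
    have "((\<lambda>_. 0) has_real_derivative 0) (at x)" by simp
    then have "(flat j has_real_derivative 0) (at x)"
      by (rule has_field_derivative_transform_within_open[of _ _ _ "{..<0}"]) (use 1 in \<open>auto simp: flat_def\<close>)
    then show ?thesis using 1 by (simp add: flat_def)
  next
    case 3
    have "((\<lambda>s. poly (flat_poly j) (1 / s) * exp (- (1 / s))) has_real_derivative flat (Suc j) x) (at x)"
      using 3 by (auto intro!: derivative_eq_intros DERIV_chain2[OF poly_DERIV]
          simp: flat_def field_simps power2_eq_square)
    then show ?thesis
      by (rule has_field_derivative_transform_within_open[of _ _ _ "{0<..}"]) (use 3 in \<open>auto simp: flat_def\<close>)
  next
    case 2
    have "((\<lambda>y. flat j y / y) \<longlongrightarrow> 0) (at_right 0)"
    proof -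
      \<comment> \<open>\<open>pCons 0\<close> multiplies the polynomial by its argument
        \<open>1 / y\<close>, which accounts for the division in the difference quotient at
        0.\<close>
      have "((\<lambda>y. poly (pCons 0 (flat_poly j)) (inverse y) * exp (- inverse y)) \<longlongrightarrow> 0) (at_right (0::real))"
        by (rule filterlim_compose[OF poly_exp_minus_tendsto filterlim_inverse_at_top_right])
      then show ?thesis
        by (rule Lim_transform_eventually)
          (auto simp: eventually_at_filter flat_def field_simps)
    qed
    moreover have "((\<lambda>y. flat j y / y) \<longlongrightarrow> 0) (at_left 0)"
      by (rule Lim_transform_eventually[OF tendsto_const])
        (auto simp: eventually_at_filter flat_def)
    ultimately have "((\<lambda>y. flat j y / y) \<longlongrightarrow> 0) (at 0)" by (rule filterlim_split_at[rotated])
    then show ?thesis using 2 by (simp add: has_field_derivative_iff flat_def)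
  qed
qed

definition mollifier :: "real \<Rightarrow> ('a::euclidean_space \<Rightarrow> real) \<Rightarrow> bool" where
  "mollifier r \<kappa> \<longleftrightarrow> (\<forall>k. Ck k \<kappa>) \<and> (\<forall>z. 0 \<le> \<kappa> z) \<and> (\<forall>z. \<kappa> z \<noteq> 0 \<longrightarrow> norm z < r) \<and>
     integrable lborel \<kappa> \<and> (\<integral>z. \<kappa> z \<partial>lborel) = 1"

lemma integrable_cont_compact_support:
  fixes f :: "'a::euclidean_space \<Rightarrow> 'b::{banach, second_countable_topology}"
  assumes "continuous_on UNIV f" "compact S" "\<And>z. z \<notin> S \<Longrightarrow> f z = 0"
  shows "integrable lborel f"
proof -
  have "integrable lborel (\<lambda>z. indicator S z *\<^sub>R f z)"
    by (rule borel_integrable_compact[OF assms(2) continuous_on_subset[OF assms(1) subset_UNIV]])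
  also have "(\<lambda>z. indicator S z *\<^sub>R f z) = f" using assms(3) by (auto simp: indicator_def)
  finally show ?thesis .
qed

text \<open>The classical bump exp(-1/(1 - |z|^2/r^2)) divided by its integral. The squared norm,
  rather than the norm, keeps the inner function smooth at the origin.\<close>

lemma mollifier_exists:
  assumes "0 < r"
  shows "\<exists>\<kappa> :: 'a::euclidean_space \<Rightarrow> real. mollifier r \<kappa>"
proof -
  define p where "p z = 1 + (- 1 / r\<^sup>2) * (z \<bullet> z)" for z :: 'a
  define f where "f z = flat 0 (p z)" for z :: 'a
  have p: "Ck k p" for k unfolding p_def by (intro Ck_add Ck_mult Ck_const Ck_inner_self)
  have f: "Ck k f" for k unfolding f_def by (rule Ck_compose_real[of flat p, OF flat_deriv p])
  have ppos: "0 < p z \<longleftrightarrow> norm z < r" for z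
  proof -
    have "0 < p z \<longleftrightarrow> (norm z)\<^sup>2 < r\<^sup>2" using assms by (simp add: p_def dot_square_norm field_simps)
    also have "\<dots> \<longleftrightarrow> norm z < r" using assms by (simp add: power_mono_iff linorder_not_le[symmetric])
    finally show ?thesis .
  qed
  have f0: "0 \<le> f z" for z by (simp add: f_def flat_def)
  have fpos: "0 < f z \<longleftrightarrow> norm z < r" for z using ppos by (auto simp: f_def flat_def)
  have fz: "f z = 0" if "\<not> norm z < r" for z using fpos[of z] f0[of z] that by linarith
  have int: "integrable lborel f"
    by (rule integrable_cont_compact_support[OF Ck_continuous[OF f] compact_cball[of 0 r]])
      (auto intro!: fz)
  have "(\<integral>z. f z \<partial>lborel) \<noteq> 0"
  proof
    assume "(\<integral>z. f z \<partial>lborel) = 0"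
    then have "AE z in lborel. f z = 0"
      using integral_nonneg_eq_0_iff_AE[OF int] f0 by simp
    then have "AE z in lborel. z \<notin> ball (0::'a) r"
      by eventually_elim (use fpos in \<open>auto simp: less_le\<close>)
    then have "emeasure lborel (ball (0::'a) r) = 0"
      by (subst (asm) AE_iff_measurable[of "ball 0 r"]) auto
    then have "measure lborel (ball (0::'a) r) = 0" by (simp add: measure_def)
    then show False using content_ball_pos[OF assms, of "0::'a"] by simp
  qed
  moreover have "0 \<le> (\<integral>z. f z \<partial>lborel)" using f0 by simp
  ultimately have pos: "0 < (\<integral>z. f z \<partial>lborel)" by simp
  have "mollifier r (\<lambda>z. (1 / (\<integral>z. f z \<partial>lborel)) * f z)"
    unfolding mollifier_def
  proof (intro conjI allI impI)
    show "Ck k (\<lambda>z. 1 / (\<integral>z. f z \<partial>lborel) * f z)" for k by (intro Ck_mult Ck_const f)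
    show "norm z < r" if "1 / (\<integral>z. f z \<partial>lborel) * f z \<noteq> 0" for z using that fz by auto
  qed (use int f0 pos in auto)
  then show ?thesis by blast
qed

text \<open>Defined on every Euclidean space, because mollifiers live on space-time, while
  \<open>gradient\<close> is restricted to functions of the space variable.\<close>

definition grad :: "('a::euclidean_space \<Rightarrow> real) \<Rightarrow> 'a \<Rightarrow> 'a" where
  "grad f z = (\<Sum>b\<in>Basis. frechet_derivative f (at z) b *\<^sub>R b)"

lemma grad:
  assumes "\<And>k. Ck k f"
  shows grad_deriv: "(f has_derivative (\<lambda>h. grad f z \<bullet> h)) (at z)"
    and grad_cont: "continuous_on A (grad f)"
proof -
  have D: "(f has_derivative frechet_derivative f (at z)) (at z)" for z by (rule Ck_SucE[OF assms])
  have "frechet_derivative f (at z) h = grad f z \<bullet> h" for h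
  proof -
    interpret linear "frechet_derivative f (at z)" using D by (rule has_derivative_linear)
    have "frechet_derivative f (at z) h = frechet_derivative f (at z) (\<Sum>b\<in>Basis. (h \<bullet> b) *\<^sub>R b)"
      by (simp add: euclidean_representation)
    also have "\<dots> = (\<Sum>b\<in>Basis. (h \<bullet> b) * frechet_derivative f (at z) b)"
      by (simp add: sum scale)
    also have "\<dots> = grad f z \<bullet> h"
      unfolding grad_def inner_sum_left by (intro sum.cong refl) (simp add: inner_commute)
    finally show ?thesis .
  qed
  then have "frechet_derivative f (at z) = (\<lambda>h. grad f z \<bullet> h)" by (rule ext)
  with D[of z] show "(f has_derivative (\<lambda>h. grad f z \<bullet> h)) (at z)" by (simp only:)
  show "continuous_on A (grad f)"
    unfolding grad_def
    by (intro continuous_intros Ck_continuous[OF Ck_SucE(2)[OF assms]])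
qed

subsection \<open>Mollification\<close>

lemma lborel_distr_reflect: "distr lborel borel (\<lambda>w. z - w) = (lborel :: 'a::euclidean_space measure)"
  using lborel_affine[of "- 1" z] by (simp add: density_1)

lemma lborel_distr_translate: "distr lborel borel (\<lambda>w. z + w) = (lborel :: 'a::euclidean_space measure)"
  using lborel_distr_plus[of z] by simp

lemma nn_integral_lborel_translate:
  assumes [measurable]: "f \<in> borel_measurable borel"
  shows "(\<integral>\<^sup>+w. f (z + w) \<partial>lborel) = (\<integral>\<^sup>+w. f w \<partial>lborel)"
  by (subst (2) lborel_distr_translate[of z, symmetric]) (simp add: nn_integral_distr)

lemma lborel_integral_translate:
  fixes f :: "'a::euclidean_space \<Rightarrow> 'b::{banach, second_countable_topology}"
  assumes [measurable]: "f \<in> borel_measurable borel"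
  shows "(\<integral>w. f (z + w) \<partial>lborel) = (\<integral>w. f w \<partial>lborel)"
  by (subst (2) lborel_distr_translate[of z, symmetric]) (simp add: integral_distr)

lemma lborel_integrable_translate:
  fixes f :: "'a::euclidean_space \<Rightarrow> 'b::{banach, second_countable_topology}"
  assumes "integrable lborel f"
  shows "integrable lborel (\<lambda>w. f (z + w))"
  using assms integrable_distr[of "\<lambda>w. z + w" lborel borel f] by (simp add: lborel_distr_translate)

lemma lborel_integral_reflect:
  fixes f :: "'a::euclidean_space \<Rightarrow> 'b::{banach, second_countable_topology}"
  assumes [measurable]: "f \<in> borel_measurable borel"
  shows "(\<integral>w. f (z - w) \<partial>lborel) = (\<integral>w. f w \<partial>lborel)"
  by (subst (2) lborel_distr_reflect[of z, symmetric]) (simp add: integral_distr)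

lemma lborel_integrable_reflect:
  fixes f :: "'a::euclidean_space \<Rightarrow> 'b::{banach, second_countable_topology}"
  assumes "integrable lborel f"
  shows "integrable lborel (\<lambda>w. f (z - w))"
  using assms integrable_distr[of "\<lambda>w. z - w" lborel borel f] by (simp add: lborel_distr_reflect)

text \<open>Every point of an open set stays in it under small translations, so the measure of the
  overlap tends to the full measure by dominated convergence. Translation preserves measure, hence
  the symmetric difference is twice the measure minus twice the overlap.\<close>

lemma L1_translation_continuous_open:
  fixes U :: "'a::euclidean_space set"
  assumes "open U" "emeasure lborel U < \<infinity>" "0 < e"
  shows "\<exists>d>0. \<forall>y. norm y < d \<longrightarrow> (\<integral>x. \<bar>indicator U (y + x) - indicator U x\<bar> \<partial>lborel) < (e::real)"
proof (rule ccontr)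
  have [measurable]: "U \<in> sets borel" using assms by simp
  assume "\<not> ?thesis"
  then have "\<forall>n::nat. \<exists>y. norm y < 1 / (n + 1) \<and> \<not> (\<integral>x. \<bar>indicator U (y + x) - indicator U x\<bar> \<partial>lborel) < e"
    by (metis of_nat_0_le_iff add_nonneg_pos zero_less_divide_1_iff zero_less_one)
  then obtain y :: "nat \<Rightarrow> 'a" where y: "\<And>n. norm (y n) < 1 / (n + 1)"
    "\<And>n. \<not> (\<integral>x. \<bar>indicator U (y n + x) - indicator U x\<bar> \<partial>lborel) < e" by metis
  have y0: "y \<longlonglongrightarrow> 0"
    by (rule LIMSEQ_norm_0) (use y(1) in \<open>auto simp: less_imp_le add.commute\<close>)
  have int: "integrable lborel (indicator U :: 'a \<Rightarrow> real)" using assms by simp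
  have lim: "(\<lambda>n. \<integral>x. indicator U (y n + x) * indicator U x \<partial>lborel) \<longlonglongrightarrow> (\<integral>x. (indicator U x :: real) \<partial>lborel)"
  proof (rule integral_dominated_convergence[OF _ _ int])
    show "AE x in lborel. (\<lambda>n. indicator U (y n + x) * indicator U x :: real) \<longlonglongrightarrow> indicator U x"
    proof (rule AE_I2)
      fix x
      show "(\<lambda>n. indicator U (y n + x) * indicator U x :: real) \<longlonglongrightarrow> indicator U x"
      proof (cases "x \<in> U")
        case True
        have "(\<lambda>n. y n + x) \<longlonglongrightarrow> 0 + x" by (intro tendsto_intros y0)
        then have "eventually (\<lambda>n. y n + x \<in> U) sequentially"
          using \<open>open U\<close> True by (auto dest: topological_tendstoD)
        then show ?thesis
          by (intro tendsto_eventually, eventually_elim) (use True in simp)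
      qed simp
    qed
  qed (auto simp: indicator_def)
  have eq: "(\<integral>x. \<bar>indicator U (y n + x) - indicator U x\<bar> \<partial>lborel) =
      2 * (\<integral>x. (indicator U x :: real) \<partial>lborel) - 2 * (\<integral>x. indicator U (y n + x) * indicator U x \<partial>lborel)" for n
  proof -
    have i2: "integrable lborel (\<lambda>x. indicator U (y n + x) * indicator U x :: real)"
      by (rule Bochner_Integration.integrable_bound[OF int]) (auto simp: indicator_def)
    have i1: "integrable lborel (\<lambda>x. indicator U (y n + x) :: real)"
      by (rule lborel_integrable_translate[OF int])
    have "(\<integral>x. \<bar>indicator U (y n + x) - indicator U x\<bar> \<partial>lborel) =
        (\<integral>x. indicator U (y n + x) + indicator U x - 2 * (indicator U (y n + x) * indicator U x :: real) \<partial>lborel)"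
      by (intro Bochner_Integration.integral_cong) (auto simp: indicator_def)
    also have "\<dots> = (\<integral>x. (indicator U (y n + x) :: real) \<partial>lborel) + (\<integral>x. (indicator U x :: real) \<partial>lborel)
        - 2 * (\<integral>x. indicator U (y n + x) * indicator U x \<partial>lborel)"
      using i1 i2 int by simp
    also have "(\<integral>x. (indicator U (y n + x) :: real) \<partial>lborel) = (\<integral>x. (indicator U x :: real) \<partial>lborel)"
      by (rule lborel_integral_translate) measurable
    finally show ?thesis by simp
  qed
  have "(\<lambda>n. \<integral>x. \<bar>indicator U (y n + x) - indicator U x\<bar> \<partial>lborel) \<longlonglongrightarrow>
      2 * (\<integral>x. (indicator U x :: real) \<partial>lborel) - 2 * (\<integral>x. (indicator U x :: real) \<partial>lborel)"
    unfolding eq by (intro tendsto_intros lim)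
  then have "eventually (\<lambda>n. (\<integral>x. \<bar>indicator U (y n + x) - indicator U x\<bar> \<partial>lborel) < e) sequentially"
    using \<open>0 < e\<close> by (auto dest: order_tendstoD(2))
  then show False using y(2) by (auto simp: eventually_sequentially)
qed

text \<open>Translation is an isometry of L^1, so replacing \<open>f\<close> by an approximation
  \<open>h\<close> costs the distance exactly twice.\<close>

lemma L1_translation_perturb:
  fixes f h :: "'a::euclidean_space \<Rightarrow> 'b::{banach, second_countable_topology}"
  assumes f: "integrable lborel f" and h: "integrable lborel h"
  shows "(\<integral>x. norm (f (y + x) - f x) \<partial>lborel) \<le>
    (\<integral>x. norm (h (y + x) - h x) \<partial>lborel) + 2 * (\<integral>x. norm (f x - h x) \<partial>lborel)"
proof -
  have i: "integrable lborel (\<lambda>x. f (y + x))" "integrable lborel (\<lambda>x. h (y + x))"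
    using f h by (auto intro: lborel_integrable_translate)
  have m: "f \<in> borel_measurable borel" "h \<in> borel_measurable borel" using f h by auto
  have "(\<integral>x. norm (f (y + x) - f x) \<partial>lborel) \<le>
      (\<integral>x. norm (h (y + x) - h x) + norm (f (y + x) - h (y + x)) + norm (f x - h x) \<partial>lborel)"
  proof (rule integral_mono)
    fix x
    have "f (y + x) - f x = (h (y + x) - h x) + (f (y + x) - h (y + x)) - (f x - h x)" by simp
    then show "norm (f (y + x) - f x) \<le> norm (h (y + x) - h x) + norm (f (y + x) - h (y + x)) + norm (f x - h x)"
      by (metis norm_triangle_le_diff norm_triangle_ineq add_mono order_refl)
  qed (intro Bochner_Integration.integrable_add integrable_norm Bochner_Integration.integrable_diff f h i)+
  also have "\<dots> = (\<integral>x. norm (h (y + x) - h x) \<partial>lborel) + (\<integral>x. norm (f (y + x) - h (y + x)) \<partial>lborel)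
      + (\<integral>x. norm (f x - h x) \<partial>lborel)"
    using f h i by simp
  also have "(\<integral>x. norm (f (y + x) - h (y + x)) \<partial>lborel) = (\<integral>x. norm (f x - h x) \<partial>lborel)"
    by (rule lborel_integral_translate[of "\<lambda>x. norm (f x - h x)"]) (use m in measurable)
  finally show ?thesis by simp
qed

text \<open>Induction over integrable functions: indicators are approximated by open sets through
  outer regularity, sums use the triangle inequality, and limits use the perturbation bound.\<close>

lemma L1_translation_continuous:
  fixes f :: "'a::euclidean_space \<Rightarrow> 'b::{banach, second_countable_topology}"
  assumes "integrable lborel f" "0 < e"
  shows "\<exists>d>0. \<forall>y. norm y < d \<longrightarrow> (\<integral>x. norm (f (y + x) - f x) \<partial>lborel) < e"
  using assms
proof (induction arbitrary: e)
  case (base A c e)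
  \<comment> \<open>Three contributions of size \<open>e'\<close> arise: one from translating the
    open set and two from the approximation. Adding 1 to \<open>norm c\<close> avoids division by
    zero.\<close>
  define e' where "e' = e / (3 * (norm c + 1))"
  have e': "0 < e'" using base unfolding e'_def by (simp add: add_nonneg_pos)
  obtain U where U: "open U" "A \<subseteq> U" "emeasure lborel (U - A) < e'"
    using outer_regular_lborel[of A e'] base e' by auto
  have A: "A \<in> sets borel" using base by simp
  have [measurable]: "U \<in> sets borel" "A \<in> sets borel" using U A by auto
  have "emeasure lborel U \<le> emeasure lborel A + emeasure lborel (U - A)"
    using U(2) by (subst plus_emeasure) (auto intro!: emeasure_mono)
  also have "\<dots> < \<infinity>" using base(2) U(3) by (auto simp: less_top[symmetric] dest: order.strict_trans)
  finally have Uf: "emeasure lborel U < \<infinity>" .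
  obtain d where d: "0 < d" "\<And>y. norm y < d \<Longrightarrow> (\<integral>x. \<bar>indicator U (y + x) - indicator U x\<bar> \<partial>lborel) < e'"
    using L1_translation_continuous_open[OF U(1) Uf e'] by blast
  have iA: "integrable lborel (indicator A :: 'a \<Rightarrow> real)" "integrable lborel (indicator U :: 'a \<Rightarrow> real)"
    using base Uf by auto
  have "(\<integral>x. norm (indicator A (y + x) *\<^sub>R c - indicator A x *\<^sub>R c) \<partial>lborel) < e" if "norm y < d" for y
  proof -
    have "(\<integral>x. norm (indicator A x - indicator U x :: real) \<partial>lborel) = (\<integral>x. indicator (U - A) x \<partial>lborel)"
      by (intro Bochner_Integration.integral_cong) (use U(2) in \<open>auto simp: indicator_def\<close>)
    also have "\<dots> = measure lborel (U - A)" by simp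
    also have "\<dots> \<le> e'" unfolding measure_def by (rule enn2real_leI) (use U(3) e' in auto)
    finally have "(\<integral>x. norm (indicator A x - indicator U x :: real) \<partial>lborel) \<le> e'" .
    then have "(\<integral>x. norm (indicator A (y + x) - indicator A x :: real) \<partial>lborel) < 3 * e'"
      using L1_translation_perturb[OF iA, of y] d(2)[OF that] by simp
    then have "(\<integral>x. norm (indicator A (y + x) - indicator A x :: real) \<partial>lborel) * norm c \<le> 3 * e' * norm c"
      by (intro mult_right_mono) auto
    also have "\<dots> < 3 * e' * (norm c + 1)" using e' by simp
    also have "\<dots> = e"
    proof -
      have "norm c + 1 \<noteq> 0" "3 * norm c + 3 \<noteq> 0" using norm_ge_zero[of c] by linarith+
      then show ?thesis unfolding e'_def by (simp add: field_simps)
    qed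
    finally show ?thesis
      by (simp add: scaleR_diff_left[symmetric])
  qed
  then show ?case using d(1) by blast
next
  case (add f h)
  obtain d1 where d1: "0 < d1" "\<And>y. norm y < d1 \<Longrightarrow> (\<integral>x. norm (f (y + x) - f x) \<partial>lborel) < e / 2"
    using add.IH(1)[of "e / 2"] add.prems by auto
  obtain d2 where d2: "0 < d2" "\<And>y. norm y < d2 \<Longrightarrow> (\<integral>x. norm (h (y + x) - h x) \<partial>lborel) < e / 2"
    using add.IH(2)[of "e / 2"] add.prems by auto
  have "(\<integral>x. norm (f (y + x) + h (y + x) - (f x + h x)) \<partial>lborel) < e" if "norm y < min d1 d2" for y
  proof -
    have i: "integrable lborel (\<lambda>x. f (y + x))" "integrable lborel (\<lambda>x. h (y + x))"
      using add.hyps by (auto intro: lborel_integrable_translate)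
    have "(\<integral>x. norm (f (y + x) + h (y + x) - (f x + h x)) \<partial>lborel) \<le>
        (\<integral>x. norm (f (y + x) - f x) + norm (h (y + x) - h x) \<partial>lborel)"
      using add.hyps i by (intro integral_mono integrable_norm Bochner_Integration.integrable_add Bochner_Integration.integrable_diff)
        (auto simp: norm_diff_triangle_ineq)
    also have "\<dots> = (\<integral>x. norm (f (y + x) - f x) \<partial>lborel) + (\<integral>x. norm (h (y + x) - h x) \<partial>lborel)"
      using add.hyps i by simp
    finally show ?thesis using d1(2)[of y] d2(2)[of y] that by simp
  qed
  then show ?case using d1(1) d2(1) by (intro exI[of _ "min d1 d2"]) auto
next
  case (lim f s)
  have "(\<lambda>i. \<integral>x. norm (f x - s i x) \<partial>lborel) \<longlonglongrightarrow> (\<integral>x. norm (f x - f x) \<partial>lborel)"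
  proof (rule integral_dominated_convergence[where w = "\<lambda>x. 3 * norm (f x)"])
    show "AE x in lborel. (\<lambda>i. norm (f x - s i x)) \<longlonglongrightarrow> norm (f x - f x)"
    proof (rule AE_I2)
      fix x show "(\<lambda>i. norm (f x - s i x)) \<longlonglongrightarrow> norm (f x - f x)"
        using lim.hyps(2)[of x] by (intro tendsto_intros) simp
    qed
    \<comment> \<open>The approximating functions are dominated by \<open>2 * norm (f x)\<close>,
      whence the factor 3.\<close>
    show "AE x in lborel. norm (norm (f x - s i x)) \<le> 3 * norm (f x)" for i
    proof (rule AE_I2)
      fix x show "norm (norm (f x - s i x)) \<le> 3 * norm (f x)"
        using norm_triangle_ineq4[of "f x" "s i x"] lim.hyps(3)[of x i] by simp
    qed
  qed (use lim.hyps in auto)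
  then have "(\<lambda>i. \<integral>x. norm (f x - s i x) \<partial>lborel) \<longlonglongrightarrow> 0" by simp
  then obtain i where i: "(\<integral>x. norm (f x - s i x) \<partial>lborel) < e / 4"
    using lim.prems order_tendstoD(2)[of _ 0 sequentially "e / 4"] by (auto simp: eventually_sequentially)
  obtain d where d: "0 < d" "\<And>y. norm y < d \<Longrightarrow> (\<integral>x. norm (s i (y + x) - s i x) \<partial>lborel) < e / 2"
    using lim.IH[of "e / 2" i] lim.prems by auto
  have "(\<integral>x. norm (f (y + x) - f x) \<partial>lborel) < e" if "norm y < d" for y
    using L1_translation_perturb[OF lim.hyps(4) lim.hyps(1)[of i], of y] d(2)[OF that] i by simp
  then show ?case using d(1) by blast
qed

text \<open>Mollifiers and their derivatives are of this kind.\<close>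

definition kernel :: "real \<Rightarrow> ('a::euclidean_space \<Rightarrow> 'b::euclidean_space) \<Rightarrow> bool" where
  "kernel r \<kappa> \<longleftrightarrow> continuous_on UNIV \<kappa> \<and> (\<forall>z. \<kappa> z \<noteq> 0 \<longrightarrow> norm z \<le> r)"

definition conv :: "('a::euclidean_space \<Rightarrow> real) \<Rightarrow> ('a \<Rightarrow> 'b::euclidean_space) \<Rightarrow> 'a \<Rightarrow> 'b" where
  "conv \<kappa> f z = (\<integral>w. \<kappa> (z - w) *\<^sub>R f w \<partial>lborel)"

section \<open>Convolution: continuity, differentiation, Jensen's inequality, convergence in
  L^1\<close>

lemma kernel_bound:
  assumes "kernel r \<kappa>"
  obtains C where "0 < C" "\<And>z. norm (\<kappa> z) \<le> C"
proof -
  have "compact (\<kappa> ` cball 0 r)"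
    using assms by (intro compact_continuous_image) (auto simp: kernel_def intro: continuous_on_subset)
  then obtain C where C: "0 < C" "\<And>z. z \<in> cball 0 r \<Longrightarrow> norm (\<kappa> z) \<le> C"
    by (auto dest!: compact_imp_bounded simp: bounded_pos)
  have "norm (\<kappa> z) \<le> C" for z
    using C assms by (cases "\<kappa> z = 0") (auto simp: kernel_def)
  then show ?thesis using C that by blast
qed

lemma kernel_uniformly_continuous:
  assumes "kernel r \<kappa>" "0 < e"
  obtains d where "0 < d" "\<And>a v. norm v < d \<Longrightarrow> norm (\<kappa> (a + v) - \<kappa> a) < e"
proof -
  \<comment> \<open>Radius \<open>r + 1\<close>: if one of two points at distance less than 1 lies
    in the support, both lie in this ball.\<close>
  have "uniformly_continuous_on (cball 0 (r + 1)) \<kappa>"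
    using assms by (intro compact_uniformly_continuous) (auto simp: kernel_def intro: continuous_on_subset)
  then obtain d where d: "0 < d" "\<And>x x'. x \<in> cball 0 (r + 1) \<Longrightarrow> x' \<in> cball 0 (r + 1) \<Longrightarrow>
      dist x' x < d \<Longrightarrow> dist (\<kappa> x') (\<kappa> x) < e"
    using assms(2) unfolding uniformly_continuous_on_def by metis
  have "norm (\<kappa> (a + v) - \<kappa> a) < e" if v: "norm v < min d 1" for a v
  proof (cases "\<kappa> a = 0 \<and> \<kappa> (a + v) = 0")
    case False
    then have "norm a \<le> r \<or> norm (a + v) \<le> r" using assms(1) by (auto simp: kernel_def)
    then have "norm a \<le> r + 1" "norm (a + v) \<le> r + 1"
      using v norm_triangle_ineq[of a v] norm_triangle_ineq4[of "a + v" v] by auto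
    then have "a \<in> cball 0 (r + 1)" "a + v \<in> cball 0 (r + 1)"
      by (metis dist_0_norm mem_cball)+
    then show ?thesis using d(2)[of a "a + v"] v by (simp add: dist_norm)
  qed (use assms in simp)
  then show ?thesis using d(1) that[of "min d 1"] by auto
qed

lemma conv_integrable:
  fixes f :: "'a::euclidean_space \<Rightarrow> 'b::euclidean_space"
  assumes "kernel r \<kappa>" and f: "integrable lborel f"
  shows "integrable lborel (\<lambda>w. \<kappa> (z - w) *\<^sub>R f w)"
proof -
  obtain C where C: "0 < C" "\<And>z. norm (\<kappa> z) \<le> C" using kernel_bound[OF assms(1)] by blast
  have [measurable]: "\<kappa> \<in> borel_measurable borel"
    using assms(1) by (auto simp: kernel_def intro: borel_measurable_continuous_onI)
  show ?thesis
  proof (rule Bochner_Integration.integrable_bound)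
    show "integrable lborel (\<lambda>w. C *\<^sub>R f w)" using f by simp
    show "(\<lambda>w. \<kappa> (z - w) *\<^sub>R f w) \<in> borel_measurable lborel" using f by measurable
    show "AE w in lborel. norm (\<kappa> (z - w) *\<^sub>R f w) \<le> norm (C *\<^sub>R f w)"
      using C by (auto intro!: mult_right_mono)
  qed
qed

lemma conv_continuous:
  assumes "kernel r \<kappa>" and f: "integrable lborel f"
  shows "continuous_on A (conv \<kappa> f)"
proof -
  obtain C where C: "0 < C" "\<And>z. norm (\<kappa> z) \<le> C" using kernel_bound[OF assms(1)] by blast
  have c: "continuous_on UNIV \<kappa>" using assms(1) by (auto simp: kernel_def)
  then have [measurable]: "\<kappa> \<in> borel_measurable borel" by (auto intro: borel_measurable_continuous_onI)
  have "isCont (conv \<kappa> f) z" for z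
    unfolding continuous_at_sequentially comp_def conv_def
  proof safe
    fix s assume s: "s \<longlonglongrightarrow> z"
    show "(\<lambda>n. \<integral>w. \<kappa> (s n - w) *\<^sub>R f w \<partial>lborel) \<longlonglongrightarrow> (\<integral>w. \<kappa> (z - w) *\<^sub>R f w \<partial>lborel)"
    proof (rule integral_dominated_convergence[where w = "\<lambda>w. C * norm (f w)"])
      show "AE w in lborel. (\<lambda>n. \<kappa> (s n - w) *\<^sub>R f w) \<longlonglongrightarrow> \<kappa> (z - w) *\<^sub>R f w"
        using c by (intro AE_I2 tendsto_intros s continuous_on_tendsto_compose[OF c]) auto
      show "AE w in lborel. norm (\<kappa> (s n - w) *\<^sub>R f w) \<le> C * norm (f w)" for n
        using C by (auto intro!: mult_right_mono)
    qed (use f in auto)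
  qed
  then show ?thesis by (simp add: continuous_at_imp_continuous_on)
qed

lemma mollifier_kernel: "mollifier r \<kappa> \<Longrightarrow> kernel r \<kappa>"
  by (auto simp: mollifier_def kernel_def less_imp_le intro: Ck_continuous[of 0])

text \<open>The mollifier vanishes on the open exterior of the ball, hence so does its gradient. The
  argument does not reach the sphere itself, which is why \<open>kernel\<close> admits
  \<open>norm z = r\<close>.\<close>

lemma mollifier_grad_kernel:
  assumes "mollifier r \<kappa>"
  shows "kernel r (grad \<kappa>)"
proof -
  have Ck: "Ck k \<kappa>" for k using assms by (simp add: mollifier_def)
  have "grad \<kappa> z = 0" if "r < norm z" for z
  proof -
    have "((\<lambda>_. 0) has_derivative (\<lambda>h. 0)) (at z)" by simp
    then have "(\<kappa> has_derivative (\<lambda>h. 0)) (at z)"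
    proof (rule has_derivative_transform_within_open[of _ _ _ UNIV "{z. r < norm z}"])
      show "open {z::'a. r < norm z}" by (intro open_Collect_less continuous_intros)
    qed (use assms that in \<open>auto simp: mollifier_def less_le_not_le\<close>)
    then have "(\<lambda>h. grad \<kappa> z \<bullet> h) = (\<lambda>h. 0)"
      using grad_deriv[OF Ck] by (rule has_derivative_unique[rotated])
    then show ?thesis by (metis inner_eq_zero_iff)
  qed
  then show ?thesis using grad_cont[OF Ck] by (auto simp: kernel_def not_less[symmetric])
qed

lemma kernel_inner: "kernel r \<kappa> \<Longrightarrow> kernel r (\<lambda>z. \<kappa> z \<bullet> h)"
  unfolding kernel_def by (auto intro!: continuous_intros) (metis inner_zero_left)

text \<open>Uniform continuity of \<open>grad \<kappa>\<close> bounds the linearisation error of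
  \<open>\<kappa>\<close> by \<open>e' * norm v\<close> at all base points simultaneously;
  integrated against \<open>f\<close> it costs only the L^1 norm of \<open>f\<close>. The derivative
  falls entirely on the kernel.\<close>

lemma conv_has_derivative:
  assumes \<kappa>: "mollifier r \<kappa>" and f: "integrable lborel f"
  shows "(conv \<kappa> f has_derivative (\<lambda>h. conv (\<lambda>z. grad \<kappa> z \<bullet> h) f z)) (at z)"
  unfolding has_derivative_at_alt
proof (intro conjI allI impI)
  have K: "kernel r \<kappa>" "kernel r (grad \<kappa>)" "\<And>h. kernel r (\<lambda>z. grad \<kappa> z \<bullet> h)"
    using mollifier_kernel[OF \<kappa>] mollifier_grad_kernel[OF \<kappa>] kernel_inner by auto
  have Ck: "Ck k \<kappa>" for k using \<kappa> by (simp add: mollifier_def)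
  let ?M = "\<integral>w. norm (f w) \<partial>lborel"
  have nf: "integrable lborel (\<lambda>w. norm (f w))" using f by simp
  obtain C where C: "0 < C" "\<And>z. norm (grad \<kappa> z) \<le> C" using kernel_bound[OF K(2)] by blast
  note int = conv_integrable[OF K(1) f] conv_integrable[OF K(3) f]
  show "bounded_linear (\<lambda>h. conv (\<lambda>z. grad \<kappa> z \<bullet> h) f z)"
  proof (rule bounded_linear_intro[where K = "C * ?M"])
    show "conv (\<lambda>z. grad \<kappa> z \<bullet> (x + y)) f z = conv (\<lambda>z. grad \<kappa> z \<bullet> x) f z + conv (\<lambda>z. grad \<kappa> z \<bullet> y) f z" for x y
      unfolding conv_def by (simp add: inner_add_right scaleR_add_left int)
    show "conv (\<lambda>z. grad \<kappa> z \<bullet> (a *\<^sub>R x)) f z = a *\<^sub>R conv (\<lambda>z. grad \<kappa> z \<bullet> x) f z" for a x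
      unfolding conv_def by (simp add: scaleR_scaleR[symmetric] int del: scaleR_scaleR)
    show "norm (conv (\<lambda>z. grad \<kappa> z \<bullet> h) f z) \<le> norm h * (C * ?M)" for h
    proof -
      have "norm (conv (\<lambda>z. grad \<kappa> z \<bullet> h) f z) \<le> (\<integral>w. norm ((grad \<kappa> (z - w) \<bullet> h) *\<^sub>R f w) \<partial>lborel)"
        unfolding conv_def by (rule integral_norm_bound)
      also have "\<dots> \<le> (\<integral>w. (norm h * C) * norm (f w) \<partial>lborel)"
      proof (rule integral_mono)
        fix w
        have "\<bar>grad \<kappa> (z - w) \<bullet> h\<bar> \<le> norm (grad \<kappa> (z - w)) * norm h" by (rule Cauchy_Schwarz_ineq2)
        also have "\<dots> \<le> C * norm h" using C by (intro mult_right_mono) auto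
        finally show "norm ((grad \<kappa> (z - w) \<bullet> h) *\<^sub>R f w) \<le> (norm h * C) * norm (f w)"
          using mult_right_mono[OF _ norm_ge_zero[of "f w"]] by (fastforce simp: mult.commute)
      qed (use nf int(2)[THEN integrable_norm] in auto)
      finally show ?thesis by (simp add: mult.assoc)
    qed
  qed
  fix e :: real assume e: "0 < e"
  define e' where "e' = e / (?M + 1)"
  have M0: "0 \<le> ?M" by simp
  have e': "0 < e'" using e M0 unfolding e'_def by (simp add: add_nonneg_pos)
  obtain d where d: "0 < d" "\<And>a v. norm v < d \<Longrightarrow> norm (grad \<kappa> (a + v) - grad \<kappa> a) < e'"
    using kernel_uniformly_continuous[OF K(2) e'] by blast
  have lin: "\<bar>\<kappa> (a + v) - \<kappa> a - grad \<kappa> a \<bullet> v\<bar> \<le> norm v * e'" if v: "norm v < d" for a v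
  proof -
    have "norm (\<kappa> (a + v) - \<kappa> a - grad \<kappa> a \<bullet> (a + v - a)) \<le> norm (a + v - a) * e'"
    proof (rule differentiable_bound_linearization[of a "a + v" "ball a d" \<kappa> "\<lambda>x h. grad \<kappa> x \<bullet> h" a e'])
      show "a + t *\<^sub>R (a + v - a) \<in> ball a d" if "t \<in> {0..1}" for t
        using v that mult_left_le_one_le[of "norm v" t] by (simp add: dist_norm abs_of_nonneg)
      show "(\<kappa> has_derivative (\<lambda>h. grad \<kappa> x \<bullet> h)) (at x within ball a d)" for x
        using grad_deriv[OF Ck] has_derivative_at_withinI by blast
      show "onorm ((\<lambda>h. grad \<kappa> x \<bullet> h) - (\<lambda>h. grad \<kappa> a \<bullet> h)) \<le> e'" if "x \<in> ball a d" for x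
      proof (rule onorm_le)
        fix h
        have "\<bar>(grad \<kappa> x - grad \<kappa> a) \<bullet> h\<bar> \<le> norm (grad \<kappa> x - grad \<kappa> a) * norm h" by (rule Cauchy_Schwarz_ineq2)
        also have "\<dots> \<le> e' * norm h"
          using d(2)[of "x - a" a] that by (intro mult_right_mono) (auto simp: dist_norm norm_minus_commute)
        finally show "norm (((\<lambda>h. grad \<kappa> x \<bullet> h) - (\<lambda>h. grad \<kappa> a \<bullet> h)) h) \<le> e' * norm h"
          by (simp add: inner_diff_left)
      qed
    qed (use d in auto)
    then show ?thesis by simp
  qed
  have "norm (conv \<kappa> f y - conv \<kappa> f z - conv (\<lambda>x. grad \<kappa> x \<bullet> (y - z)) f z) \<le> e * norm (y - z)"
    if y: "norm (y - z) < d" for y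
  proof -
    have eq: "conv \<kappa> f y - conv \<kappa> f z - conv (\<lambda>x. grad \<kappa> x \<bullet> (y - z)) f z =
        (\<integral>w. (\<kappa> (y - w) - \<kappa> (z - w) - grad \<kappa> (z - w) \<bullet> (y - z)) *\<^sub>R f w \<partial>lborel)"
      unfolding conv_def by (simp add: scaleR_diff_left int)
    have "norm (conv \<kappa> f y - conv \<kappa> f z - conv (\<lambda>x. grad \<kappa> x \<bullet> (y - z)) f z) \<le>
        (\<integral>w. norm ((\<kappa> (y - w) - \<kappa> (z - w) - grad \<kappa> (z - w) \<bullet> (y - z)) *\<^sub>R f w) \<partial>lborel)"
      unfolding eq by (rule integral_norm_bound)
    also have "\<dots> \<le> (\<integral>w. (norm (y - z) * e') * norm (f w) \<partial>lborel)"
    proof (rule integral_mono)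
      fix w
      show "norm ((\<kappa> (y - w) - \<kappa> (z - w) - grad \<kappa> (z - w) \<bullet> (y - z)) *\<^sub>R f w) \<le> (norm (y - z) * e') * norm (f w)"
        using lin[OF y, of "z - w"] by (simp add: mult_right_mono)
      show "integrable lborel (\<lambda>w. norm ((\<kappa> (y - w) - \<kappa> (z - w) - grad \<kappa> (z - w) \<bullet> (y - z)) *\<^sub>R f w))"
        unfolding scaleR_diff_left by (intro integrable_norm Bochner_Integration.integrable_diff int)
    qed (use nf in auto)
    also have "\<dots> = norm (y - z) * (e' * ?M)" by simp
    also have "\<dots> \<le> norm (y - z) * e"
    proof (rule mult_left_mono)
      have "e / (M + 1) * M \<le> e" if "0 \<le> M" for M
        using that e by (simp add: field_simps add_nonneg_pos)
      from this[OF M0] show "e' * ?M \<le> e" unfolding e'_def .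
    qed simp
    finally show ?thesis by (simp add: mult.commute)
  qed
  then show "\<exists>d>0. \<forall>y. norm (y - z) < d \<longrightarrow>
      norm (conv \<kappa> f y - conv \<kappa> f z - conv (\<lambda>x. grad \<kappa> x \<bullet> (y - z)) f z) \<le> e * norm (y - z)"
    using d(1) by blast
qed

lemma mollifier_int:
  assumes "mollifier r \<kappa>"
  shows "integrable lborel (\<lambda>w. \<kappa> (z - w))" "(\<integral>w. \<kappa> (z - w) \<partial>lborel) = 1"
  using assms lborel_integrable_reflect[of \<kappa> z] lborel_integral_reflect[of \<kappa> z]
  by (auto simp: mollifier_def)

lemma norm_conv_le:
  assumes "mollifier r \<kappa>"
  shows "norm (conv \<kappa> f z) \<le> conv \<kappa> (\<lambda>w. norm (f w)) z"
proof -
  have "norm (conv \<kappa> f z) \<le> (\<integral>w. norm (\<kappa> (z - w) *\<^sub>R f w) \<partial>lborel)"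
    unfolding conv_def by (rule integral_norm_bound)
  also have "\<dots> = conv \<kappa> (\<lambda>w. norm (f w)) z"
    unfolding conv_def using assms by (simp add: mollifier_def)
  finally show ?thesis .
qed

lemma conv_nonneg:
  fixes f :: "'a::euclidean_space \<Rightarrow> real"
  assumes "mollifier r \<kappa>" "\<And>w. 0 \<le> f w"
  shows "0 \<le> conv \<kappa> f z"
  unfolding conv_def using assms by (intro Bochner_Integration.integral_nonneg) (auto simp: mollifier_def)

lemma conv_affine:
  fixes f :: "'a::euclidean_space \<Rightarrow> real"
  assumes \<kappa>: "mollifier r \<kappa>" and f: "integrable lborel f"
  shows "integrable lborel (\<lambda>w. \<kappa> (z - w) * (a + c * f w))"
    and "(\<integral>w. \<kappa> (z - w) * (a + c * f w) \<partial>lborel) = a + c * conv \<kappa> f z"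
proof -
  have i: "integrable lborel (\<lambda>w. \<kappa> (z - w) * f w)"
    using conv_integrable[OF mollifier_kernel[OF \<kappa>] f] by simp
  have eq: "(\<lambda>w. \<kappa> (z - w) * (a + c * f w)) = (\<lambda>w. a * \<kappa> (z - w) + c * (\<kappa> (z - w) * f w))"
    by (auto simp: algebra_simps)
  show "integrable lborel (\<lambda>w. \<kappa> (z - w) * (a + c * f w))"
    unfolding eq using i mollifier_int[OF \<kappa>] by simp
  show "(\<integral>w. \<kappa> (z - w) * (a + c * f w) \<partial>lborel) = a + c * conv \<kappa> f z"
    unfolding eq conv_def using i mollifier_int[OF \<kappa>] by simp
qed

text \<open>The supporting line at the value of the convolution is integrated against the
  probability density \<open>\<kappa> (z - w)\<close>; its linear term cancels.\<close>

lemma conv_jensen: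
  fixes f :: "'a::euclidean_space \<Rightarrow> real"
  assumes \<kappa>: "mollifier r \<kappa>" and f: "integrable lborel f" "integrable lborel (\<lambda>w. \<Phi> (f w))"
    and supp: "\<And>a. \<exists>c. \<forall>b. \<Phi> a + c * (b - a) \<le> \<Phi> b"
  shows "\<Phi> (conv \<kappa> f z) \<le> conv \<kappa> (\<lambda>w. \<Phi> (f w)) z"
proof -
  define a0 where "a0 = conv \<kappa> f z"
  obtain c where c: "\<And>b. \<Phi> a0 + c * (b - a0) \<le> \<Phi> b" using supp by blast
  have "\<Phi> a0 = (\<integral>w. \<kappa> (z - w) * ((\<Phi> a0 - c * a0) + c * f w) \<partial>lborel)"
    by (simp add: conv_affine[OF \<kappa> f(1)] a0_def[symmetric])
  also have "\<dots> \<le> conv \<kappa> (\<lambda>w. \<Phi> (f w)) z"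
    unfolding conv_def real_scaleR_def
  proof (rule integral_mono)
    show "integrable lborel (\<lambda>w. \<kappa> (z - w) * ((\<Phi> a0 - c * a0) + c * f w))"
      by (rule conv_affine[OF \<kappa> f(1)])
    show "integrable lborel (\<lambda>w. \<kappa> (z - w) * \<Phi> (f w))"
      using conv_integrable[OF mollifier_kernel[OF \<kappa>] f(2)] by simp
    show "\<kappa> (z - w) * ((\<Phi> a0 - c * a0) + c * f w) \<le> \<kappa> (z - w) * \<Phi> (f w)" for w
      using c[of "f w"] \<kappa> by (intro mult_left_mono) (auto simp: mollifier_def algebra_simps)
  qed
  finally show ?thesis by (simp add: a0_def)
qed

text \<open>The difference \<open>conv \<kappa> f - f\<close> is an average of translation
  differences over shifts shorter than \<open>r\<close>, so Tonelli's theorem bounds its L^1 norm by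
  their supremum. Integrability of the convolution follows from the same bound.\<close>

lemma conv_L1_le:
  assumes \<kappa>: "mollifier r \<kappa>" and f: "integrable lborel f"
    and e: "\<And>y. norm y < r \<Longrightarrow> (\<integral>x. norm (f (y + x) - f x) \<partial>lborel) \<le> e"
  shows "integrable lborel (conv \<kappa> f)" "(\<integral>z. norm (conv \<kappa> f z - f z) \<partial>lborel) \<le> e"
proof -
  have [measurable]: "conv \<kappa> f \<in> borel_measurable borel" "f \<in> borel_measurable borel" "\<kappa> \<in> borel_measurable borel"
    using conv_continuous[OF mollifier_kernel[OF \<kappa>] f, of UNIV] f \<kappa>
    by (auto intro: borel_measurable_continuous_onI simp: mollifier_def)
  have r: "0 < r"
  proof (rule ccontr)
    assume "\<not> 0 < r"
    then have "\<kappa> z = 0" for z using \<kappa> norm_ge_zero[of z] unfolding mollifier_def by (meson le_less_trans not_le less_imp_le order_trans norm_ge_zero)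
    then have "\<kappa> = (\<lambda>_. 0)" by auto
    then show False using \<kappa> by (simp add: mollifier_def)
  qed
  have e0: "0 \<le> e" using e[of 0] r by simp
  have pt: "ennreal (norm (conv \<kappa> f z - f z)) \<le> (\<integral>\<^sup>+y. ennreal (\<kappa> y * norm (f (z - y) - f z)) \<partial>lborel)" for z
  proof -
    have i1: "integrable lborel (\<lambda>y. \<kappa> y *\<^sub>R f (z - y))"
      using lborel_integrable_reflect[OF conv_integrable[OF mollifier_kernel[OF \<kappa>] f, of z], of z] by simp
    have i2: "integrable lborel (\<lambda>y. \<kappa> y *\<^sub>R f z)" using \<kappa> by (auto simp: mollifier_def)
    have "conv \<kappa> f z = (\<integral>y. \<kappa> y *\<^sub>R f (z - y) \<partial>lborel)"
      unfolding conv_def using lborel_integral_reflect[of "\<lambda>w. \<kappa> (z - w) *\<^sub>R f w" z] by simp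
    moreover have "f z = (\<integral>y. \<kappa> y *\<^sub>R f z \<partial>lborel)" using \<kappa> by (simp add: mollifier_def)
    ultimately have "conv \<kappa> f z - f z = (\<integral>y. \<kappa> y *\<^sub>R (f (z - y) - f z) \<partial>lborel)"
      using i1 i2 by (simp add: scaleR_diff_right)
    then have "norm (conv \<kappa> f z - f z) \<le> (\<integral>y. norm (\<kappa> y *\<^sub>R (f (z - y) - f z)) \<partial>lborel)"
      by (metis integral_norm_bound)
    also have "\<dots> = (\<integral>y. \<kappa> y * norm (f (z - y) - f z) \<partial>lborel)"
      using \<kappa> by (simp add: mollifier_def)
    finally have "ennreal (norm (conv \<kappa> f z - f z)) \<le> ennreal (\<integral>y. \<kappa> y * norm (f (z - y) - f z) \<partial>lborel)"
      by (rule ennreal_leI)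
    also have "\<dots> = (\<integral>\<^sup>+y. ennreal (\<kappa> y * norm (f (z - y) - f z)) \<partial>lborel)"
    proof (rule nn_integral_eq_integral[symmetric])
      have "integrable lborel (\<lambda>y. norm (\<kappa> y *\<^sub>R (f (z - y) - f z)))"
        using i1 i2 by (simp add: scaleR_diff_right)
      then show "integrable lborel (\<lambda>y. \<kappa> y * norm (f (z - y) - f z))"
        using \<kappa> by (simp add: mollifier_def)
    qed (use \<kappa> in \<open>auto simp: mollifier_def\<close>)
    finally show ?thesis .
  qed
  have "(\<integral>\<^sup>+z. ennreal (norm (conv \<kappa> f z - f z)) \<partial>lborel) \<le>
      (\<integral>\<^sup>+z. (\<integral>\<^sup>+y. ennreal (\<kappa> y * norm (f (z - y) - f z)) \<partial>lborel) \<partial>lborel)"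
    by (intro nn_integral_mono pt)
  also have "\<dots> = (\<integral>\<^sup>+y. (\<integral>\<^sup>+z. ennreal (\<kappa> y * norm (f (z - y) - f z)) \<partial>lborel) \<partial>lborel)"
    by (rule lborel_pair.Fubini'[symmetric]) measurable
  also have "\<dots> \<le> (\<integral>\<^sup>+y. ennreal (\<kappa> y) * ennreal e \<partial>lborel)"
  proof (rule nn_integral_mono)
    fix y
    show "(\<integral>\<^sup>+z. ennreal (\<kappa> y * norm (f (z - y) - f z)) \<partial>lborel) \<le> ennreal (\<kappa> y) * ennreal e"
    proof (cases "\<kappa> y = 0")
      case False
      then have y: "norm (- y) < r" using \<kappa> by (simp add: mollifier_def)
      have i: "integrable lborel (\<lambda>z. norm (f (- y + z) - f z))"
        by (intro integrable_norm Bochner_Integration.integrable_diff lborel_integrable_translate f)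
      have "(\<integral>\<^sup>+z. ennreal (\<kappa> y * norm (f (z - y) - f z)) \<partial>lborel) =
          ennreal (\<kappa> y) * (\<integral>\<^sup>+z. ennreal (norm (f (- y + z) - f z)) \<partial>lborel)"
        using \<kappa> by (subst nn_integral_cmult[symmetric]) (auto simp: mollifier_def ennreal_mult' add.commute)
      also have "(\<integral>\<^sup>+z. ennreal (norm (f (- y + z) - f z)) \<partial>lborel) = ennreal (\<integral>z. norm (f (- y + z) - f z) \<partial>lborel)"
        by (rule nn_integral_eq_integral[OF i]) simp
      also have "\<dots> \<le> ennreal e" by (intro ennreal_leI e y)
      finally show ?thesis by (simp add: mult_left_mono)
    qed simp
  qed
  also have "\<dots> = (\<integral>\<^sup>+y. ennreal (\<kappa> y) \<partial>lborel) * ennreal e" by (rule nn_integral_multc) simp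
  also have "(\<integral>\<^sup>+y. ennreal (\<kappa> y) \<partial>lborel) = 1"
    using \<kappa> by (subst nn_integral_eq_integral) (auto simp: mollifier_def)
  finally have le: "(\<integral>\<^sup>+z. ennreal (norm (conv \<kappa> f z - f z)) \<partial>lborel) \<le> ennreal e" by simp
  have i: "integrable lborel (\<lambda>z. conv \<kappa> f z - f z)"
    by (rule integrableI_bounded) (use le in \<open>auto intro: le_less_trans\<close>)
  show "integrable lborel (conv \<kappa> f)" using Bochner_Integration.integrable_add[OF i f] by simp
  have "ennreal (\<integral>z. norm (conv \<kappa> f z - f z) \<partial>lborel) \<le> ennreal e"
    using le by (subst nn_integral_eq_integral[symmetric]) (use i in auto)
  then show "(\<integral>z. norm (conv \<kappa> f z - f z) \<partial>lborel) \<le> e" using e0 by simp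
qed

lemma conv_integrable_lborel:
  assumes \<kappa>: "mollifier r \<kappa>" and f: "integrable lborel f"
  shows "integrable lborel (conv \<kappa> f)"
proof (rule conv_L1_le(1)[OF assms])
  fix y
  have "(\<integral>x. norm (f (y + x) - f x) \<partial>lborel) \<le> (\<integral>x. norm (f (y + x)) + norm (f x) \<partial>lborel)"
    by (intro integral_mono integrable_norm Bochner_Integration.integrable_diff Bochner_Integration.integrable_add
        lborel_integrable_translate f norm_triangle_ineq4)
  also have "\<dots> = (\<integral>x. norm (f (y + x)) \<partial>lborel) + (\<integral>x. norm (f x) \<partial>lborel)"
    using f lborel_integrable_translate[OF f] by simp
  also have "(\<integral>x. norm (f (y + x)) \<partial>lborel) = (\<integral>x. norm (f x) \<partial>lborel)"
    by (rule lborel_integral_translate[of "\<lambda>x. norm (f x)"]) (use f in auto)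
  finally show "(\<integral>x. norm (f (y + x) - f x) \<partial>lborel) \<le> 2 * (\<integral>x. norm (f x) \<partial>lborel)" by simp
qed

lemma conv_tendsto_L1:
  assumes \<kappa>: "\<And>m. mollifier (r m) (\<kappa> m)" and r: "r \<longlonglongrightarrow> 0" and f: "integrable lborel f"
  shows "(\<lambda>m. \<integral>z. norm (conv (\<kappa> m) f z - f z) \<partial>lborel) \<longlonglongrightarrow> 0"
proof (rule LIMSEQ_I)
  fix e :: real assume e: "0 < e"
  obtain d where d: "0 < d" "\<And>y. norm y < d \<Longrightarrow> (\<integral>x. norm (f (y + x) - f x) \<partial>lborel) < e / 2"
    using L1_translation_continuous[OF f, of "e / 2"] e by auto
  obtain N where N: "\<And>m. N \<le> m \<Longrightarrow> r m < d"
    using order_tendstoD(2)[OF r d(1)] by (auto simp: eventually_sequentially)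
  have le: "(\<integral>z. norm (conv (\<kappa> m) f z - f z) \<partial>lborel) \<le> e / 2" if "N \<le> m" for m
    by (rule conv_L1_le(2)[OF \<kappa> f]) (use d N[OF that] in \<open>meson less_imp_le less_trans\<close>)
  then show "\<exists>N. \<forall>m\<ge>N. norm ((\<integral>z. norm (conv (\<kappa> m) f z - f z) \<partial>lborel) - 0) < e"
  proof (intro exI[of _ N] allI impI)
    fix m assume "N \<le> m"
    then have "(\<integral>z. norm (conv (\<kappa> m) f z - f z) \<partial>lborel) < e"
      using le[of m] e by linarith
    then show "norm ((\<integral>z. norm (conv (\<kappa> m) f z - f z) \<partial>lborel) - 0) < e" by simp
  qed
qed

text \<open>Dominated convergence with a majorant that itself varies but converges in L^1:
  \<open>X m\<close> is at most \<open>|Z m - Z0|\<close> plus \<open>min (X m) |Z0|\<close>, and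
  the last term has the fixed majorant \<open>|Z0|\<close>.\<close>

lemma L1_dominated_limit:
  fixes X Z :: "nat \<Rightarrow> 'a \<Rightarrow> real"
  assumes [measurable]: "\<And>m. X m \<in> borel_measurable M"
    and Z: "\<And>m. integrable M (Z m)" "integrable M Z0"
    and X: "\<And>m. AE x in M. 0 \<le> X m x \<and> X m x \<le> Z m x" "AE x in M. (\<lambda>m. X m x) \<longlonglongrightarrow> 0"
    and lim: "(\<lambda>m. \<integral>x. norm (Z m x - Z0 x) \<partial>M) \<longlonglongrightarrow> 0"
  shows "(\<lambda>m. \<integral>x. X m x \<partial>M) \<longlonglongrightarrow> 0"
proof -
  have [measurable]: "Z0 \<in> borel_measurable M" using Z by auto
  have l2: "(\<lambda>m. \<integral>x. min (X m x) \<bar>Z0 x\<bar> \<partial>M) \<longlonglongrightarrow> (\<integral>x. 0 \<partial>M)"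
  proof (rule integral_dominated_convergence[where w = "\<lambda>x. \<bar>Z0 x\<bar>"])
    show "AE x in M. (\<lambda>m. min (X m x) \<bar>Z0 x\<bar>) \<longlonglongrightarrow> 0"
      using X(2)
    proof eventually_elim
      case (elim x)
      have "(\<lambda>m. min (X m x) \<bar>Z0 x\<bar>) \<longlonglongrightarrow> min 0 \<bar>Z0 x\<bar>" by (intro tendsto_min elim tendsto_const)
      then show ?case by simp
    qed
    show "AE x in M. norm (min (X m x) \<bar>Z0 x\<bar>) \<le> \<bar>Z0 x\<bar>" for m
      using X(1)[of m] by eventually_elim auto
  qed (use Z in auto)
  have "(\<lambda>m. (\<integral>x. norm (Z m x - Z0 x) \<partial>M) + (\<integral>x. min (X m x) \<bar>Z0 x\<bar> \<partial>M)) \<longlonglongrightarrow> 0 + 0"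
    using lim l2 by (intro tendsto_add) auto
  then have l3: "(\<lambda>m. (\<integral>x. norm (Z m x - Z0 x) \<partial>M) + (\<integral>x. min (X m x) \<bar>Z0 x\<bar> \<partial>M)) \<longlonglongrightarrow> 0" by simp
  have iX: "integrable M (X m)" for m
    by (rule Bochner_Integration.integrable_bound[OF Z(1)[of m]]) (use X(1)[of m] in auto)
  have imin: "integrable M (\<lambda>x. min (X m x) \<bar>Z0 x\<bar>)" for m
    by (rule Bochner_Integration.integrable_bound[OF iX[of m]]) (use X(1)[of m] in auto)
  show ?thesis
  proof (rule tendsto_sandwich[OF _ _ tendsto_const l3])
    show "eventually (\<lambda>m. 0 \<le> (\<integral>x. X m x \<partial>M)) sequentially"
    proof (intro always_eventually allI)
      fix m
      have "AE x in M. 0 \<le> X m x" using X(1)[of m] by eventually_elim auto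
      then show "0 \<le> (\<integral>x. X m x \<partial>M)" by (rule integral_nonneg_AE)
    qed
    show "eventually (\<lambda>m. (\<integral>x. X m x \<partial>M) \<le>
        (\<integral>x. norm (Z m x - Z0 x) \<partial>M) + (\<integral>x. min (X m x) \<bar>Z0 x\<bar> \<partial>M)) sequentially"
    proof (intro always_eventually allI)
      fix m
      have "(\<integral>x. X m x \<partial>M) \<le> (\<integral>x. norm (Z m x - Z0 x) + min (X m x) \<bar>Z0 x\<bar> \<partial>M)"
      proof (rule integral_mono_AE[OF iX])
        show "integrable M (\<lambda>x. norm (Z m x - Z0 x) + min (X m x) \<bar>Z0 x\<bar>)" using Z imin by auto
        show "AE x in M. X m x \<le> norm (Z m x - Z0 x) + min (X m x) \<bar>Z0 x\<bar>"
          using X(1)[of m] by eventually_elim auto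
      qed
      then show "(\<integral>x. X m x \<partial>M) \<le> (\<integral>x. norm (Z m x - Z0 x) \<partial>M) + (\<integral>x. min (X m x) \<bar>Z0 x\<bar> \<partial>M)"
        using Z imin by simp
    qed
  qed
qed

subsection \<open>Level sets\<close>

context growth
begin

text \<open>The drop of \<open>f\<close> along a segment shorter than \<open>h\<close> is at most
  \<open>h\<close> times the average of \<open>norm Df\<close> on it. Jensen's inequality on the
  unit interval moves the convex \<open>G\<close> inside this average.\<close>

lemma G_increment_along_segment:
  fixes f :: "'a::euclidean_space \<Rightarrow> real"
  assumes D: "\<And>x. (f has_derivative (\<lambda>h. Df x \<bullet> h)) (at x)" and cont: "continuous_on UNIV Df"
    and l: "0 < l" "0 < h" "norm y < h" "l \<le> f x - f (x + y)"
  shows "ennreal (G (l / h)) \<le> (\<integral>\<^sup>+s. ennreal (G (norm (Df (x + s *\<^sub>R y)))) * indicator {0..1} s \<partial>lborel)"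
proof -
  let ?p = "\<lambda>s. norm (Df (x + s *\<^sub>R y))"
  let ?I = "\<lambda>\<phi>. (\<integral>s. indicator {0..1::real} s *\<^sub>R \<phi> s \<partial>lborel) :: real"
  have c: "continuous_on A (\<lambda>s. Df (x + s *\<^sub>R y))" for A
    by (rule continuous_on_compose2[OF cont]) (auto intro!: continuous_intros)
  have pc: "continuous_on A ?p" for A by (intro continuous_intros c)
  have int: "integrable lborel (\<lambda>s. indicator {0..1::real} s *\<^sub>R \<phi> s)" if "continuous_on {0..1} \<phi>" for \<phi> :: "real \<Rightarrow> real"
    by (rule borel_integrable_compact[OF compact_Icc that])
  have D1: "((\<lambda>s. f (x + s *\<^sub>R y)) has_real_derivative (Df (x + s *\<^sub>R y) \<bullet> y)) (at s)" for s
  proof -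
    have "((\<lambda>s. x + s *\<^sub>R y) has_derivative (\<lambda>h. h *\<^sub>R y)) (at s)"
      by (auto intro!: derivative_eq_intros)
    from has_derivative_compose[OF this D] show ?thesis
      by (simp add: has_field_derivative_def mult_commute_abs)
  qed
  have "?I (\<lambda>s. Df (x + s *\<^sub>R y) \<bullet> y) = f (x + 1 *\<^sub>R y) - f (x + 0 *\<^sub>R y)"
    by (rule integral_FTC_Icc) (auto intro!: D1[unfolded has_real_derivative_iff_has_vector_derivative]
        has_vector_derivative_at_within continuous_intros c D1[THEN has_field_derivative_at_within, unfolded has_real_derivative_iff_has_vector_derivative])
  then have "f x - f (x + y) = - ?I (\<lambda>s. Df (x + s *\<^sub>R y) \<bullet> y)" by simp
  also have "\<dots> \<le> norm (?I (\<lambda>s. Df (x + s *\<^sub>R y) \<bullet> y))" by simp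
  also have "\<dots> \<le> (\<integral>s. norm (indicator {0..1::real} s *\<^sub>R (Df (x + s *\<^sub>R y) \<bullet> y)) \<partial>lborel)"
    by (rule integral_norm_bound)
  also have "\<dots> \<le> (\<integral>s. h * (indicator {0..1::real} s *\<^sub>R ?p s) \<partial>lborel)"
  proof (rule integral_mono)
    fix s
    have "\<bar>Df (x + s *\<^sub>R y) \<bullet> y\<bar> \<le> ?p s * norm y" by (rule Cauchy_Schwarz_ineq2)
    also have "\<dots> \<le> ?p s * h" using l by (intro mult_left_mono) auto
    finally show "norm (indicator {0..1} s *\<^sub>R (Df (x + s *\<^sub>R y) \<bullet> y)) \<le> h * (indicator {0..1} s *\<^sub>R ?p s)"
      by (auto simp: indicator_def mult.commute)
  qed (intro integrable_norm int integrable_mult_right continuous_intros c pc)+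
  also have "\<dots> = h * ?I ?p" by simp
  finally have le: "l / h \<le> ?I ?p" using l by (simp add: field_simps)
  have Ip: "0 \<le> ?I ?p" by (simp add: Bochner_Integration.integral_nonneg)
  obtain k where k: "\<And>b. G (?I ?p) + k * (b - ?I ?p) \<le> G b" using G_support by blast
  have one: "?I (\<lambda>_. 1) = 1" by simp
  define a where "a = ?I ?p"
  have "G a = ?I (\<lambda>s. (G a - k * a) + k * ?p s)"
  proof -
    have "?I (\<lambda>s. (G a - k * a) + k * ?p s) = (\<integral>s. (G a - k * a) * (indicator {0..1} s *\<^sub>R 1) + k * (indicator {0..1} s *\<^sub>R ?p s) \<partial>lborel)"
      by (intro Bochner_Integration.integral_cong) (auto simp: indicator_def)
    also have "\<dots> = (G a - k * a) * ?I (\<lambda>_. 1) + k * ?I ?p"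
      by (subst Bochner_Integration.integral_add) (intro integrable_mult_right int continuous_intros pc | simp)+
    finally show ?thesis using one by (simp add: a_def)
  qed
  also have "\<dots> \<le> ?I (\<lambda>s. G (?p s))"
  proof (rule integral_mono)
    fix s
    have "G a - k * a + k * ?p s \<le> G (?p s)" using k[of "?p s"] unfolding a_def by (simp only: right_diff_distrib)
    then show "indicator {0..1} s *\<^sub>R (G a - k * a + k * ?p s) \<le> indicator {0..1} s *\<^sub>R G (?p s)"
      by (rule scaleR_left_mono) simp
  qed (intro int continuous_intros c pc continuous_on_compose2[OF G_cont[of UNIV]] | simp)+
  finally have "G (l / h) \<le> ?I (\<lambda>s. G (?p s))" using G_mono[OF le] by (simp add: a_def)
  then have "ennreal (G (l / h)) \<le> ennreal (?I (\<lambda>s. G (?p s)))" by (rule ennreal_leI)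
  also have "\<dots> = (\<integral>\<^sup>+s. ennreal (indicator {0..1} s *\<^sub>R G (?p s)) \<partial>lborel)"
    by (intro nn_integral_eq_integral[symmetric] int continuous_on_compose2[OF G_cont[of UNIV]] pc AE_I2) auto
  also have "\<dots> = (\<integral>\<^sup>+s. ennreal (G (?p s)) * indicator {0..1} s \<partial>lborel)"
    by (intro nn_integral_cong) (auto simp: indicator_def)
  finally show ?thesis .
qed

text \<open>The segment estimate is integrated over \<open>x\<close> in the superlevel set and over
  \<open>y\<close> in the ball. By translation invariance the integral of
  \<open>G (norm (Df (x + s y)))\<close> over \<open>x\<close> depends on neither \<open>s\<close>
  nor \<open>y\<close>, so the volume of the ball cancels; the factor 2 remains because only half of
  the \<open>y\<close> are known to be good.\<close>

lemma superlevel_gradient_bound: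
  fixes f :: "'a::euclidean_space \<Rightarrow> real"
  assumes D: "\<And>x. (f has_derivative (\<lambda>h. Df x \<bullet> h)) (at x)" and cont: "continuous_on UNIV Df"
    and l: "0 < l" "0 < h"
    and M: "(\<integral>\<^sup>+x. ennreal ((f x)\<^sup>2) \<partial>lborel) \<le> ennreal M" "2 * M \<le> l\<^sup>2 * measure lborel (ball (0::'a) h)" "0 \<le> M"
  shows "emeasure lborel {x. 2 * l < f x} * ennreal (G (l / h)) \<le> 2 * (\<integral>\<^sup>+x. ennreal (G (norm (Df x))) \<partial>lborel)"
proof -
  define V where "V = measure lborel (ball (0::'a) h)"
  have V: "0 < V" using content_ball_pos[OF l(2), of "0::'a"] by (simp add: V_def)
  have eV: "emeasure lborel (ball (0::'a) h) = ennreal V"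
    unfolding V_def by (rule emeasure_eq_ennreal_measure) (use emeasure_bounded_finite[of "ball (0::'a) h"] in simp)
  have "continuous_on UNIV f" using D by (meson has_derivative_continuous continuous_at_imp_continuous_on)
  then have [measurable]: "f \<in> borel_measurable borel" "Df \<in> borel_measurable borel"
    using cont by (auto intro: borel_measurable_continuous_onI)
  let ?J = "\<lambda>x y. \<integral>\<^sup>+s. ennreal (G (norm (Df (x + s *\<^sub>R y)))) * indicator {0..1::real} s \<partial>lborel"
  \<comment> \<open>Chebyshev's inequality at level \<open>l\<close>; the assumption on
    \<open>M\<close> is calibrated to give half the volume of the ball.\<close>
  have cheb: "emeasure lborel {x. l < f x} \<le> ennreal (V / 2)"
  proof -
    have "ennreal (l\<^sup>2) * emeasure lborel {x. l < f x} = (\<integral>\<^sup>+x. ennreal (l\<^sup>2) * indicator {x. l < f x} x \<partial>lborel)"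
      by (rule nn_integral_cmult_indicator[symmetric]) measurable
    also have "\<dots> \<le> (\<integral>\<^sup>+x. ennreal ((f x)\<^sup>2) \<partial>lborel)"
      using l by (intro nn_integral_mono) (auto simp: indicator_def intro!: ennreal_leI power_mono)
    also have "\<dots> \<le> ennreal M" by (rule M)
    also have "\<dots> \<le> ennreal (l\<^sup>2 * (V / 2))" using M(2) by (intro ennreal_leI) (simp add: V_def)
    also have "\<dots> = ennreal (l\<^sup>2) * ennreal (V / 2)" using V by (subst ennreal_mult) auto
    finally show ?thesis using l by (subst (asm) ennreal_mult_le_mult_iff) auto
  qed
  have half: "ennreal (V / 2) * ennreal (G (l / h)) \<le> (\<integral>\<^sup>+y. ?J x y * indicator (ball 0 h) y \<partial>lborel)"
    if x: "2 * l < f x" for x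
  proof -
    let ?Y = "{y \<in> ball 0 h. f (x + y) \<le> l}"
    have Y[measurable]: "?Y \<in> sets borel" by measurable
    have "ennreal V \<le> emeasure lborel (?Y \<union> {y. l < f (x + y)})"
      unfolding eV[symmetric] by (intro emeasure_mono) auto
    also have "\<dots> \<le> emeasure lborel ?Y + emeasure lborel {y. l < f (x + y)}"
      by (rule emeasure_subadditive) auto
    also have "emeasure lborel {y. l < f (x + y)} = emeasure lborel {x. l < f x}"
    proof -
      have eq: "(\<lambda>y. indicator {x. l < f x} (x + y)) = (indicator {y. l < f (x + y)} :: 'a \<Rightarrow> ennreal)"
        by (auto simp: indicator_def fun_eq_iff)
      have "emeasure lborel {y. l < f (x + y)} = (\<integral>\<^sup>+y. indicator {x. l < f x} (x + y) \<partial>lborel)"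
        unfolding eq by simp
      also have "\<dots> = emeasure lborel {x. l < f x}"
        by (subst nn_integral_lborel_translate) auto
      finally show ?thesis .
    qed
    finally have "ennreal V \<le> emeasure lborel ?Y + ennreal (V / 2)"
      using cheb by (meson add_left_mono order_trans)
    moreover have "ennreal V = ennreal (V / 2) + ennreal (V / 2)"
      using V by (simp add: ennreal_plus[symmetric] del: ennreal_plus)
    ultimately have "ennreal (V / 2) \<le> emeasure lborel ?Y" by simp
    then have "ennreal (V / 2) * ennreal (G (l / h)) \<le> emeasure lborel ?Y * ennreal (G (l / h))"
      by (rule mult_right_mono) simp
    also have "\<dots> = (\<integral>\<^sup>+y. ennreal (G (l / h)) * indicator ?Y y \<partial>lborel)"
      by (subst nn_integral_cmult_indicator) (auto simp: mult.commute)
    also have "\<dots> \<le> (\<integral>\<^sup>+y. ?J x y * indicator (ball 0 h) y \<partial>lborel)"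
    proof (rule nn_integral_mono)
      fix y
      show "ennreal (G (l / h)) * indicator ?Y y \<le> ?J x y * indicator (ball 0 h) y"
      proof (cases "y \<in> ?Y")
        case True
        then have "ennreal (G (l / h)) \<le> ?J x y"
          using x by (intro G_increment_along_segment[OF D cont l]) auto
        then show ?thesis using True by (simp add: indicator_def)
      qed simp
    qed
    finally show ?thesis .
  qed
  have [measurable]: "{x. 2 * l < f x} \<in> sets borel" by measurable
  have [measurable]: "ball (0::'a) h \<in> sets borel" by simp
  have "(ennreal (V / 2) * ennreal (G (l / h))) * emeasure lborel {x. 2 * l < f x} =
      (\<integral>\<^sup>+x. (ennreal (V / 2) * ennreal (G (l / h))) * indicator {x. 2 * l < f x} x \<partial>lborel)"
    by (rule nn_integral_cmult_indicator[symmetric]) measurable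
  also have "\<dots> \<le> (\<integral>\<^sup>+x. (\<integral>\<^sup>+y. ?J x y * indicator (ball 0 h) y \<partial>lborel) \<partial>lborel)"
    using half by (intro nn_integral_mono) (auto simp: indicator_def)
  also have "\<dots> = (\<integral>\<^sup>+y. (\<integral>\<^sup>+x. ?J x y * indicator (ball 0 h) y \<partial>lborel) \<partial>lborel)"
    by (rule lborel_pair.Fubini'[symmetric]) measurable
  also have "\<dots> = (\<integral>\<^sup>+y. (\<integral>\<^sup>+x. ennreal (G (norm (Df x))) \<partial>lborel) * indicator (ball (0::'a) h) y \<partial>lborel)"
  proof (rule nn_integral_cong)
    fix y :: 'a
    have "(\<integral>\<^sup>+x. ?J x y * indicator (ball 0 h) y \<partial>lborel) = (\<integral>\<^sup>+x. ?J x y \<partial>lborel) * indicator (ball 0 h) y"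
      by (rule nn_integral_multc) measurable
    also have "(\<integral>\<^sup>+x. ?J x y \<partial>lborel) =
        (\<integral>\<^sup>+s. (\<integral>\<^sup>+x. ennreal (G (norm (Df (x + s *\<^sub>R y)))) * indicator {0..1::real} s \<partial>lborel) \<partial>lborel)"
      by (rule lborel_pair.Fubini'[symmetric]) measurable
    also have "\<dots> = (\<integral>\<^sup>+s. (\<integral>\<^sup>+x. ennreal (G (norm (Df x))) \<partial>lborel) * indicator {0..1::real} s \<partial>lborel)"
    proof (rule nn_integral_cong)
      fix s :: real
      have "(\<integral>\<^sup>+x. ennreal (G (norm (Df (x + s *\<^sub>R y)))) * indicator {0..1::real} s \<partial>lborel) =
          (\<integral>\<^sup>+x. ennreal (G (norm (Df (s *\<^sub>R y + x)))) \<partial>lborel) * indicator {0..1::real} s"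
        by (subst nn_integral_multc) (auto simp: add.commute)
      also have "(\<integral>\<^sup>+x. ennreal (G (norm (Df (s *\<^sub>R y + x)))) \<partial>lborel) = (\<integral>\<^sup>+x. ennreal (G (norm (Df x))) \<partial>lborel)"
        by (rule nn_integral_lborel_translate[of "\<lambda>x. ennreal (G (norm (Df x)))"]) measurable
      finally show "(\<integral>\<^sup>+x. ennreal (G (norm (Df (x + s *\<^sub>R y)))) * indicator {0..1::real} s \<partial>lborel) =
          (\<integral>\<^sup>+x. ennreal (G (norm (Df x))) \<partial>lborel) * indicator {0..1::real} s" .
    qed
    also have "\<dots> = (\<integral>\<^sup>+x. ennreal (G (norm (Df x))) \<partial>lborel)"
      by (subst nn_integral_cmult_indicator) auto
    finally show "(\<integral>\<^sup>+x. ?J x y * indicator (ball 0 h) y \<partial>lborel) =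
        (\<integral>\<^sup>+x. ennreal (G (norm (Df x))) \<partial>lborel) * indicator (ball 0 h) y" .
  qed
  also have "\<dots> = (\<integral>\<^sup>+x. ennreal (G (norm (Df x))) \<partial>lborel) * ennreal V"
    by (subst nn_integral_cmult_indicator) (auto simp: eV)
  finally have le: "ennreal (2 / V) * ((ennreal (V / 2) * ennreal (G (l / h))) * emeasure lborel {x. 2 * l < f x}) \<le>
      ennreal (2 / V) * ((\<integral>\<^sup>+x. ennreal (G (norm (Df x))) \<partial>lborel) * ennreal V)"
    by (rule mult_left_mono) simp
  have 1: "ennreal (2 / V) * ennreal (V / 2) = 1" "ennreal (2 / V) * ennreal V = 2"
    using V by (simp_all add: ennreal_mult[symmetric])
  have "emeasure lborel {x. 2 * l < f x} * ennreal (G (l / h)) =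
      (ennreal (2 / V) * ennreal (V / 2)) * (ennreal (G (l / h)) * emeasure lborel {x. 2 * l < f x})"
    unfolding 1 by (simp add: mult.commute)
  also have "\<dots> \<le> (ennreal (2 / V) * ennreal V) * (\<integral>\<^sup>+x. ennreal (G (norm (Df x))) \<partial>lborel)"
    using le by (simp only: ac_simps)
  finally show ?thesis unfolding 1 .
qed

end

section \<open>Summation over dyadic levels\<close>

lemma ennreal_le_divideI:
  assumes "E * ennreal p \<le> ennreal q" "0 < p" "0 \<le> q"
  shows "E \<le> ennreal (q / p)"
proof (cases E)
  case (real r)
  then have "ennreal (r * p) \<le> ennreal q" using assms by (simp add: ennreal_mult)
  then show ?thesis using real assms by (simp add: field_simps)
next
  case top
  then show ?thesis using assms by (simp add: ennreal_top_mult top_unique)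
qed

text \<open>Each point of the superlevel set lies in a shell between \<open>2 * 2^i * l\<close> and
  \<open>4 * 2^i * l\<close>, with \<open>i\<close> the least index whose upper end suffices; there
  the monotone \<open>\<Psi>\<close> is bounded by its value at the upper end.\<close>

lemma nn_integral_dyadic:
  fixes f :: "'b \<Rightarrow> real" and \<Psi> :: "real \<Rightarrow> real"
  assumes [measurable]: "f \<in> borel_measurable M" and l: "0 < l"
    and \<Psi>: "\<And>a b. 0 \<le> a \<Longrightarrow> a \<le> b \<Longrightarrow> \<Psi> a \<le> \<Psi> b"
  shows "(\<integral>\<^sup>+z. ennreal (\<Psi> (f z)) * indicator {z \<in> space M. 2 * l < f z} z \<partial>M) \<le>
    (\<Sum>i. ennreal (\<Psi> (4 * (2 ^ i * l))) * emeasure M {z \<in> space M. 2 * (2 ^ i * l) < f z})"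
proof -
  have "(\<integral>\<^sup>+z. ennreal (\<Psi> (f z)) * indicator {z \<in> space M. 2 * l < f z} z \<partial>M) \<le>
     (\<integral>\<^sup>+z. (\<Sum>i. ennreal (\<Psi> (4 * (2 ^ i * l))) * indicator {z \<in> space M. 2 * (2 ^ i * l) < f z} z) \<partial>M)"
  proof (rule nn_integral_mono)
    fix z assume z: "z \<in> space M"
    let ?t = "\<lambda>i. ennreal (\<Psi> (4 * (2 ^ i * l))) * indicator {z \<in> space M. 2 * (2 ^ i * l) < f z} z"
    show "ennreal (\<Psi> (f z)) * indicator {z \<in> space M. 2 * l < f z} z \<le> (\<Sum>i. ?t i)"
    proof (cases "2 * l < f z")
      case True
      obtain j :: nat where "f z / (4 * l) < 2 ^ j" using real_arch_pow[of 2] by auto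
      then have ex: "\<exists>j::nat. f z \<le> 4 * (2 ^ j * l)" using l by (intro exI[of _ j]) (simp add: field_simps)
      define i where "i = (LEAST j. f z \<le> 4 * (2 ^ j * l))"
      have i1: "f z \<le> 4 * (2 ^ i * l)" unfolding i_def by (rule LeastI_ex[OF ex])
      have i2: "2 * (2 ^ i * l) < f z"
      proof (cases i)
        case (Suc j)
        have "\<not> f z \<le> 4 * (2 ^ j * l)" by (rule not_less_Least) (use Suc i_def in auto)
        then show ?thesis using Suc by simp
      qed (use True in simp)
      have "ennreal (\<Psi> (f z)) \<le> ?t i"
        using z i2 i1 True l by (auto intro!: ennreal_leI \<Psi>)
      also have "\<dots> \<le> (\<Sum>i. ?t i)"
      proof -
        have "t i \<le> suminf t" for t :: "nat \<Rightarrow> ennreal" using sum_le_suminf[of t "{i}"] by simp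
        then show ?thesis .
      qed
      finally show ?thesis using True z by simp
    qed simp
  qed
  also have "\<dots> = (\<Sum>i. ennreal (\<Psi> (4 * (2 ^ i * l))) * emeasure M {z \<in> space M. 2 * (2 ^ i * l) < f z})"
    by (subst nn_integral_suminf) (auto simp: nn_integral_cmult_indicator)
  finally show ?thesis .
qed

text \<open>The sum of two geometric series, one for the \<open>G\<close> term and one for the
  quadratic term of the excess. The prefactor is the cost of passing from level \<open>4 * l\<close>
  to \<open>l\<close> in both terms.\<close>

definition gain_const :: "real \<Rightarrow> real \<Rightarrow> nat \<Rightarrow> real" where
  "gain_const g0 g1 n =
     4 powr max g1 2 * (1 / (1 - 4 powr (- (g0 / n))) + 1 / (1 - 2 powr (2 - g0 - 2 * (g0 / n))))"

text \<open>Multiplied by \<open>n\<close> this reads \<open>2 n < (n + 2) g0\<close>. It makes the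
  ratio of the second geometric series smaller than 1.\<close>

lemma gain_exponent_neg:
  fixes n :: nat
  assumes "1 \<le> n" "2 * real n / (real n + 2) < g0"
  shows "2 - g0 - 2 * (g0 / n) < 0"
  using assms by (simp add: field_simps)

lemma gain_const_pos:
  assumes "1 \<le> n" "0 < g0" "2 * real n / (real n + 2) < g0"
  shows "0 < gain_const g0 g1 n"
  using assms gain_exponent_neg[OF assms(1,3)] unfolding gain_const_def
  by (intro mult_pos_pos add_pos_pos divide_pos_pos) (auto simp: powr_less_one)

context growth
begin

text \<open>
  The choice \<open>h = \<rho> / a\<close> with \<open>a\<^sup>n = \<omega> \<rho>\<^sup>n l\<^sup>2 / (4 S)\<close>, \<open>S = s \<rho>\<^sup>n k\<^sup>2\<close>, saturates the side condition of
  the hypothesis \<open>lev\<close>.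
\<close>

lemma dyadic_gain:
  fixes f :: "'b \<Rightarrow> real" and n :: nat
  assumes n: "1 \<le> n" and g0n: "2 * real n / (real n + 2) < g0"
    and f: "f \<in> borel_measurable M" and C: "0 < C" and \<omega>: "0 < \<omega>" and s: "0 < s" and k: "0 < k" and \<rho>: "0 < \<rho>"
    and \<mu>: "0 < \<mu>" "\<mu> \<le> 1" and s\<mu>: "4 * s \<le> \<omega> * \<mu>\<^sup>2"
    and lev: "\<And>l h. 0 < l \<Longrightarrow> 0 < h \<Longrightarrow> 4 * (s * \<rho> ^ n * k\<^sup>2) \<le> l\<^sup>2 * (\<omega> * h ^ n) \<Longrightarrow>
      emeasure M {z \<in> space M. 2 * l < f z} * ennreal (G (l / h)) \<le> ennreal (C * (s * \<rho> ^ n * k\<^sup>2))"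
  shows "(\<integral>\<^sup>+z. ennreal (G (f z / \<rho>) + (f z)\<^sup>2 / k\<^sup>2 * G (k / \<rho>)) * indicator {z \<in> space M. 2 * (k * \<mu>) < f z} z \<partial>M)
    \<le> ennreal (gain_const g0 g1 n * C * (4 * s / \<omega>) powr (g0 / n) * \<mu> powr (- 2 * (g0 / n) - g1) * (s * \<rho> ^ n * k\<^sup>2))"
proof -
  define \<alpha> where "\<alpha> = g0 / n"
  have \<alpha>: "0 < \<alpha>" using n g0_gt by (simp add: \<alpha>_def)
  have n0: "0 < real n" using n by simp
  \<comment> \<open>At level \<open>2^i * k * \<mu>\<close> the Chebyshev gain contributes
    \<open>r1^i\<close>. The quadratic term grows against \<open>G\<close> by a further factor
    \<open>2 powr (2 - g0)\<close> per level, and the product of the two is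
    \<open>r2\<close>.\<close>
  define r1 where "r1 = 4 powr (- \<alpha>)"
  define r2 where "r2 = 2 powr (2 - g0 - 2 * \<alpha>)"
  have r1: "0 < r1" "r1 < 1" using \<alpha> unfolding r1_def by (auto simp: powr_less_one)
  have "2 - g0 - 2 * \<alpha> < 0" using gain_exponent_neg[OF n g0n] by (simp add: \<alpha>_def)
  then have r2: "0 < r2" "r2 < 1" unfolding r2_def by (auto simp: powr_less_one)
  define m where "m = max g1 2"
  define K where "K = gain_const g0 g1 n"
  have K_def': "K = 4 powr m * (1 / (1 - r1) + 1 / (1 - r2))"
    by (simp add: K_def gain_const_def m_def r1_def r2_def \<alpha>_def)
    define H where "H = G (k / \<rho>)"
    define \<Psi> where "\<Psi> t = G (t / \<rho>) + t\<^sup>2 / k\<^sup>2 * H" for t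
    define S where "S = s * \<rho> ^ n * k\<^sup>2"
    define D where "D = \<omega> / (4 * s)"
    have H: "0 < H" using k \<rho> G_pos by (simp add: H_def)
    have S: "0 < S" using s \<rho> k by (simp add: S_def)
    have D: "0 < D" "1 \<le> \<mu>\<^sup>2 * D" using s \<omega> s\<mu> by (auto simp: D_def field_simps)
    have \<Psi>mono: "\<Psi> a \<le> \<Psi> b" if "0 \<le> a" "a \<le> b" for a b
      unfolding \<Psi>_def using that k \<rho> H by (intro add_mono G_mono divide_right_mono mult_right_mono power_mono) auto
    define c where "c i = C * S * D powr (- \<alpha>) * \<mu> powr (- 2 * \<alpha> - g1)" for i :: nat
    have step: "ennreal (\<Psi> (4 * (2 ^ i * (k * \<mu>)))) * emeasure M {z \<in> space M. 2 * (2 ^ i * (k * \<mu>)) < f z}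
        \<le> ennreal (4 powr m * (r1 ^ i + r2 ^ i) * c i)" for i
    proof -
      define \<mu>i where "\<mu>i = 2 ^ i * \<mu>"
      define l where "l = k * \<mu>i"
      have \<mu>i: "0 < \<mu>i" "\<mu> \<le> \<mu>i" using \<mu> by (auto simp: \<mu>i_def)
      have l: "0 < l" using k \<mu>i by (simp add: l_def)
      have l_eq: "2 ^ i * (k * \<mu>) = l" by (simp add: l_def \<mu>i_def)
      define a where "a = (\<mu>i\<^sup>2 * D) powr (1 / n)"
      have "\<mu>\<^sup>2 * D \<le> \<mu>i\<^sup>2 * D" using \<mu>i \<mu> D by (intro mult_right_mono power_mono) auto
      \<comment> \<open>The smallness of \<open>s\<close> relative to \<open>\<mu>^2\<close> enters
        here: it yields \<open>a >= 1\<close>, that is \<open>h <= \<rho>\<close>, so that the lower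
        exponent \<open>g0\<close> governs the passage from \<open>l / \<rho>\<close> to
        \<open>l / h\<close>.\<close>
      then have aD: "1 \<le> \<mu>i\<^sup>2 * D" using D(2) by (rule order_trans[rotated])
      then have a: "1 \<le> a" unfolding a_def by (intro ge_one_powr_ge_zero) auto
      have an: "a ^ n = \<mu>i\<^sup>2 * D"
      proof -
        have "(b powr (1 / n)) ^ n = b" if "0 < b" for b :: real
          using powr_realpow[of "b powr (1 / n)" n] that n0 by (simp add: powr_powr)
        then show ?thesis unfolding a_def using aD by simp
      qed
      define h where "h = \<rho> / a"
      have h: "0 < h" using \<rho> a by (simp add: h_def)
      have "4 * S = l\<^sup>2 * (\<omega> * h ^ n)"
        using a s \<omega> \<mu>i unfolding h_def power_divide an by (simp add: S_def l_def D_def field_simps power2_eq_square)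
      then have 1: "emeasure M {z \<in> space M. 2 * l < f z} * ennreal (G (l / h)) \<le> ennreal (C * S)"
        using lev[OF l h] unfolding S_def by simp
      have Gl: "0 < G (l / \<rho>)" using l \<rho> G_pos by simp
      have 2: "a powr g0 * G (l / \<rho>) \<le> G (l / h)"
        using G_scale_ge[OF a, of "l / \<rho>"] by (simp add: h_def mult.commute)
      have ag: "0 < a powr g0" using a by simp
      have ageq: "a powr g0 = (\<mu>i\<^sup>2 * D) powr \<alpha>"
        using aD by (simp add: a_def powr_powr \<alpha>_def)
      have 3: "emeasure M {z \<in> space M. 2 * l < f z} \<le> ennreal (C * S / (a powr g0 * G (l / \<rho>)))"
      proof -
        have p: "0 < a powr g0 * G (l / \<rho>)" using ag Gl by simp
        have "emeasure M {z \<in> space M. 2 * l < f z} * ennreal (a powr g0 * G (l / \<rho>)) \<le> ennreal (C * S)"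
          by (rule order_trans[OF mult_left_mono[OF ennreal_leI[OF 2]] 1]) simp
        then show ?thesis by (rule ennreal_le_divideI[OF _ p]) (use C S in simp)
      qed
      have 4: "\<Psi> (4 * l) \<le> 4 powr m * \<Psi> l"
      proof -
        have "G (4 * l / \<rho>) \<le> 4 powr g1 * G (l / \<rho>)" using G_scale_le[of 4 "l / \<rho>"] by simp
        also have "\<dots> \<le> 4 powr m * G (l / \<rho>)" by (intro mult_right_mono powr_mono) (auto simp: m_def)
        finally have g: "G (4 * l / \<rho>) \<le> 4 powr m * G (l / \<rho>)" .
        have "(4::real) powr 2 \<le> 4 powr m" by (intro powr_mono) (auto simp: m_def)
        then have "(16::real) \<le> 4 powr m" by simp
        then have "16 * (l\<^sup>2 / k\<^sup>2 * H) \<le> 4 powr m * (l\<^sup>2 / k\<^sup>2 * H)"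
          using H by (intro mult_right_mono) auto
        then show ?thesis using g unfolding \<Psi>_def by (simp add: power_mult_distrib algebra_simps)
      qed
      \<comment> \<open>Comparison of the quadratic term with \<open>G (l / \<rho>)\<close>:
        descending from \<open>k\<close> to \<open>k * \<mu>\<close> costs
        \<open>\<mu> powr (- g1)\<close> by the upper exponent, and ascending from
        \<open>k * \<mu>\<close> to \<open>l\<close> gains \<open>2 powr (i * g0)\<close> by the
        lower one.\<close>
      have 5: "\<mu>i\<^sup>2 * H \<le> r2 ^ i / r1 ^ i * \<mu> powr (- g1) * G (l / \<rho>)"
      proof -
        have "H = G ((1 / \<mu>) * (k * \<mu> / \<rho>))" using \<mu> by (simp add: H_def)
        also have "\<dots> \<le> (1 / \<mu>) powr g1 * G (k * \<mu> / \<rho>)" by (rule G_scale_le) (use \<mu> in simp)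
        also have "(1 / \<mu>) powr g1 = \<mu> powr (- g1)" using \<mu> by (simp add: powr_divide powr_minus field_simps)
        finally have H1: "H \<le> \<mu> powr (- g1) * G (k * \<mu> / \<rho>)" .
        have "(2 ^ i) powr g0 * G (k * \<mu> / \<rho>) \<le> G (2 ^ i * (k * \<mu> / \<rho>))" by (rule G_scale_ge) simp
        also have "2 ^ i * (k * \<mu> / \<rho>) = l / \<rho>" by (simp add: l_def \<mu>i_def)
        finally have H2: "G (k * \<mu> / \<rho>) \<le> (2 ^ i) powr (- g0) * G (l / \<rho>)"
          by (simp add: powr_minus field_simps)
        have rr: "4 ^ i * (2 ^ i) powr (- g0) = r2 ^ i / r1 ^ i"
        proof -
          have "r2 / r1 = 2 powr (2 - g0 - 2 * \<alpha>) / (2 powr 2) powr (- \<alpha>)" by (simp add: r2_def r1_def)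
          also have "\<dots> = 2 powr (2 - g0)" by (simp only: powr_powr powr_diff[symmetric]) simp
          finally have "r2 ^ i / r1 ^ i = (2 powr (2 - g0)) ^ i" by (simp add: power_divide[symmetric])
          also have "\<dots> = (2 ^ i) powr (2 - g0)"
            by (simp add: powr_realpow[symmetric] powr_powr mult.commute)
          also have "\<dots> = (2 ^ i) powr 2 * (2 ^ i) powr (- g0)"
            using powr_add[of "2 ^ i :: real" 2 "- g0"] by (simp only: diff_conv_add_uminus)
          also have "(2 ^ i :: real) powr 2 = 4 ^ i"
            by (simp add: power2_eq_square power_mult_distrib[symmetric] powr_numeral)
          finally show ?thesis ..
        qed
        have "\<mu>i\<^sup>2 = 4 ^ i * \<mu>\<^sup>2" by (simp add: \<mu>i_def power_mult_distrib power2_eq_square[of "2 ^ i"] power_mult_distrib[symmetric])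
        also have "\<dots> \<le> 4 ^ i * 1" using \<mu> by (intro mult_left_mono) (auto simp: power_le_one)
        finally have "\<mu>i\<^sup>2 * H \<le> 4 ^ i * H" using H by (intro mult_right_mono) auto
        also have "\<dots> \<le> 4 ^ i * (\<mu> powr (- g1) * ((2 ^ i) powr (- g0) * G (l / \<rho>)))"
          using H1 H2 by (intro mult_left_mono order_trans[OF H1] mult_left_mono) auto
        also have "\<dots> = (4 ^ i * (2 ^ i) powr (- g0)) * \<mu> powr (- g1) * G (l / \<rho>)" by simp
        finally show ?thesis unfolding rr .
      qed
      have 6: "\<Psi> l \<le> (1 + r2 ^ i / r1 ^ i) * \<mu> powr (- g1) * G (l / \<rho>)"
      proof -
        have "1 \<le> \<mu> powr (- g1)"
        proof -
          have "\<mu> powr g1 \<le> 1" using \<mu> g0_gt g0_le by (intro powr_le1) auto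
          then show ?thesis using \<mu> by (simp add: powr_minus one_le_inverse)
        qed
        then have "G (l / \<rho>) \<le> \<mu> powr (- g1) * G (l / \<rho>)" using mult_right_mono[of 1 "\<mu> powr (- g1)" "G (l / \<rho>)"] by simp
        moreover have "l\<^sup>2 / k\<^sup>2 * H = \<mu>i\<^sup>2 * H" using k by (simp add: l_def power_mult_distrib)
        ultimately show ?thesis using 5 unfolding \<Psi>_def by (simp add: algebra_simps)
      qed
      have \<Psi>0: "0 \<le> \<Psi> l" using H unfolding \<Psi>_def by simp
      have "ennreal (\<Psi> (4 * l)) * emeasure M {z \<in> space M. 2 * l < f z}
          \<le> ennreal (4 powr m * \<Psi> l) * ennreal (C * S / (a powr g0 * G (l / \<rho>)))"
        by (intro mult_mono ennreal_leI 4 3) auto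
      also have "\<dots> = ennreal (4 powr m * \<Psi> l * (C * S / (a powr g0 * G (l / \<rho>))))"
        using \<Psi>0 C S ag Gl by (subst ennreal_mult) auto
      also have "\<dots> \<le> ennreal (4 powr m * ((1 + r2 ^ i / r1 ^ i) * \<mu> powr (- g1) * G (l / \<rho>)) * (C * S / (a powr g0 * G (l / \<rho>))))"
        using C S ag Gl by (intro ennreal_leI mult_right_mono mult_left_mono 6) auto
      also have "4 powr m * ((1 + r2 ^ i / r1 ^ i) * \<mu> powr (- g1) * G (l / \<rho>)) * (C * S / (a powr g0 * G (l / \<rho>))) =
          4 powr m * (1 + r2 ^ i / r1 ^ i) * \<mu> powr (- g1) * (C * S * inverse (a powr g0))"
        using Gl ag by (simp add: field_simps)
      also have "inverse (a powr g0) = D powr (- \<alpha>) * \<mu> powr (- 2 * \<alpha>) * r1 ^ i"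
      proof -
        have "inverse (a powr g0) = (\<mu>i\<^sup>2 * D) powr (- \<alpha>)" by (simp add: ageq powr_minus)
        also have "\<mu>i\<^sup>2 * D = (\<mu>\<^sup>2 * 4 ^ i) * D"
          by (simp add: \<mu>i_def power_mult_distrib power2_eq_square[of "2 ^ i"] power_mult_distrib[symmetric])
        also have "\<dots> powr (- \<alpha>) = ((\<mu> powr 2) powr (- \<alpha>) * (4 powr i) powr (- \<alpha>)) * D powr (- \<alpha>)"
          using \<mu> D by (simp add: powr_mult powr_realpow)
        also have "(4 powr i) powr (- \<alpha>) = r1 ^ i"
          using powr_realpow[of r1 i] r1 by (simp add: r1_def powr_powr mult.commute)
        also have "(\<mu> powr 2) powr (- \<alpha>) = \<mu> powr (- 2 * \<alpha>)" by (simp only: powr_powr) simp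
        finally show ?thesis by (simp only: ac_simps)
      qed
      also have "4 powr m * (1 + r2 ^ i / r1 ^ i) * \<mu> powr (- g1) * (C * S * (D powr (- \<alpha>) * \<mu> powr (- 2 * \<alpha>) * r1 ^ i)) =
          4 powr m * (r1 ^ i + r2 ^ i) * c i"
      proof -
        have e1: "(1 + r2 ^ i / r1 ^ i) * r1 ^ i = r1 ^ i + r2 ^ i" using r1 by (simp add: field_simps)
        have e2: "\<mu> powr (- 2 * \<alpha> - g1) = \<mu> powr (- 2 * \<alpha>) * \<mu> powr (- g1)" using powr_add[of \<mu> "- 2 * \<alpha>" "- g1"] by simp
        show ?thesis unfolding c_def e2 e1[symmetric] by (simp only: ac_simps)
      qed
      finally show ?thesis unfolding l_eq .
    qed
    have c0: "0 \<le> c 0" using C S by (simp add: c_def)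
    have ci: "c i = c 0" for i by (simp add: c_def)
    have sums: "(\<lambda>i. 4 powr m * (r1 ^ i + r2 ^ i) * c i) sums (K * c 0)"
    proof -
      have "(\<lambda>i. (4 powr m * c 0) * (r1 ^ i + r2 ^ i)) sums ((4 powr m * c 0) * (1 / (1 - r1) + 1 / (1 - r2)))"
        using r1 r2 by (intro sums_mult sums_add geometric_sums) auto
      moreover have "(\<lambda>i. 4 powr m * (r1 ^ i + r2 ^ i) * c i) = (\<lambda>i. (4 powr m * c 0) * (r1 ^ i + r2 ^ i))"
        by (rule ext) (subst ci, simp)
      moreover have "K * c 0 = (4 powr m * c 0) * (1 / (1 - r1) + 1 / (1 - r2))"
        unfolding K_def' by (simp only: ac_simps)
      ultimately show ?thesis by (simp only:)
    qed
    have "(\<integral>\<^sup>+z. ennreal (\<Psi> (f z)) * indicator {z \<in> space M. 2 * (k * \<mu>) < f z} z \<partial>M) \<le>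
        (\<Sum>i. ennreal (\<Psi> (4 * (2 ^ i * (k * \<mu>)))) * emeasure M {z \<in> space M. 2 * (2 ^ i * (k * \<mu>)) < f z})"
      by (rule nn_integral_dyadic[OF f _ \<Psi>mono]) (use k \<mu> in auto)
    also have "\<dots> \<le> (\<Sum>i. ennreal (4 powr m * (r1 ^ i + r2 ^ i) * c i))"
      by (intro suminf_le step) auto
    also have "\<dots> = ennreal (K * c 0)"
      using sums c0 r1 r2 by (intro suminf_ennreal_eq) (auto simp: c_def C S less_imp_le)
    also have "K * c 0 = K * C * (4 * s / \<omega>) powr \<alpha> * \<mu> powr (- 2 * \<alpha> - g1) * S"
    proof -
      have "D powr (- \<alpha>) = (4 * s / \<omega>) powr \<alpha>"
        using s \<omega> by (simp add: D_def powr_minus powr_divide field_simps)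
      then show ?thesis by (simp add: c_def)
    qed
    finally show ?thesis
      by (simp only: \<Psi>_def H_def S_def \<alpha>_def K_def)
qed

end

subsection \<open>Truncation\<close>

text \<open>An exponent of at least two makes the power of the positive part differentiable at 0.
  Both the truncation and the cutoff are built from such powers.\<close>

lemma pos_part_power_deriv:
  "((\<lambda>s::real. max 0 s ^ Suc (Suc m)) has_real_derivative real (Suc (Suc m)) * max 0 s ^ Suc m) (at s)"
proof -
  consider "s < 0" | "s = 0" | "0 < s" by linarith
  then show ?thesis
  proof cases
    case 1
    have "((\<lambda>_. 0) has_real_derivative 0) (at s)" by simp
    then have "((\<lambda>s::real. max 0 s ^ Suc (Suc m)) has_real_derivative 0) (at s)"
      by (rule has_field_derivative_transform_within_open[of _ _ _ "{..<0}"]) (use 1 in auto)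
    then show ?thesis using 1 by (simp add: max_def)
  next
    case 3
    have "((\<lambda>s. s ^ Suc (Suc m)) has_real_derivative real (Suc (Suc m)) * s ^ Suc m) (at s)"
      using DERIV_pow[of "Suc (Suc m)" s] by simp
    then have "((\<lambda>s::real. max 0 s ^ Suc (Suc m)) has_real_derivative real (Suc (Suc m)) * s ^ Suc m) (at s)"
      by (rule has_field_derivative_transform_within_open[of _ _ _ "{0<..}"]) (use 3 in auto)
    then show ?thesis using 3 by (simp add: max_def)
  next
    case 2
    have "((\<lambda>y::real. max 0 y ^ Suc m) \<longlongrightarrow> max 0 0 ^ Suc m) (at 0)"
      by (intro tendsto_intros)
    then have "((\<lambda>y::real. max 0 y ^ Suc m) \<longlongrightarrow> 0) (at 0)" by simp
    then have "((\<lambda>y::real. max 0 y ^ Suc (Suc m) / y) \<longlongrightarrow> 0) (at 0)"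
      by (rule Lim_transform_eventually)
        (auto simp: eventually_at_filter max_def)
    then show ?thesis using 2 by (simp add: has_field_derivative_iff)
  qed
qed

text \<open>
  A \<open>C\<^sup>1\<close> version \<open>trunc k d\<close> of \<open>(s - k)\<^sub>+\<close>: quadratic on \<open>[k, k + d]\<close> and affine with slope 1
  afterwards. It makes the chain rule classical, and \<open>trunc k d s \<le> trunc' k d s * (s - k)\<^sub>+\<close> is
  what the absorption step in the energy estimate needs.
\<close>

definition trunc :: "real \<Rightarrow> real \<Rightarrow> real \<Rightarrow> real" where
  "trunc k d s = (max 0 (s - k) ^ 2 - max 0 (s - k - d) ^ 2) / (2 * d)"

definition trunc' :: "real \<Rightarrow> real \<Rightarrow> real \<Rightarrow> real" where
  "trunc' k d s = (max 0 (s - k) - max 0 (s - k - d)) / d"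

text \<open>The primitive of \<open>trunc k d\<close>: multiplying a time derivative by the
  truncation gives the time derivative of this function.\<close>

definition Trunc :: "real \<Rightarrow> real \<Rightarrow> real \<Rightarrow> real" where
  "Trunc k d s = (max 0 (s - k) ^ 3 - max 0 (s - k - d) ^ 3) / (6 * d)"

lemma trunc_deriv:
  assumes "0 < d"
  shows "(trunc k d has_real_derivative trunc' k d s) (at s)"
    and "(Trunc k d has_real_derivative trunc k d s) (at s)"
proof -
  have sh: "((\<lambda>s. max 0 (s - a) ^ Suc (Suc m)) has_real_derivative real (Suc (Suc m)) * max 0 (s - a) ^ Suc m) (at s)" for a m
  proof -
    have "((\<lambda>s. s - a) has_real_derivative 1) (at s)" by (auto intro!: derivative_eq_intros)
    from DERIV_chain2[of "\<lambda>s. max 0 s ^ Suc (Suc m)" _ "\<lambda>s. s - a", OF pos_part_power_deriv this]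
    show ?thesis by simp
  qed
  have 2: "((\<lambda>s. max 0 (s - a)^2) has_real_derivative 2 * max 0 (s - a)) (at s)" for a
    using sh[where m = 0 and a = a] by (simp add: numeral_2_eq_2)
  have 3: "((\<lambda>s. max 0 (s - a)^3) has_real_derivative 3 * max 0 (s - a)^2) (at s)" for a
    using sh[where m = 1 and a = a] by (simp add: numeral_2_eq_2 numeral_3_eq_3)
  have "(trunc k d has_real_derivative (2 * max 0 (s - k) - 2 * max 0 (s - (k + d))) / (2 * d)) (at s)"
    unfolding trunc_def[abs_def] diff_diff_eq by (intro DERIV_cdivide DERIV_diff 2)
  also have "(2 * max 0 (s - k) - 2 * max 0 (s - (k + d))) / (2 * d) = trunc' k d s"
    unfolding trunc'_def diff_diff_eq using assms by (simp add: field_simps)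
  finally show "(trunc k d has_real_derivative trunc' k d s) (at s)" .
  have "(Trunc k d has_real_derivative (3 * max 0 (s - k)^2 - 3 * max 0 (s - (k + d))^2) / (6 * d)) (at s)"
    unfolding Trunc_def[abs_def] diff_diff_eq by (intro DERIV_cdivide DERIV_diff 3)
  also have "(3 * max 0 (s - k)^2 - 3 * max 0 (s - (k + d))^2) / (6 * d) = trunc k d s"
    unfolding trunc_def diff_diff_eq using assms by (simp add: field_simps)
  finally show "(Trunc k d has_real_derivative trunc k d s) (at s)" .
qed

lemma trunc_cont:
  "0 < d \<Longrightarrow> continuous_on A (trunc k d)" "0 < d \<Longrightarrow> continuous_on A (trunc' k d)" "0 < d \<Longrightarrow> continuous_on A (Trunc k d)"
  unfolding trunc_def[abs_def] trunc'_def[abs_def] Trunc_def[abs_def] by (auto intro!: continuous_intros)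

text \<open>With \<open>w\<close>, \<open>y\<close> the two positive parts and \<open>b\<close> the
  slope, factoring differences of squares and cubes gives \<open>trunc = b (w + y) / 2\<close> and
  \<open>Trunc = b (w^2 + w y + y^2) / 6\<close>. The bounds then follow from
  \<open>0 <= b <= 1\<close> and \<open>0 <= y <= w\<close>; beyond \<open>k + d\<close> the slope
  is exactly 1.\<close>

lemma trunc_bounds:
  assumes d: "0 < d"
  shows "0 \<le> trunc' k d s" "trunc' k d s \<le> 1"
    and "0 \<le> trunc k d s" "trunc k d s \<le> trunc' k d s * max 0 (s - k)" "trunc k d s \<le> max 0 (s - k)"
    and "0 \<le> Trunc k d s" "Trunc k d s \<le> (max 0 (s - k))\<^sup>2 / 2" "(trunc k d s)\<^sup>2 \<le> 2 * Trunc k d s"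
    and "k + d < s \<Longrightarrow> max 0 (s - k) \<le> 2 * trunc k d s"
proof -
  define w where "w = max 0 (s - k)"
  define y where "y = max 0 (s - k - d)"
  define b where "b = (w - y) / d"
  have wy: "0 \<le> y" "y \<le> w" "w - y \<le> d" using d by (auto simp: w_def y_def)
  have b: "0 \<le> b" "b \<le> 1" using wy d by (auto simp: b_def)
  have t': "trunc' k d s = b" by (simp add: trunc'_def b_def w_def y_def)
  have t: "trunc k d s = b * ((w + y) / 2)"
    using d by (simp add: trunc_def b_def flip: w_def y_def) (simp add: field_simps power2_eq_square)
  have T: "Trunc k d s = b * ((w\<^sup>2 + w * y + y\<^sup>2) / 6)"
    using d by (simp add: Trunc_def b_def flip: w_def y_def) (simp add: field_simps power2_eq_square power3_eq_cube)
  show "0 \<le> trunc' k d s" "trunc' k d s \<le> 1" using b t' by auto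
  show "0 \<le> trunc k d s" unfolding t using b wy by simp
  have 1: "trunc k d s \<le> b * w" unfolding t using b wy by (intro mult_left_mono) auto
  then show "trunc k d s \<le> trunc' k d s * max 0 (s - k)" by (simp add: t' w_def)
  have "b * w \<le> 1 * w" using b wy by (intro mult_right_mono) auto
  then show "trunc k d s \<le> max 0 (s - k)" using 1 by (simp add: w_def)
  show "0 \<le> Trunc k d s" unfolding T using b wy by simp
  have wyy: "w * y \<le> w\<^sup>2" "y\<^sup>2 \<le> w\<^sup>2" using wy by (auto simp: power2_eq_square intro: mult_mono)
  have "Trunc k d s \<le> 1 * (w\<^sup>2 / 2)"
    unfolding T
  proof (intro mult_mono b)
    have "(a + b + c) / 6 \<le> a / 2" if "b \<le> a" "c \<le> a" for a b c :: real using that by simp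
    from this[OF wyy] show "(w\<^sup>2 + w * y + y\<^sup>2) / 6 \<le> w\<^sup>2 / 2" .
  qed (use wy in auto)
  then show "Trunc k d s \<le> (max 0 (s - k))\<^sup>2 / 2" by (simp add: w_def)
  have "(trunc k d s)\<^sup>2 = b * (b * ((w + y)\<^sup>2 / 4))" unfolding t by (simp add: power2_eq_square)
  also have "\<dots> \<le> b * (1 * ((w\<^sup>2 + w * y + y\<^sup>2) / 3))"
  proof (intro mult_left_mono mult_mono b)
    have "0 \<le> (w - y)\<^sup>2" by simp
    then show "(w + y)\<^sup>2 / 4 \<le> (w\<^sup>2 + w * y + y\<^sup>2) / 3" by (simp add: power2_eq_square algebra_simps)
  qed auto
  finally show "(trunc k d s)\<^sup>2 \<le> 2 * Trunc k d s" unfolding T by simp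
  assume "k + d < s"
  then have "y = w - d" using d by (auto simp: w_def y_def)
  then have "b = 1" using d by (simp add: b_def)
  then show "max 0 (s - k) \<le> 2 * trunc k d s" using wy unfolding t w_def[symmetric] by simp
qed

text \<open>Difference quotients in direction \<open>e\<close> have integral zero by translation
  invariance, and the mean value theorem dominates them. Only differentiability along lines parallel
  to \<open>e\<close> enters, so \<open>h\<close> may jump in other directions, as the indicator of
  a time interval does.\<close>

lemma integral_directional_derivative_zero:
  fixes h h' :: "'a::euclidean_space \<Rightarrow> real"
  assumes hm[measurable]: "h \<in> borel_measurable borel" and S: "bounded S" "\<And>z. z \<notin> S \<Longrightarrow> h z = 0"
    and D: "\<And>z s. ((\<lambda>s. h (z + s *\<^sub>R e)) has_real_derivative h' (z + s *\<^sub>R e)) (at s)"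
    and bd: "\<And>z. \<bar>h z\<bar> \<le> C" "\<And>z. \<bar>h' z\<bar> \<le> C"
  shows "(\<integral>z. h' z \<partial>lborel) = 0"
proof -
  obtain B where B: "\<And>z. z \<in> S \<Longrightarrow> norm z \<le> B" using S(1) by (auto simp: bounded_iff)
  \<comment> \<open>This ball contains the support of every translate of \<open>h\<close> by
    \<open>s *\<^sub>R e\<close> with \<open>s\<close> between 0 and 1.\<close>
  define K where "K = cball (0::'a) (B + norm e)"
  have C0: "0 \<le> C" using bd(1)[of 0] by simp
  have zero: "h (z + s *\<^sub>R e) = 0" if "z \<notin> K" "0 \<le> s" "s \<le> 1" for z s
  proof (rule S(2), rule notI)
    assume "z + s *\<^sub>R e \<in> S"
    then have "norm (z + s *\<^sub>R e) \<le> B" by (rule B)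
    moreover have "norm z \<le> norm (z + s *\<^sub>R e) + norm (s *\<^sub>R e)"
      using norm_triangle_ineq4[of "z + s *\<^sub>R e" "s *\<^sub>R e"] by simp
    moreover have "norm (s *\<^sub>R e) \<le> norm e" using that mult_left_le_one_le[of "norm e" s] by simp
    ultimately show False using that by (simp add: K_def)
  qed
  have intK: "integrable lborel (\<lambda>z. C * indicator K z)"
    unfolding K_def by (intro integrable_mult_right integrable_real_indicator) (use emeasure_bounded_finite[OF bounded_cball] in auto)
  have ih: "integrable lborel h"
  proof (rule Bochner_Integration.integrable_bound[OF intK])
    show "AE z in lborel. norm (h z) \<le> norm (C * indicator K z)"
      using bd(1) zero[of _ 0] C0 by (auto simp: indicator_def)
  qed simp
  define s where "s m = 1 / real (Suc m)" for m
  have s: "0 < s m" "s m \<le> 1" for m by (auto simp: s_def)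
  have s0: "s \<longlonglongrightarrow> 0" unfolding s_def by (rule LIMSEQ_Suc[OF lim_1_over_n])
  define q where "q m z = (h (s m *\<^sub>R e + z) - h z) / s m" for m z
  have q0: "(\<integral>z. q m z \<partial>lborel) = 0" for m
    unfolding q_def using ih lborel_integrable_translate[OF ih] lborel_integral_translate[of h "s m *\<^sub>R e"] by simp
  have lim: "(\<lambda>m. q m z) \<longlonglongrightarrow> h' z" for z
  proof -
    have "((\<lambda>y. (h (z + y *\<^sub>R e) - h z) / y) \<longlongrightarrow> h' z) (at 0)"
      using D[of z 0] by (simp add: has_field_derivative_iff)
    moreover have "filterlim s (at 0) sequentially"
      using s0 s by (auto simp: filterlim_at less_imp_neq[THEN not_sym] eventually_sequentially)
    ultimately show ?thesis unfolding q_def by (auto dest: filterlim_compose simp: add.commute)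
  qed
  have qb: "\<bar>q m z\<bar> \<le> C * indicator K z" for m z
  proof (cases "z \<in> K")
    case True
    have "\<exists>x>0. x < s m \<and> h (z + s m *\<^sub>R e) - h (z + 0 *\<^sub>R e) = (s m - 0) * h' (z + x *\<^sub>R e)"
      using s(1)[of m] D by (intro MVT2) auto
    then obtain x where "h (z + s m *\<^sub>R e) - h z = s m * h' (z + x *\<^sub>R e)" by auto
    then have "q m z = h' (z + x *\<^sub>R e)" using s(1)[of m] by (simp add: q_def add.commute)
    then show ?thesis using bd(2) True by simp
  next
    case False
    then show ?thesis using zero[OF False, of "s m"] zero[OF False, of 0] s[of m] by (simp add: q_def add.commute)
  qed
  have h'm: "h' \<in> borel_measurable lborel"
    by (rule borel_measurable_LIMSEQ_real[OF lim]) (simp add: q_def[abs_def])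
  have "(\<lambda>m. \<integral>z. q m z \<partial>lborel) \<longlonglongrightarrow> (\<integral>z. h' z \<partial>lborel)"
    by (rule integral_dominated_convergence[OF h'm _ intK]) (use lim qb in \<open>auto simp: q_def[abs_def]\<close>)
  then show ?thesis unfolding q0 by (simp add: LIMSEQ_const_iff)
qed

subsection \<open>The energy estimate for a mollified subsolution\<close>

text \<open>The parameter in Young's inequality, chosen so that
  \<open>La * g1 * e <= \<nu> / 2\<close>: the cross term then consumes at most half of the coercive
  term.\<close>

definition energy_eps :: "real \<Rightarrow> real \<Rightarrow> real \<Rightarrow> real" where
  "energy_eps \<nu> La g1 = min 1 (\<nu> / (2 * La * g1))"

text \<open>The middle summand is the remainder in Young's inequality and \<open>q\<close> comes
  from the time derivative of the cutoff; the 1 makes the constant at least one, so the energy bound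
  also controls the plain integral of \<open>G (w / \<rho>)\<close>.\<close>

definition energy_const :: "real \<Rightarrow> real \<Rightarrow> real \<Rightarrow> nat \<Rightarrow> real" where
  "energy_const \<nu> La g1 q = 1 + La * g1 * (2 * q / energy_eps \<nu> La g1) powr g1 + q"

text \<open>Twice the constant in the bound for the integral of \<open>G\<close> of the spatial
  gradient of the localised truncation; the factor 2 is the one in the superlevel estimate.\<close>

definition level_const :: "real \<Rightarrow> real \<Rightarrow> nat \<Rightarrow> real" where
  "level_const \<nu> g1 q = 2 * 2 powr g1 * (2 / \<nu> + (2 * q) powr g1)"

lemma has_derivative_slices:
  assumes "(u has_derivative (\<lambda>h. U \<bullet> fst h + ut * snd h)) (at (x, t))"
  shows "((\<lambda>s. u (x, s)) has_real_derivative ut) (at t)"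
    and "((\<lambda>y. u (y, t)) has_derivative (\<lambda>h. U \<bullet> h)) (at x)"
proof -
  have "((\<lambda>s. (x, s)) has_derivative (\<lambda>h. (0, h))) (at t)"
    by (auto intro!: derivative_eq_intros)
  from has_derivative_compose[OF this assms] show "((\<lambda>s. u (x, s)) has_real_derivative ut) (at t)"
    by (simp add: has_field_derivative_def)
  have "((\<lambda>y. (y, t)) has_derivative (\<lambda>h. (h, 0))) (at x)"
    by (auto intro!: derivative_eq_intros)
  from has_derivative_compose[OF this assms] show "((\<lambda>y. u (y, t)) has_derivative (\<lambda>h. U \<bullet> h)) (at x)"
    by simp
qed

lemma has_derivative_line:
  assumes "\<And>z. (u has_derivative u' z) (at z)"
  shows "((\<lambda>s. u (z + s *\<^sub>R e)) has_vector_derivative u' (z + s *\<^sub>R e) e) (at s)"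
proof -
  have "((\<lambda>s. z + s *\<^sub>R e) has_derivative (\<lambda>h. h *\<^sub>R e)) (at s)"
    by (auto intro!: derivative_eq_intros)
  from has_derivative_compose[OF this assms] show ?thesis
    using linear_scale[OF has_derivative_linear[OF assms]] by (simp add: has_vector_derivative_def)
qed

text \<open>
  In the application \<open>v\<close> is a mollified subsolution with spatial gradient \<open>V\<close> and time derivative
  \<open>vt\<close>, and \<open>F\<close> is the mollified flux, which differs from \<open>A (V)\<close>. Only \<open>g0\<close>, \<open>g1\<close>, \<open>\<nu>\<close>, \<open>La\<close>, \<open>q\<close>
  and the dimension may enter the constants. The cutoff is \<open>P\<close>; its exponent \<open>q \<ge> g1\<close> compensates the
  factor \<open>\<phi> powr (- g1)\<close> that Young's inequality produces from \<open>G (w / (\<rho> \<phi>))\<close>, where \<open>P = \<phi> ^ q\<close>.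
\<close>

locale energy = growth g0 g1 g for g0 g1 g +
  fixes \<nu> La \<kappa> d r \<rho> \<tau>0 t0 \<theta> :: real and q :: nat and x0 :: "real ^ 'n" and A :: "real ^ 'n \<Rightarrow> real ^ 'n"
    and v vt :: "(real ^ 'n) \<times> real \<Rightarrow> real" and V F :: "(real ^ 'n) \<times> real \<Rightarrow> real ^ 'n"
    and F' :: "(real ^ 'n) \<times> real \<Rightarrow> (real ^ 'n) \<times> real \<Rightarrow> real ^ 'n"
  assumes \<nu>: "0 < \<nu>" and La: "0 < La"
    and A_ell: "\<And>\<xi>. \<nu> * G (norm \<xi>) \<le> A \<xi> \<bullet> \<xi>" and A_bd: "\<And>\<xi>. norm (A \<xi>) \<le> La * g (norm \<xi>)"
    and A_cont: "continuous_on UNIV A"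
    and v_deriv: "\<And>z. (v has_derivative (\<lambda>h. V z \<bullet> fst h + vt z * snd h)) (at z)"
    and V_cont: "continuous_on UNIV V" and vt_cont: "continuous_on UNIV vt"
    and F_deriv: "\<And>z. (F has_derivative F' z) (at z)" and F'_cont: "\<And>h. continuous_on UNIV (\<lambda>z. F' z h)"
    and sub: "\<And>x t. norm (x - x0) \<le> r \<Longrightarrow> \<tau>0 \<le> t \<Longrightarrow> t \<le> t0 \<Longrightarrow>
      vt (x, t) \<le> (\<Sum>i\<in>UNIV. F' (x, t) (axis i 1, 0) $ i)"
    and d: "0 < d" and r: "0 < r" "r \<le> \<rho>" and \<theta>: "0 < \<theta>" and \<tau>: "\<tau>0 < t0" "t0 - \<tau>0 \<le> \<theta>"
    and q: "2 \<le> q" "g1 \<le> q"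
begin

text \<open>\<open>P\<close> equals \<open>(X Y)^q\<close>, with \<open>X\<close> a truncated
  paraboloid and \<open>Y\<close> a truncated ramp, so powers with \<open>q >= 2\<close> are
  continuously differentiable. Normalising by \<open>\<rho>^2\<close> and \<open>\<theta>\<close>,
  not by the smaller cylinder, gives derivative bounds in \<open>\<rho>\<close> and
  \<open>\<theta>\<close> only. \<open>PX\<close> and \<open>PT\<close> are the spatial gradient and
  time derivative of \<open>P\<close>.\<close>

definition X :: "real ^ 'n \<Rightarrow> real" where "X x = max 0 ((r\<^sup>2 - (x - x0) \<bullet> (x - x0)) / \<rho>\<^sup>2)"
definition Y :: "real \<Rightarrow> real" where "Y t = max 0 ((t - \<tau>0) / \<theta>)"
definition P :: "(real ^ 'n) \<times> real \<Rightarrow> real" where "P z = X (fst z) ^ q * Y (snd z) ^ q"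
definition PX :: "(real ^ 'n) \<times> real \<Rightarrow> real ^ 'n" where
  "PX z = (- (2 * q / \<rho>\<^sup>2) * X (fst z) ^ (q - 1) * Y (snd z) ^ q) *\<^sub>R (fst z - x0)"
definition PT :: "(real ^ 'n) \<times> real \<Rightarrow> real" where "PT z = X (fst z) ^ q * (q / \<theta> * Y (snd z) ^ (q - 1))"
definition cyl :: "real \<Rightarrow> ((real ^ 'n) \<times> real) set" where "cyl t = cball x0 r \<times> {\<tau>0..t}"
definition w :: "(real ^ 'n) \<times> real \<Rightarrow> real" where "w z = max 0 (v z - \<kappa>)"
definition \<beta> :: "(real ^ 'n) \<times> real \<Rightarrow> real" where "\<beta> z = trunc \<kappa> d (v z)"
definition \<beta>' :: "(real ^ 'n) \<times> real \<Rightarrow> real" where "\<beta>' z = trunc' \<kappa> d (v z)"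
definition \<B> :: "(real ^ 'n) \<times> real \<Rightarrow> real" where "\<B> z = Trunc \<kappa> d (v z)"
definition f :: "(real ^ 'n) \<times> real \<Rightarrow> real" where "f z = \<beta> z * P z"
definition fX :: "(real ^ 'n) \<times> real \<Rightarrow> real ^ 'n" where "fX z = (\<beta>' z * P z) *\<^sub>R V z + \<beta> z *\<^sub>R PX z"
text \<open>The time derivative of \<open>\<B> * P\<close>, because \<open>\<beta>\<close> is the
  derivative of \<open>Trunc\<close> at \<open>v\<close>.\<close>

definition Wt :: "(real ^ 'n) \<times> real \<Rightarrow> real" where "Wt z = \<beta> z * vt z * P z + \<B> z * PT z"
definition Fdiv :: "(real ^ 'n) \<times> real \<Rightarrow> real" where "Fdiv z = (\<Sum>i\<in>UNIV. F' z (axis i 1, 0) $ i)"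
text \<open>A pointwise bound for what the flux discrepancy contributes when tested with
  \<open>f\<close>: on the cylinder, \<open>norm (fX z)\<close> is at most the second
  factor.\<close>

definition \<epsilon> :: "(real ^ 'n) \<times> real \<Rightarrow> real" where "\<epsilon> z = norm (F z - A (V z)) * (norm (V z) + 2 * q / \<rho> * w z)"
definition \<Psi>w :: "(real ^ 'n) \<times> real \<Rightarrow> real" where "\<Psi>w z = G (w z / \<rho>) + (w z)\<^sup>2 / \<theta>"
definition I :: "real \<Rightarrow> ((real ^ 'n) \<times> real \<Rightarrow> real) \<Rightarrow> real" where
  "I t h = (\<integral>z. indicator (cyl t) z *\<^sub>R h z \<partial>lborel)"

section \<open>Regularity and pointwise bounds for cutoff and truncation\<close>

lemma \<rho>: "0 < \<rho>" using r by simp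

lemma v_cont: "continuous_on S v"
  using v_deriv by (meson has_derivative_continuous continuous_at_imp_continuous_on)

lemma F_cont: "continuous_on S F"
  using F_deriv by (meson has_derivative_continuous continuous_at_imp_continuous_on)

lemma conts:
  "continuous_on S X" "continuous_on S' Y" "continuous_on S'' P" "continuous_on S'' PX" "continuous_on S'' PT"
  "continuous_on S'' w" "continuous_on S'' \<beta>" "continuous_on S'' \<beta>'" "continuous_on S'' \<B>"
proof -
  show X: "continuous_on S X" for S unfolding X_def using \<rho> by (intro continuous_intros) auto
  show Y: "continuous_on S Y" for S unfolding Y_def using \<theta> by (intro continuous_intros) auto
  have X': "continuous_on S'' (\<lambda>z. X (fst z))" and Y': "continuous_on S'' (\<lambda>z. Y (snd z))"
    by (auto intro!: continuous_on_compose2[OF X[of UNIV]] continuous_on_compose2[OF Y[of UNIV]] continuous_intros)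
  show "continuous_on S'' P" "continuous_on S'' PX" "continuous_on S'' PT"
    unfolding P_def PX_def PT_def by (intro continuous_intros X' Y')+
  show "continuous_on S'' w" unfolding w_def by (intro continuous_intros v_cont)
  show "continuous_on S'' \<beta>" "continuous_on S'' \<beta>'" "continuous_on S'' \<B>"
    unfolding \<beta>_def \<beta>'_def \<B>_def
    by (auto intro!: continuous_on_compose2[OF trunc_cont(1)[OF d, of UNIV]] continuous_on_compose2[OF trunc_cont(2)[OF d, of UNIV]]
       continuous_on_compose2[OF trunc_cont(3)[OF d, of UNIV]] v_cont)
qed

lemma conts2: "continuous_on S f" "continuous_on S fX" "continuous_on S Wt" "continuous_on S Fdiv" "continuous_on S \<epsilon>" "continuous_on S \<Psi>w"
proof -
  note [continuous_intros] = conts v_cont F_cont continuous_on_subset[OF V_cont subset_UNIV] continuous_on_subset[OF vt_cont subset_UNIV]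
    continuous_on_subset[OF F'_cont subset_UNIV]
  show "continuous_on S f" "continuous_on S fX" "continuous_on S Wt" "continuous_on S Fdiv"
    unfolding f_def[abs_def] fX_def[abs_def] Wt_def[abs_def] Fdiv_def[abs_def] by (intro continuous_intros)+
  show "continuous_on S \<epsilon>" unfolding \<epsilon>_def
    by (intro continuous_intros continuous_on_compose2[OF A_cont]) auto
  show "continuous_on S \<Psi>w" unfolding \<Psi>w_def using \<rho> \<theta>
    by (intro continuous_intros continuous_on_compose2[OF G_cont[of UNIV]]) auto
qed

lemma cyl_compact: "compact (cyl t)"
  unfolding cyl_def by (intro compact_Times compact_cball compact_Icc)

lemma I_int: "continuous_on UNIV h \<Longrightarrow> integrable lborel (\<lambda>z. indicator (cyl t) z *\<^sub>R (h z :: real))"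
  by (rule borel_integrable_compact[OF cyl_compact]) (rule continuous_on_subset[OF _ subset_UNIV])

lemma I_mono:
  assumes "continuous_on UNIV h1" "continuous_on UNIV h2" "\<And>z. z \<in> cyl t \<Longrightarrow> h1 z \<le> h2 z"
  shows "I t h1 \<le> I t h2"
  unfolding I_def using assms by (intro integral_mono I_int) (auto simp: indicator_def)

lemma I_mono_time:
  assumes "continuous_on UNIV h" "\<And>z. z \<in> cyl t' \<Longrightarrow> 0 \<le> h z" "t \<le> t'"
  shows "I t h \<le> I t' h"
  unfolding I_def using assms by (intro integral_mono I_int) (auto simp: indicator_def cyl_def)

lemma I_add: "continuous_on UNIV h1 \<Longrightarrow> continuous_on UNIV h2 \<Longrightarrow> I t (\<lambda>z. h1 z + h2 z) = I t h1 + I t h2"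
  unfolding I_def scaleR_add_right by (rule Bochner_Integration.integral_add[OF I_int I_int])

lemma I_cmult: "I t (\<lambda>z. c * h z) = c * I t h"
  unfolding I_def by (simp add: mult.left_commute)

lemma I_nonneg: "(\<And>z. z \<in> cyl t \<Longrightarrow> 0 \<le> h z) \<Longrightarrow> 0 \<le> I t h"
  unfolding I_def by (intro Bochner_Integration.integral_nonneg) (auto simp: indicator_def)

lemma q_eq: "\<exists>m. q = Suc (Suc m)"
  using q(1) by (metis add_2_eq_Suc le_Suc_ex)

lemma pos_part_q_deriv: "((\<lambda>s::real. max 0 s ^ q) has_real_derivative real q * max 0 s ^ (q - 1)) (at s)"
  using q_eq pos_part_power_deriv by auto

lemma P_deriv: "(P has_derivative (\<lambda>h. PX z \<bullet> fst h + PT z * snd h)) (at z)"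
proof -
  have 1: "((\<lambda>z. (r\<^sup>2 - (fst z - x0) \<bullet> (fst z - x0)) / \<rho>\<^sup>2) has_derivative (\<lambda>h. - (2 / \<rho>\<^sup>2) * ((fst z - x0) \<bullet> fst h))) (at z)"
  proof -
    have "((\<lambda>z. r\<^sup>2 - (fst z - x0) \<bullet> (fst z - x0)) has_derivative (\<lambda>h. - 2 * ((fst z - x0) \<bullet> fst h))) (at z)"
      by (auto intro!: derivative_eq_intros simp: inner_commute fun_eq_iff)
    from bounded_linear.has_derivative[OF bounded_linear_divide this, of "\<rho>\<^sup>2"] show ?thesis by simp
  qed
  have 2: "((\<lambda>z. (snd z - \<tau>0) / \<theta>) has_derivative (\<lambda>h. snd h / \<theta>)) (at z)"
    using \<theta> by (auto intro!: derivative_eq_intros)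
  note X1 = has_derivative_compose[OF 1 pos_part_q_deriv[unfolded has_field_derivative_def], folded X_def]
  note Y1 = has_derivative_compose[OF 2 pos_part_q_deriv[unfolded has_field_derivative_def], folded Y_def]
  have "P = (\<lambda>z. X (fst z) ^ q * Y (snd z) ^ q)" by (auto simp: P_def)
  then show ?thesis
    by (simp only:) (rule has_derivative_eq_rhs[OF has_derivative_mult[OF X1 Y1]],
      auto simp: fun_eq_iff PX_def PT_def algebra_simps)
qed

lemma \<beta>_deriv: "(\<beta> has_derivative (\<lambda>h. \<beta>' z * (V z \<bullet> fst h + vt z * snd h))) (at z)"
  using has_derivative_compose[OF v_deriv trunc_deriv(1)[OF d, unfolded has_field_derivative_def]]
  unfolding \<beta>_def[abs_def] \<beta>'_def .

lemma \<B>_deriv: "(\<B> has_derivative (\<lambda>h. \<beta> z * (V z \<bullet> fst h + vt z * snd h))) (at z)"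
  using has_derivative_compose[OF v_deriv trunc_deriv(2)[OF d, unfolded has_field_derivative_def]]
  unfolding \<B>_def[abs_def] \<beta>_def .

lemma f_deriv: "(f has_derivative (\<lambda>h. fX z \<bullet> fst h + (\<beta>' z * vt z * P z + \<beta> z * PT z) * snd h)) (at z)"
  unfolding f_def[abs_def]
  by (rule has_derivative_eq_rhs[OF has_derivative_mult[OF \<beta>_deriv P_deriv]])
    (auto simp: fun_eq_iff fX_def inner_add_left algebra_simps)

lemma \<B>P_deriv: "((\<lambda>z. \<B> z * P z) has_derivative (\<lambda>h. ((\<beta> z * P z) *\<^sub>R V z + \<B> z *\<^sub>R PX z) \<bullet> fst h + Wt z * snd h)) (at z)"
  by (rule has_derivative_eq_rhs[OF has_derivative_mult[OF \<B>_deriv P_deriv]])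
    (auto simp: fun_eq_iff Wt_def inner_add_left algebra_simps)

lemma X_outside: "x \<notin> cball x0 r \<Longrightarrow> X x = 0"
proof -
  assume "x \<notin> cball x0 r"
  then have "r \<le> norm (x - x0)" by (simp add: dist_norm norm_minus_commute)
  then have "r\<^sup>2 \<le> (norm (x - x0))\<^sup>2" using r by (intro power_mono) auto
  then have "(r\<^sup>2 - (x - x0) \<bullet> (x - x0)) / \<rho>\<^sup>2 \<le> 0"
    using \<rho> by (intro divide_nonpos_pos) (auto simp: power2_norm_eq_inner)
  then show ?thesis by (simp add: X_def)
qed

lemma q0: "q \<noteq> 0" "q - 1 \<noteq> 0" using q(1) by auto

lemma outside:
  assumes "fst z \<notin> cball x0 r"
  shows "P z = 0" "PX z = 0" "PT z = 0" "f z = 0" "fX z = 0"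
  using X_outside[OF assms] q0 by (auto simp: P_def PX_def PT_def f_def fX_def power_0_left)

lemma X_bounds: "0 \<le> X x" "X x \<le> 1"
proof -
  have "r\<^sup>2 \<le> \<rho>\<^sup>2" using r by (intro power_mono) auto
  then have "r\<^sup>2 - (x - x0) \<bullet> (x - x0) \<le> \<rho>\<^sup>2" using inner_ge_zero[of "x - x0"] by linarith
  then show "X x \<le> 1" using \<rho> by (simp add: X_def)
qed (simp add: X_def)

lemma Y_bounds: "0 \<le> Y t" "t \<le> t0 \<Longrightarrow> Y t \<le> 1"
  using \<tau> \<theta> by (auto simp: Y_def)

lemma P_bounds: "0 \<le> P z" "snd z \<le> t0 \<Longrightarrow> P z \<le> 1"
  using X_bounds Y_bounds by (auto simp: P_def intro!: mult_le_one power_le_one)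

text \<open>One factor \<open>\<rho>\<close> is absorbed by \<open>norm (x - x0)\<close>, and only
  one power of \<open>X Y\<close> is lost. Keeping the remaining \<open>q - 1\<close> powers is
  essential for the absorption of the cross term.\<close>

lemma PX_bound:
  assumes "z \<in> cyl t0"
  shows "norm (PX z) \<le> 2 * q / \<rho> * (X (fst z) * Y (snd z)) ^ (q - 1)"
proof -
  have z: "norm (fst z - x0) \<le> \<rho>" "snd z \<le> t0"
    using assms r by (auto simp: cyl_def dist_norm norm_minus_commute)
  have "Y (snd z) ^ q \<le> Y (snd z) ^ (q - 1)"
    using Y_bounds z by (intro power_decreasing) auto
  moreover have "norm (PX z) = (2 * q / \<rho>\<^sup>2 * X (fst z) ^ (q - 1) * Y (snd z) ^ q) * norm (fst z - x0)"
    unfolding PX_def using X_bounds Y_bounds by (simp add: abs_mult)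
  ultimately have "norm (PX z) \<le> (2 * q / \<rho>\<^sup>2 * X (fst z) ^ (q - 1) * Y (snd z) ^ (q - 1)) * \<rho>"
    using X_bounds Y_bounds z by (simp only:) (intro mult_mono, auto)
  also have "\<dots> = 2 * q / \<rho> * (X (fst z) * Y (snd z)) ^ (q - 1)"
    using \<rho> by (simp add: power_mult_distrib power2_eq_square)
  finally show ?thesis .
qed

lemma PT_bound:
  assumes "z \<in> cyl t0"
  shows "0 \<le> PT z" "PT z \<le> q / \<theta>"
proof -
  have "PT z \<le> 1 * (q / \<theta> * 1)"
    unfolding PT_def using X_bounds Y_bounds assms \<theta>
    by (intro mult_mono power_le_one) (auto simp: cyl_def)
  then show "PT z \<le> q / \<theta>" by simp
  show "0 \<le> PT z" using X_bounds Y_bounds \<theta> by (simp add: PT_def)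
qed

lemma w_nonneg: "0 \<le> w z" by (simp add: w_def)

lemma t_bounds:
  shows "0 \<le> \<beta>' z" "\<beta>' z \<le> 1" "0 \<le> \<beta> z" "\<beta> z \<le> \<beta>' z * w z" "\<beta> z \<le> w z" "0 \<le> \<B> z" "\<B> z \<le> (w z)\<^sup>2 / 2" "(\<beta> z)\<^sup>2 \<le> 2 * \<B> z"
  unfolding \<beta>'_def \<beta>_def \<B>_def w_def using trunc_bounds(1-8)[OF d] by auto

lemma fX_bound:
  assumes "z \<in> cyl t0"
  shows "norm (fX z) \<le> \<beta>' z * P z * norm (V z) + 2 * q / \<rho> * w z"
proof -
  have "(X (fst z) * Y (snd z)) ^ (q - 1) \<le> 1"
    using X_bounds Y_bounds assms by (intro power_le_one mult_le_one) (auto simp: cyl_def)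
  then have "norm (PX z) \<le> 2 * q / \<rho> * 1"
    using PX_bound[OF assms] \<rho> by (meson mult_left_mono order_trans divide_nonneg_pos of_nat_0_le_iff mult_nonneg_nonneg zero_le_numeral)
  then have "\<beta> z * norm (PX z) \<le> w z * (2 * q / \<rho>)"
    using t_bounds w_nonneg by (intro mult_mono) auto
  moreover have "norm (fX z) \<le> \<beta>' z * P z * norm (V z) + \<beta> z * norm (PX z)"
    unfolding fX_def using norm_triangle_ineq[of "(\<beta>' z * P z) *\<^sub>R V z" "\<beta> z *\<^sub>R PX z"] t_bounds(1,3)[of z] P_bounds(1)[of z]
    by (simp add: abs_mult)
  ultimately show ?thesis by (simp add: mult.commute)
qed

text \<open>The fundamental theorem of calculus on each vertical line, followed by Fubini. No
  initial term appears because the cutoff vanishes at \<open>\<tau>0\<close>.\<close>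

lemma time_integral_\<B>P:
  assumes "\<tau>0 \<le> t"
  shows "(\<integral>x. \<B> (x, t) * P (x, t) \<partial>lborel) = I t Wt"
proof -
  have "(\<integral>s. indicator (cyl t) (x, s) *\<^sub>R Wt (x, s) \<partial>lborel) = \<B> (x, t) * P (x, t)" for x
  proof (cases "x \<in> cball x0 r")
    case True
    have "(\<integral>s. indicator (cyl t) (x, s) *\<^sub>R Wt (x, s) \<partial>lborel) = (\<integral>s. indicator {\<tau>0..t} s *\<^sub>R Wt (x, s) \<partial>lborel)"
      using True by (intro Bochner_Integration.integral_cong) (auto simp: indicator_def cyl_def)
    also have "\<dots> = \<B> (x, t) * P (x, t) - \<B> (x, \<tau>0) * P (x, \<tau>0)"
    proof (rule integral_FTC_Icc[OF assms])
      show "((\<lambda>s. \<B> (x, s) * P (x, s)) has_vector_derivative Wt (x, s)) (at s within {\<tau>0..t})" for s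
        using has_derivative_slices(1)[OF \<B>P_deriv, of x s]
        by (simp add: has_real_derivative_iff_has_vector_derivative has_vector_derivative_at_within)
      show "continuous_on {\<tau>0..t} (\<lambda>s. Wt (x, s))"
        by (rule continuous_on_compose2[OF conts2(3)[of UNIV]]) (auto intro!: continuous_intros)
    qed
    also have "P (x, \<tau>0) = 0" using q0 by (simp add: P_def Y_def)
    finally show ?thesis by simp
  next
    case False
    then show ?thesis using outside(1)[of "(x, t)"] by (simp add: cyl_def)
  qed
  then have "(\<integral>x. \<B> (x, t) * P (x, t) \<partial>lborel) = (\<integral>x. (\<integral>s. indicator (cyl t) (x, s) *\<^sub>R Wt (x, s) \<partial>lborel) \<partial>lborel)"
    by simp
  also have "\<dots> = I t Wt"
    using lborel_pair.integral_fst'[of "\<lambda>z. indicator (cyl t) z *\<^sub>R Wt z"] I_int[OF conts2(3), of t]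
    unfolding I_def lborel_prod by simp
  finally show ?thesis .
qed

text \<open>For each coordinate, the product of that component of \<open>F\<close> with
  \<open>f\<close> is differentiated in that spatial direction. \<open>f\<close> vanishes outside
  the ball, and the restriction to a time interval is a jump transversal to the direction of
  differentiation.\<close>

lemma integration_by_parts: "I t (\<lambda>z. Fdiv z * f z + F z \<bullet> fX z) = 0"
proof -
  define h where "h i z = indicator {\<tau>0..t} (snd z) * (F z $ i * f z)" for i :: 'n and z :: "(real ^ 'n) \<times> real"
  define h' where "h' i z = F' z (axis i 1, 0) $ i * f z + F z $ i * fX z $ i" for i :: 'n and z :: "(real ^ 'n) \<times> real"
  have h'c: "continuous_on UNIV (h' i)" for i
    unfolding h'_def by (intro continuous_intros F'_cont F_cont conts2)
  have hc: "continuous_on UNIV (\<lambda>z. F z $ i * f z)" for i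
    by (intro continuous_intros F_cont conts2)
  have h'0: "h' i z = 0" if "fst z \<notin> cball x0 r" for i z
    using outside[OF that] by (simp add: h'_def)
  have zero: "I t (h' i) = 0" for i
  proof -
    let ?e = "(axis i 1, 0) :: (real ^ 'n) \<times> real"
    have bd: "\<exists>C. \<forall>z\<in>cyl t. \<bar>\<phi> z\<bar> \<le> C" if "continuous_on UNIV \<phi>" for \<phi> :: "_ \<Rightarrow> real"
    proof -
      have "compact (\<phi> ` cyl t)"
        by (rule compact_continuous_image[OF continuous_on_subset[OF that subset_UNIV] cyl_compact])
      then show ?thesis by (auto dest!: compact_imp_bounded simp: bounded_real)
    qed
    obtain C1 where C1: "\<And>z. z \<in> cyl t \<Longrightarrow> \<bar>F z $ i * f z\<bar> \<le> C1" using bd[OF hc] by blast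
    obtain C2 where C2: "\<And>z. z \<in> cyl t \<Longrightarrow> \<bar>h' i z\<bar> \<le> C2" using bd[OF h'c] by blast
    define C where "C = max 0 (max C1 C2)"
    have eqi: "indicator (cyl t) z *\<^sub>R h' i z = indicator {\<tau>0..t} (snd z) * h' i z" for z
      using h'0[of z] by (cases z) (auto simp: cyl_def indicator_def)
    have "(\<integral>z. indicator {\<tau>0..t} (snd z) * h' i z \<partial>lborel) = 0"
    proof (rule integral_directional_derivative_zero[where h = "h i" and S = "cyl t" and e = ?e and C = C])
      have "F \<in> borel_measurable borel" "f \<in> borel_measurable borel"
        using F_cont conts2 by (auto intro: borel_measurable_continuous_onI)
      moreover have "(\<lambda>z. F z $ i * f z) \<in> borel_measurable borel"
        using hc by (rule borel_measurable_continuous_onI)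
      moreover have "(\<lambda>z::(real ^ 'n) \<times> real. indicator {\<tau>0..t} (snd z) :: real) \<in> borel_measurable borel"
        unfolding borel_prod[symmetric] by measurable
      ultimately show "h i \<in> borel_measurable borel" unfolding h_def by simp
      show "bounded (cyl t)" by (rule compact_imp_bounded[OF cyl_compact])
      have h0: "h i z = 0" if "z \<notin> cyl t" for z
        using that outside(4)[of z] by (cases z) (auto simp: h_def cyl_def indicator_def)
      then show "h i z = 0" if "z \<notin> cyl t" for z using that .
      have "0 \<le> C" "C1 \<le> C" "C2 \<le> C" by (auto simp: C_def)
      then show "\<bar>h i z\<bar> \<le> C" for z
        using C1[of z] h0[of z] by (cases "z \<in> cyl t") (auto simp: h_def indicator_def)
      have "indicator {\<tau>0..t} (snd z) * h' i z = 0" if "z \<notin> cyl t" for z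
        using that h'0[of z] by (cases z) (auto simp: cyl_def indicator_def)
      then show "\<bar>indicator {\<tau>0..t} (snd z) * h' i z\<bar> \<le> C" for z
        using C2[of z] \<open>0 \<le> C\<close> \<open>C2 \<le> C\<close> by (cases "z \<in> cyl t") (auto simp: indicator_def)
      show "((\<lambda>s. h i (z + s *\<^sub>R ?e)) has_real_derivative
          indicator {\<tau>0..t} (snd (z + s *\<^sub>R ?e)) * h' i (z + s *\<^sub>R ?e)) (at s)" for z s
      proof -
        have 1: "((\<lambda>s. F (z + s *\<^sub>R ?e) $ i) has_real_derivative F' (z + s *\<^sub>R ?e) ?e $ i) (at s)"
          unfolding has_real_derivative_iff_has_vector_derivative
          by (rule bounded_linear.has_vector_derivative[OF bounded_linear_vec_nth has_derivative_line[OF F_deriv]])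
        have 2: "((\<lambda>s. f (z + s *\<^sub>R ?e)) has_real_derivative fX (z + s *\<^sub>R ?e) $ i) (at s)"
          using has_derivative_line[OF f_deriv, of z ?e s]
          by (simp add: has_real_derivative_iff_has_vector_derivative inner_axis)
        have "((\<lambda>s. F (z + s *\<^sub>R ?e) $ i * f (z + s *\<^sub>R ?e)) has_real_derivative h' i (z + s *\<^sub>R ?e)) (at s)"
          unfolding h'_def using DERIV_mult[OF 1 2] by (simp add: algebra_simps)
        from DERIV_cmult[OF this, of "indicator {\<tau>0..t} (snd z)"] show ?thesis
          unfolding h_def by simp
      qed
    qed
    then show ?thesis unfolding I_def eqi .
  qed
  have "I t (\<lambda>z. Fdiv z * f z + F z \<bullet> fX z) = I t (\<lambda>z. \<Sum>i\<in>UNIV. h' i z)"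
    by (intro arg_cong[where f = "I t"] ext)
      (simp add: Fdiv_def h'_def inner_vec_def sum.distrib sum_distrib_right)
  also have "\<dots> = (\<Sum>i\<in>UNIV. I t (h' i))"
    unfolding I_def scaleR_sum_right by (intro Bochner_Integration.integral_sum I_int h'c)
  also have "\<dots> = 0" by (simp add: zero)
  finally show ?thesis .
qed

section \<open>The energy inequality\<close>

lemma g1_pos: "0 < g1" using g0_gt g0_le by simp

text \<open>Splitting \<open>F\<close> into \<open>A (V)\<close> and a discrepancy, the first part
  is coercive against \<open>V\<close> and produces a cross term with the gradient of the cutoff;
  half of the coercive term absorbs it. The discrepancy is collected in
  \<open>\<epsilon>\<close>.\<close>

lemma flux_bound:
  assumes z: "z \<in> cyl t0"
  shows "- (F z \<bullet> fX z) + \<B> z * PT z \<le>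
    - (\<nu> / 2) * (\<beta>' z * P z * G (norm (V z))) + energy_const \<nu> La g1 q * \<Psi>w z + \<epsilon> z"
proof -
  define e where "e = energy_eps \<nu> La g1"
  define a where "a = norm (V z)"
  define p where "p = X (fst z) * Y (snd z)"
  define K where "K = (2 * q / e) powr g1"
  have e: "0 < e" "e \<le> 1" "La * g1 * e \<le> \<nu> / 2"
  proof -
    show "0 < e" "e \<le> 1" using \<nu> La g1_pos by (auto simp: e_def energy_eps_def)
    have "La * g1 * e \<le> La * g1 * (\<nu> / (2 * La * g1))"
      using La g1_pos by (intro mult_left_mono) (auto simp: e_def energy_eps_def)
    then show "La * g1 * e \<le> \<nu> / 2" using La g1_pos by simp
  qed
  have K0: "0 \<le> K" by (simp add: K_def)
  have p: "0 \<le> p" "p \<le> 1" "P z = p ^ q" "p ^ q = p * p ^ (q - 1)"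
    using X_bounds Y_bounds z q0 power_Suc[of p "q - 1"]
    by (auto simp: p_def P_def power_mult_distrib cyl_def intro!: mult_le_one)
  have a0: "0 \<le> a" "0 \<le> g a" using g_nonneg by (auto simp: a_def)
  note tb = t_bounds[of z]
  have Pz: "0 \<le> P z" "P z \<le> 1" using P_bounds[of z] z by (auto simp: cyl_def)
  \<comment> \<open>Young's inequality with \<open>b = 2 q w / (\<rho> p)\<close>, where
    \<open>P = p * p^(q - 1)\<close>. The bound \<open>\<beta> <= \<beta>' * w\<close> supplies the
    factor \<open>\<beta>'\<close> carried by the coercive term, and \<open>p^q\<close> outweighs
    the \<open>p powr (- g1)\<close> coming out of \<open>G (b / e)\<close> since
    \<open>q >= g1\<close>.\<close>
  have T: "\<beta> z * (La * g a * (2 * q / \<rho> * p ^ (q - 1))) \<le> La * g1 * e * (\<beta>' z * P z * G a) + La * g1 * K * G (w z / \<rho>)"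
  proof (cases "p = 0")
    case True
    then show ?thesis using q0 La g1_pos e tb Pz K0 by (simp add: power_0_left)
  next
    case False
    then have p0: "0 < p" using p by simp
    define b where "b = 2 * q * w z / (\<rho> * p)"
    have b0: "0 \<le> b" using w_nonneg \<rho> p0 by (simp add: b_def)
    have "\<beta> z * (La * g a * (2 * q / \<rho> * p ^ (q - 1))) \<le> (\<beta>' z * w z) * (La * g a * (2 * q / \<rho> * p ^ (q - 1)))"
      using tb a0 La \<rho> p by (intro mult_right_mono) auto
    also have "\<dots> = La * \<beta>' z * P z * (g a * b)"
      unfolding p(3,4) b_def using p0 \<rho> by simp
    also have "\<dots> \<le> La * \<beta>' z * P z * (g1 * (e * G a + G (b / e)))"
      using tb Pz La by (intro mult_left_mono g_young a0 b0 e) auto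
    also have "\<dots> = La * g1 * e * (\<beta>' z * P z * G a) + La * g1 * (\<beta>' z * (P z * G (b / e)))"
      by (simp add: algebra_simps)
    also have "\<beta>' z * (P z * G (b / e)) \<le> 1 * (K * G (w z / \<rho>))"
    proof (rule mult_mono)
      have 1: "1 \<le> 2 * q / e / p"
      proof -
        have "e * p \<le> 1 * 1" using e p by (intro mult_mono) auto
        also have "\<dots> \<le> 2 * q" using q by simp
        finally show ?thesis using e p0 by (simp add: field_simps)
      qed
      have "G (b / e) = G ((2 * q / e / p) * (w z / \<rho>))" by (simp add: b_def field_simps)
      also have "\<dots> \<le> (2 * q / e / p) powr g1 * G (w z / \<rho>)" by (rule G_scale_le[OF 1])
      also have "(2 * q / e / p) powr g1 = K * p powr (- g1)"
        using e p0 q by (simp add: K_def powr_divide powr_minus powr_mult field_simps)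
      finally have "P z * G (b / e) \<le> P z * (K * p powr (- g1) * G (w z / \<rho>))"
        using Pz by (intro mult_left_mono) auto
      also have "\<dots> = (p powr q * p powr (- g1)) * (K * G (w z / \<rho>))"
        using p0 by (simp add: p(3) powr_realpow)
      also have "p powr q * p powr (- g1) = p powr (q - g1)" using powr_add[of p q "- g1"] by simp
      also have "p powr (q - g1) * (K * G (w z / \<rho>)) \<le> 1 * (K * G (w z / \<rho>))"
        using p p0 q K0 by (intro mult_right_mono powr_le1) auto
      finally show "P z * G (b / e) \<le> K * G (w z / \<rho>)" by simp
    qed (use tb Pz in auto)
    finally show ?thesis using La g1_pos by (simp add: mult.assoc)
  qed
  have AV: "- (A (V z) \<bullet> fX z) \<le> - \<nu> * (\<beta>' z * P z * G a) + \<beta> z * (La * g a * (2 * q / \<rho> * p ^ (q - 1)))"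
  proof -
    have "- (A (V z) \<bullet> PX z) \<le> norm (A (V z)) * norm (PX z)"
      using norm_cauchy_schwarz[of "- A (V z)" "PX z"] by simp
    also have "\<dots> \<le> La * g a * (2 * q / \<rho> * p ^ (q - 1))"
      using A_bd[of "V z"] PX_bound[OF z] La a0 by (intro mult_mono) (auto simp: a_def p_def)
    finally have "\<beta> z * - (A (V z) \<bullet> PX z) \<le> \<beta> z * (La * g a * (2 * q / \<rho> * p ^ (q - 1)))"
      using tb by (intro mult_left_mono) auto
    moreover have "(\<beta>' z * P z) * (\<nu> * G a) \<le> (\<beta>' z * P z) * (A (V z) \<bullet> V z)"
      using A_ell[of "V z"] tb Pz by (intro mult_left_mono) (auto simp: a_def)
    ultimately show ?thesis unfolding fX_def by (simp add: inner_add_right algebra_simps)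
  qed
  have R: "- ((F z - A (V z)) \<bullet> fX z) \<le> norm (F z - A (V z)) * (norm (V z) + 2 * q / \<rho> * w z)"
  proof -
    have "\<beta>' z * P z * norm (V z) \<le> 1 * 1 * norm (V z)" using tb Pz by (intro mult_mono) auto
    then have "norm (fX z) \<le> norm (V z) + 2 * q / \<rho> * w z" using fX_bound[OF z] by simp
    moreover have "- ((F z - A (V z)) \<bullet> fX z) \<le> norm (F z - A (V z)) * norm (fX z)"
      using norm_cauchy_schwarz[of "- (F z - A (V z))" "fX z"] by (simp only: inner_minus_left norm_minus_cancel)
    ultimately show ?thesis by (meson mult_left_mono norm_ge_zero order_trans)
  qed
  have B: "\<B> z * PT z \<le> q * ((w z)\<^sup>2 / \<theta>)"
  proof -
    have "\<B> z * PT z \<le> (w z)\<^sup>2 / 2 * (q / \<theta>)" using tb PT_bound[OF z] by (intro mult_mono) auto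
    also have "\<dots> \<le> q * ((w z)\<^sup>2 / \<theta>)" using \<theta> by (simp add: field_simps)
    finally show ?thesis .
  qed
  have G1: "La * g1 * e * (\<beta>' z * P z * G a) \<le> \<nu> / 2 * (\<beta>' z * P z * G a)"
    using e tb Pz by (intro mult_right_mono) auto
  have "energy_const \<nu> La g1 q * \<Psi>w z = (1 + La * g1 * K + q) * (G (w z / \<rho>) + (w z)\<^sup>2 / \<theta>)"
    by (simp add: energy_const_def K_def e_def \<Psi>w_def)
  moreover have "La * g1 * K * G (w z / \<rho>) + q * ((w z)\<^sup>2 / \<theta>) \<le> (1 + La * g1 * K + q) * (G (w z / \<rho>) + (w z)\<^sup>2 / \<theta>)"
  proof -
    have n: "0 \<le> La * g1 * K" "0 \<le> (w z)\<^sup>2 / \<theta>" using La g1_pos K0 \<theta> by auto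
    have "a * G1 + b * W \<le> (1 + a + b) * (G1 + W)" if "0 \<le> a" "0 \<le> b" "0 \<le> G1" "0 \<le> W" for a b G1 W :: real
      using that by (simp add: algebra_simps)
    from this[OF n(1) _ _ n(2)] show ?thesis by simp
  qed
  ultimately have C: "La * g1 * K * G (w z / \<rho>) + q * ((w z)\<^sup>2 / \<theta>) \<le> energy_const \<nu> La g1 q * \<Psi>w z" by simp
  have "- (F z \<bullet> fX z) = - (A (V z) \<bullet> fX z) + - ((F z - A (V z)) \<bullet> fX z)" by (simp add: inner_diff_left)
  then have "- (F z \<bullet> fX z) + \<B> z * PT z \<le> - \<nu> * (\<beta>' z * P z * G a) + \<nu> / 2 * (\<beta>' z * P z * G a) + energy_const \<nu> La g1 q * \<Psi>w z
      + norm (F z - A (V z)) * (norm (V z) + 2 * q / \<rho> * w z)"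
    using AV T R B G1 C by linarith
  then show ?thesis unfolding a_def \<epsilon>_def by (simp add: algebra_simps)
qed

end

context energy
begin

definition rhs :: real where "rhs = energy_const \<nu> La g1 q * I t0 \<Psi>w + I t0 \<epsilon>"

lemma energy_const_ge_1: "1 \<le> energy_const \<nu> La g1 q"
  using La g1_pos by (simp add: energy_const_def)

lemma \<Psi>w_nonneg: "0 \<le> \<Psi>w z" and \<epsilon>_nonneg: "0 \<le> \<epsilon> z"
  using \<theta> \<rho> w_nonneg by (auto simp: \<Psi>w_def \<epsilon>_def)

lemma gradient_part_cont: "continuous_on S (\<lambda>z. \<beta>' z * P z * G (norm (V z)))"
  by (intro continuous_intros conts continuous_on_compose2[OF G_cont[of UNIV]] continuous_on_subset[OF V_cont subset_UNIV]) auto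

text \<open>The equation is tested with \<open>\<beta> P\<close> up to time \<open>t\<close>: the
  divergence part integrates to zero together with \<open>F \<bullet> fX\<close>, and the rest is
  bounded pointwise. The right side is taken over the full time interval, so one number serves all
  slices.\<close>

lemma energy_estimate:
  assumes t: "\<tau>0 \<le> t" "t \<le> t0"
  shows "(\<integral>x. \<B> (x, t) * P (x, t) \<partial>lborel) + \<nu> / 2 * I t (\<lambda>z. \<beta>' z * P z * G (norm (V z))) \<le> rhs"
proof -
  note [continuous_intros] = conts conts2 F_cont continuous_on_subset[OF V_cont subset_UNIV] gradient_part_cont
  have sub_cyl: "z \<in> cyl t0" if "z \<in> cyl t" for z using that t by (auto simp: cyl_def)
  let ?D = "\<lambda>z. \<beta>' z * P z * G (norm (V z))"
  have "(\<integral>x. \<B> (x, t) * P (x, t) \<partial>lborel) = I t Wt" by (rule time_integral_\<B>P[OF t(1)])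
  also have "\<dots> \<le> I t (\<lambda>z. (Fdiv z * f z + F z \<bullet> fX z) + (- (F z \<bullet> fX z) + \<B> z * PT z))"
  proof (rule I_mono)
    fix z assume z: "z \<in> cyl t"
    then have "vt z \<le> Fdiv z"
      using sub[of "fst z" "snd z"] t by (auto simp: cyl_def Fdiv_def dist_norm norm_minus_commute)
    then have "vt z * (\<beta> z * P z) \<le> Fdiv z * (\<beta> z * P z)"
      using t_bounds(3)[of z] P_bounds(1)[of z] by (intro mult_right_mono) auto
    then show "Wt z \<le> (Fdiv z * f z + F z \<bullet> fX z) + (- (F z \<bullet> fX z) + \<B> z * PT z)"
      by (simp add: Wt_def f_def algebra_simps)
  qed (intro continuous_intros)+
  also have "\<dots> = I t (\<lambda>z. Fdiv z * f z + F z \<bullet> fX z) + I t (\<lambda>z. - (F z \<bullet> fX z) + \<B> z * PT z)"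
    by (intro I_add continuous_intros)
  also have "\<dots> = I t (\<lambda>z. - (F z \<bullet> fX z) + \<B> z * PT z)" by (simp add: integration_by_parts)
  also have "\<dots> \<le> I t (\<lambda>z. (- (\<nu> / 2) * ?D z + energy_const \<nu> La g1 q * \<Psi>w z) + \<epsilon> z)"
    by (intro I_mono continuous_intros) (use flux_bound sub_cyl in auto)
  also have "\<dots> = - (\<nu> / 2) * I t ?D + energy_const \<nu> La g1 q * I t \<Psi>w + I t \<epsilon>"
    by (subst I_add, (intro continuous_intros)+, subst I_add, (intro continuous_intros)+, simp only: I_cmult)
  also have "\<dots> \<le> - (\<nu> / 2) * I t ?D + energy_const \<nu> La g1 q * I t0 \<Psi>w + I t0 \<epsilon>"
    using energy_const_ge_1 t
    by (intro add_mono mult_left_mono I_mono_time conts2 \<Psi>w_nonneg \<epsilon>_nonneg order_refl) auto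
  finally show ?thesis by (simp add: rhs_def)
qed

lemma \<B>P_integral_nonneg: "0 \<le> (\<integral>x. \<B> (x, t) * P (x, t) \<partial>lborel)"
  using t_bounds P_bounds by (intro Bochner_Integration.integral_nonneg) auto

text \<open>Both terms on the left of the energy inequality are nonnegative. Dropping the gradient
  term at arbitrary \<open>t\<close> controls every slice; dropping the slice term at
  \<open>t0\<close> controls the gradient.\<close>

lemma rhs_bounds:
  shows "\<tau>0 \<le> t \<Longrightarrow> t \<le> t0 \<Longrightarrow> (\<integral>x. \<B> (x, t) * P (x, t) \<partial>lborel) \<le> rhs"
    and "I t0 (\<lambda>z. \<beta>' z * P z * G (norm (V z))) \<le> 2 / \<nu> * rhs"
    and "I t0 (\<lambda>z. G (w z / \<rho>)) \<le> rhs"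
proof -
  have D0: "0 \<le> I t (\<lambda>z. \<beta>' z * P z * G (norm (V z)))" for t
    using t_bounds P_bounds by (intro I_nonneg) auto
  then have "0 \<le> \<nu> / 2 * I t (\<lambda>z. \<beta>' z * P z * G (norm (V z)))" for t using \<nu> by simp
  then show "(\<integral>x. \<B> (x, t) * P (x, t) \<partial>lborel) \<le> rhs" if "\<tau>0 \<le> t" "t \<le> t0" for t
    using energy_estimate[OF that] by (smt (verit))
  have "\<nu> / 2 * I t0 (\<lambda>z. \<beta>' z * P z * G (norm (V z))) \<le> rhs"
    using energy_estimate[of t0] \<B>P_integral_nonneg[of t0] \<tau> by linarith
  then show "I t0 (\<lambda>z. \<beta>' z * P z * G (norm (V z))) \<le> 2 / \<nu> * rhs" using \<nu> by (simp add: field_simps)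
  have "I t0 (\<lambda>z. G (w z / \<rho>)) \<le> I t0 \<Psi>w"
    using \<theta> \<rho> by (intro I_mono conts2 continuous_intros conts continuous_on_compose2[OF G_cont[of UNIV]]) (auto simp: \<Psi>w_def)
  also have "\<dots> \<le> energy_const \<nu> La g1 q * I t0 \<Psi>w"
    using energy_const_ge_1 mult_right_mono[OF energy_const_ge_1 I_nonneg[of t0 \<Psi>w]] \<Psi>w_nonneg by simp
  also have "\<dots> \<le> rhs" using I_nonneg[of t0 \<epsilon>] \<epsilon>_nonneg by (simp add: rhs_def)
  finally show "I t0 (\<lambda>z. G (w z / \<rho>)) \<le> rhs" .
qed

text \<open>The ramp \<open>Y\<close> does not return to zero after \<open>t0\<close>, so
  \<open>f\<close> is cut off in time by hand; in space and before \<open>\<tau>0\<close> it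
  vanishes already.\<close>

definition fc :: "(real ^ 'n) \<times> real \<Rightarrow> real" where "fc z = indicator (cyl t0) z * f z"

section \<open>Superlevel sets of the localised truncation\<close>

lemma cyl_measurable [measurable]: "cyl t \<in> sets borel"
  using cyl_compact by (auto intro: borel_compact)

lemma measurables [measurable]:
  "f \<in> borel_measurable borel" "fX \<in> borel_measurable borel" "fc \<in> borel_measurable borel"
proof -
  show [measurable]: "f \<in> borel_measurable borel" "fX \<in> borel_measurable borel"
    using conts2 by (auto intro: borel_measurable_continuous_onI)
  show "fc \<in> borel_measurable borel" unfolding fc_def[abs_def] by measurable
qed

text \<open>The factor \<open>\<beta>' P\<close> is at most 1 and leaves \<open>G\<close> by
  \<open>G_mult_le\<close>, which recovers the coercive integrand; the term
  \<open>2 q w / \<rho>\<close> from the cutoff is controlled by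
  \<open>G (w / \<rho>)\<close>.\<close>

lemma gradient_integral:
  "(\<integral>\<^sup>+z. ennreal (G (norm (fX z))) * indicator (cyl t0) z \<partial>lborel) \<le> ennreal (2 powr g1 * (2 / \<nu> + (2 * q) powr g1) * rhs)"
proof -
  have c: "continuous_on UNIV (\<lambda>z. G (norm (fX z)))"
    by (intro continuous_on_compose2[OF G_cont[of UNIV]] continuous_intros conts2) auto
  have c2: "continuous_on UNIV (\<lambda>z. G (w z / \<rho>))"
    using \<rho> by (intro continuous_on_compose2[OF G_cont[of UNIV]] continuous_intros conts) auto
  have "(\<integral>\<^sup>+z. ennreal (G (norm (fX z))) * indicator (cyl t0) z \<partial>lborel) =
      (\<integral>\<^sup>+z. ennreal (indicator (cyl t0) z *\<^sub>R G (norm (fX z))) \<partial>lborel)"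
    by (intro nn_integral_cong) (auto simp: indicator_def)
  also have "\<dots> = ennreal (I t0 (\<lambda>z. G (norm (fX z))))"
    unfolding I_def by (intro nn_integral_eq_integral I_int c AE_I2) (auto simp: indicator_def)
  finally have eq: "(\<integral>\<^sup>+z. ennreal (G (norm (fX z))) * indicator (cyl t0) z \<partial>lborel) = ennreal (I t0 (\<lambda>z. G (norm (fX z))))" .
  have "I t0 (\<lambda>z. G (norm (fX z))) \<le>
      I t0 (\<lambda>z. 2 powr g1 * (\<beta>' z * P z * G (norm (V z)) + (2 * q) powr g1 * G (w z / \<rho>)))"
  proof (rule I_mono[OF c])
    show "continuous_on UNIV (\<lambda>z. 2 powr g1 * (\<beta>' z * P z * G (norm (V z)) + (2 * q) powr g1 * G (w z / \<rho>)))"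
      by (intro continuous_intros c2 gradient_part_cont)
    fix z assume z: "z \<in> cyl t0"
    have b: "0 \<le> \<beta>' z * P z" "\<beta>' z * P z \<le> 1"
      using t_bounds[of z] P_bounds[of z] z by (auto simp: cyl_def intro!: mult_le_one)
    have "G (norm (fX z)) \<le> G (\<beta>' z * P z * norm (V z) + 2 * q * (w z / \<rho>))"
      by (intro G_mono order_trans[OF fX_bound[OF z]]) simp
    also have "\<dots> \<le> 2 powr g1 * (G (\<beta>' z * P z * norm (V z)) + G (2 * q * (w z / \<rho>)))"
      using b w_nonneg \<rho> by (intro G_add_le) auto
    also have "\<dots> \<le> 2 powr g1 * (\<beta>' z * P z * G (norm (V z)) + (2 * q) powr g1 * G (w z / \<rho>))"
      using q by (intro mult_left_mono add_mono G_mult_le b G_scale_le) auto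
    finally show "G (norm (fX z)) \<le> 2 powr g1 * (\<beta>' z * P z * G (norm (V z)) + (2 * q) powr g1 * G (w z / \<rho>))" .
  qed
  also have "I t0 (\<lambda>z. 2 powr g1 * (\<beta>' z * P z * G (norm (V z)) + (2 * q) powr g1 * G (w z / \<rho>))) =
      2 powr g1 * (I t0 (\<lambda>z. \<beta>' z * P z * G (norm (V z))) + (2 * q) powr g1 * I t0 (\<lambda>z. G (w z / \<rho>)))"
    by (subst I_cmult, subst I_add, (intro continuous_intros gradient_part_cont c2)+, simp only: I_cmult)
  also have "\<dots> \<le> 2 powr g1 * (2 / \<nu> * rhs + (2 * q) powr g1 * rhs)"
    by (intro mult_left_mono add_mono rhs_bounds) auto
  also have "\<dots> = 2 powr g1 * (2 / \<nu> + (2 * q) powr g1) * rhs" by (simp add: algebra_simps)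
  finally show ?thesis unfolding eq by (rule ennreal_leI)
qed

text \<open>On the slice \<open>\<beta>^2 <= 2 \<B>\<close> and \<open>P^2 <= P\<close>, so the
  energy of the slice dominates the square of \<open>f\<close>.\<close>

lemma slice_square:
  assumes "\<tau>0 \<le> t" "t \<le> t0"
  shows "(\<integral>\<^sup>+x. ennreal ((f (x, t))\<^sup>2) \<partial>lborel) \<le> ennreal (2 * rhs)"
proof -
  have i: "integrable lborel (\<lambda>x. 2 * (\<B> (x, t) * P (x, t)))"
  proof (rule integrable_cont_compact_support[OF _ compact_cball[of x0 r]])
    show "continuous_on UNIV (\<lambda>x. 2 * (\<B> (x, t) * P (x, t)))"
      by (intro continuous_intros continuous_on_compose2[OF conts(9)[of UNIV]] continuous_on_compose2[OF conts(3)[of UNIV]]) auto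
  qed (simp add: outside)
  have "(\<integral>\<^sup>+x. ennreal ((f (x, t))\<^sup>2) \<partial>lborel) \<le> (\<integral>\<^sup>+x. ennreal (2 * (\<B> (x, t) * P (x, t))) \<partial>lborel)"
  proof (intro nn_integral_mono ennreal_leI)
    fix x
    have "(f (x, t))\<^sup>2 = (\<beta> (x, t))\<^sup>2 * (P (x, t) * P (x, t))" by (simp add: f_def power2_eq_square)
    also have "\<dots> \<le> (2 * \<B> (x, t)) * (1 * P (x, t))"
      using t_bounds[of "(x, t)"] P_bounds[of "(x, t)"] assms by (intro mult_mono) auto
    finally show "(f (x, t))\<^sup>2 \<le> 2 * (\<B> (x, t) * P (x, t))" by simp
  qed
  also have "\<dots> = ennreal (2 * (\<integral>x. \<B> (x, t) * P (x, t) \<partial>lborel))"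
    using t_bounds P_bounds by (subst nn_integral_eq_integral[OF i]) auto
  also have "\<dots> \<le> ennreal (2 * rhs)" by (intro ennreal_leI mult_left_mono rhs_bounds assms) simp
  finally show ?thesis .
qed

text \<open>The spatial estimate is applied on each time slice and integrated in time. Slices are
  bounded by \<open>2 * S\<close> and the spatial estimate asks for twice that bound, hence
  \<open>4 * S\<close>.\<close>

lemma superlevel_estimate:
  assumes S: "rhs \<le> S" and l: "0 < l" "0 < h" and lh: "4 * S \<le> l\<^sup>2 * measure lborel (ball (0 :: real ^ 'n) h)"
  shows "emeasure lborel {z \<in> space lborel. 2 * l < fc z} * ennreal (G (l / h)) \<le> ennreal (level_const \<nu> g1 q * S)"
proof -
  let ?E = "{z. 2 * l < fc z}"
  have E[measurable]: "?E \<in> sets borel" by measurable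
  have rhs0: "0 \<le> rhs" using rhs_bounds(3) I_nonneg[of t0 "\<lambda>z. G (w z / \<rho>)"] by (meson G_nonneg order_trans)
  have m1: "(\<lambda>z. indicator ?E z :: ennreal) \<in> borel_measurable (lborel \<Otimes>\<^sub>M lborel)"
    unfolding lborel_prod by measurable
  have m2: "(\<lambda>z. ennreal (G (norm (fX z))) * indicator (cyl t0) z) \<in> borel_measurable (lborel \<Otimes>\<^sub>M lborel)"
    unfolding lborel_prod by measurable
  have slice: "(\<integral>\<^sup>+x. indicator ?E (x, t) \<partial>lborel) * ennreal (G (l / h)) \<le>
      2 * (\<integral>\<^sup>+x. ennreal (G (norm (fX (x, t)))) * indicator (cyl t0) (x, t) \<partial>lborel)" for t
  proof (cases "\<tau>0 \<le> t \<and> t \<le> t0")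
    case True
    have c: "continuous_on UNIV (\<lambda>x. fX (x, t))"
      by (rule continuous_on_compose2[OF conts2(2)[of UNIV]]) (auto intro!: continuous_intros)
    have cf: "continuous_on UNIV (\<lambda>x. f (x, t))"
      by (rule continuous_on_compose2[OF conts2(1)[of UNIV]]) (auto intro!: continuous_intros)
    have [measurable]: "(\<lambda>x. f (x, t)) \<in> borel_measurable borel" by (rule borel_measurable_continuous_onI[OF cf])
    have M: "{x. 2 * l < f (x, t)} \<in> sets borel" by measurable
    have "(\<integral>\<^sup>+x. indicator ?E (x, t) \<partial>lborel) \<le> (\<integral>\<^sup>+x. indicator {x. 2 * l < f (x, t)} x \<partial>lborel)"
      using l by (intro nn_integral_mono) (auto simp: indicator_def fc_def)
    also have "\<dots> = emeasure lborel {x. 2 * l < f (x, t)}" using M by simp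
    finally have "(\<integral>\<^sup>+x. indicator ?E (x, t) \<partial>lborel) * ennreal (G (l / h)) \<le>
        emeasure lborel {x. 2 * l < f (x, t)} * ennreal (G (l / h))"
      by (rule mult_right_mono) simp
    also have "\<dots> \<le> 2 * (\<integral>\<^sup>+x. ennreal (G (norm (fX (x, t)))) \<partial>lborel)"
    proof (rule superlevel_gradient_bound[OF has_derivative_slices(2)[OF f_deriv] c l])
      show "(\<integral>\<^sup>+x. ennreal ((f (x, t))\<^sup>2) \<partial>lborel) \<le> ennreal (2 * S)"
        using slice_square[of t] True S by (meson ennreal_leI mult_left_mono order_trans zero_le_numeral)
    qed (use lh S rhs0 in auto)
    also have "(\<integral>\<^sup>+x. ennreal (G (norm (fX (x, t)))) \<partial>lborel) =
        (\<integral>\<^sup>+x. ennreal (G (norm (fX (x, t)))) * indicator (cyl t0) (x, t) \<partial>lborel)"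
      using outside(5) True by (intro nn_integral_cong) (auto simp: indicator_def cyl_def)
    finally show ?thesis .
  next
    case False
    then have "(x, t) \<notin> ?E" for x using l by (auto simp: fc_def cyl_def)
    then have "(\<integral>\<^sup>+x. indicator ?E (x, t) \<partial>lborel) = 0" by simp
    then show ?thesis by simp
  qed
  have "emeasure lborel ?E = (\<integral>\<^sup>+z. indicator ?E z \<partial>lborel)" by simp
  also have "\<dots> = (\<integral>\<^sup>+t. (\<integral>\<^sup>+x. indicator ?E (x, t) \<partial>lborel) \<partial>lborel)"
    using lborel_pair.nn_integral_snd[OF m1] by (simp add: lborel_prod)
  finally have "emeasure lborel ?E * ennreal (G (l / h)) =
      (\<integral>\<^sup>+t. (\<integral>\<^sup>+x. indicator ?E (x, t) \<partial>lborel) * ennreal (G (l / h)) \<partial>lborel)"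
    by (subst nn_integral_multc) (use m1 in measurable)
  also have "\<dots> \<le> (\<integral>\<^sup>+t. 2 * (\<integral>\<^sup>+x. ennreal (G (norm (fX (x, t)))) * indicator (cyl t0) (x, t) \<partial>lborel) \<partial>lborel)"
    by (intro nn_integral_mono slice)
  also have "\<dots> = 2 * (\<integral>\<^sup>+t. (\<integral>\<^sup>+x. ennreal (G (norm (fX (x, t)))) * indicator (cyl t0) (x, t) \<partial>lborel) \<partial>lborel)"
    by (rule nn_integral_cmult) (use m2 in measurable)
  also have "(\<integral>\<^sup>+t. (\<integral>\<^sup>+x. ennreal (G (norm (fX (x, t)))) * indicator (cyl t0) (x, t) \<partial>lborel) \<partial>lborel) =
      (\<integral>\<^sup>+z. ennreal (G (norm (fX z))) * indicator (cyl t0) z \<partial>lborel)"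
    using lborel_pair.nn_integral_snd[OF m2] by (simp add: lborel_prod)
  also have "2 * \<dots> \<le> 2 * ennreal (2 powr g1 * (2 / \<nu> + (2 * q) powr g1) * rhs)"
    by (intro mult_left_mono gradient_integral) simp
  also have "\<dots> = ennreal (level_const \<nu> g1 q * rhs)"
    using \<nu> rhs0 by (simp add: level_const_def ennreal_mult' mult.assoc flip: ennreal_numeral)
  also have "\<dots> \<le> ennreal (level_const \<nu> g1 q * S)"
    using \<nu> S by (intro ennreal_leI mult_left_mono) (auto simp: level_const_def)
  finally show ?thesis by simp
qed

lemma level_const_pos: "0 < level_const \<nu> g1 q"
  using \<nu> by (simp add: level_const_def add_pos_nonneg)

text \<open>On \<open>N\<close>, where the cutoff is at least \<open>c\<close>,
  \<open>v > \<kappa> + d\<close> forces \<open>w <= 2 \<beta>\<close> and hence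
  \<open>fc > c d / 2 = 2 k \<mu>\<close>, and the new excess is at most
  \<open>(2 / c) * fc\<close>. The excess thus lives on a superlevel set of \<open>fc\<close>, where
  the dyadic summation applies; the relation between \<open>\<theta>\<close> and \<open>k\<close>
  converts the quadratic term to the form used there.\<close>

lemma truncation_step:
  fixes N :: "((real ^ 'n) \<times> real) set" and k c s \<mu> :: real
  defines "\<omega> \<equiv> measure lborel (ball (0 :: real ^ 'n) 1)" and "n \<equiv> CARD('n)"
  assumes g0n: "2 * real n / (real n + 2) < g0"
    and k: "0 < k" "\<theta> = k\<^sup>2 * inverse (G (k / \<rho>))" "d \<le> k"
    and c: "0 < c" "c \<le> 1" "N \<subseteq> cyl t0" "\<And>z. z \<in> N \<Longrightarrow> c \<le> P z"
    and s: "0 < s" "4 * s \<le> \<omega> * \<mu>\<^sup>2" "rhs \<le> s * \<rho> ^ n * k\<^sup>2" and \<mu>: "\<mu> = c * d / (4 * k)"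
  shows "(\<integral>\<^sup>+z. ennreal (G ((v z - (\<kappa> + d)) / \<rho>) + (max 0 (v z - (\<kappa> + d)))\<^sup>2 / \<theta>) * indicator N z \<partial>lborel)
    \<le> ennreal ((2 / c) powr max g1 2 * (gain_const g0 g1 n * level_const \<nu> g1 q * (4 * s / \<omega>) powr (g0 / n)
        * \<mu> powr (- 2 * (g0 / n) - g1) * (s * \<rho> ^ n * k\<^sup>2)))"
proof -
  have \<omega>: "0 < \<omega>" unfolding \<omega>_def using content_ball_pos[of 1 "0 :: real ^ 'n"] by simp
  have n: "1 \<le> n" by (simp add: n_def Suc_leI)
  have \<mu>01: "0 < \<mu>" "\<mu> \<le> 1"
  proof -
    show "0 < \<mu>" using c d k by (simp add: \<mu>)
    have "c * d \<le> 1 * k" using c d k by (intro mult_mono) auto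
    then show "\<mu> \<le> 1" using k by (simp add: \<mu>)
  qed
  define m where "m = max g1 2"
  define H where "H = G (k / \<rho>)"
  have H: "0 < H" using k \<rho> G_pos by (simp add: H_def)
  let ?\<Psi> = "\<lambda>t. G (t / \<rho>) + t\<^sup>2 / k\<^sup>2 * H"
  have ball: "measure lborel (ball (0 :: real ^ 'n) h) = \<omega> * h ^ n" if "0 < h" for h
    using content_ball_conv_unit_ball[of h "0 :: real ^ 'n"] that by (simp add: \<omega>_def n_def)
  have main: "(\<integral>\<^sup>+z. ennreal (?\<Psi> (fc z)) * indicator {z \<in> space lborel. 2 * (k * \<mu>) < fc z} z \<partial>lborel)
    \<le> ennreal (gain_const g0 g1 n * level_const \<nu> g1 q * (4 * s / \<omega>) powr (g0 / n) * \<mu> powr (- 2 * (g0 / n) - g1) * (s * \<rho> ^ n * k\<^sup>2))"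
    unfolding H_def
    by (rule dyadic_gain[OF n g0n _ level_const_pos \<omega> s(1) k(1) \<rho> \<mu>01 s(2)])
      (auto intro!: superlevel_estimate[OF s(3), simplified] simp: ball)
  have c2: "1 \<le> 2 / c" using c by simp
  have th: "x / \<theta> = x * (H / k\<^sup>2)" for x
    by (subst k(2)) (simp add: H_def[symmetric] field_simps)
  have "(\<integral>\<^sup>+z. ennreal (G ((v z - (\<kappa> + d)) / \<rho>) + (max 0 (v z - (\<kappa> + d)))\<^sup>2 / \<theta>) * indicator N z \<partial>lborel)
    \<le> (\<integral>\<^sup>+z. ennreal ((2 / c) powr m) * (ennreal (?\<Psi> (fc z)) * indicator {z \<in> space lborel. 2 * (k * \<mu>) < fc z} z) \<partial>lborel)"
  proof (rule nn_integral_mono)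
    fix z
    show "ennreal (G ((v z - (\<kappa> + d)) / \<rho>) + (max 0 (v z - (\<kappa> + d)))\<^sup>2 / \<theta>) * indicator N z \<le>
      ennreal ((2 / c) powr m) * (ennreal (?\<Psi> (fc z)) * indicator {z \<in> space lborel. 2 * (k * \<mu>) < fc z} z)"
    proof (cases "z \<in> N \<and> \<kappa> + d < v z")
      case True
      then have z: "z \<in> cyl t0" "c \<le> P z" using c by auto
      have fc: "fc z = \<beta> z * P z" using z by (simp add: fc_def f_def)
      have wb: "w z \<le> 2 * \<beta> z" using trunc_bounds(9)[OF d, of \<kappa> "v z"] True by (simp add: w_def \<beta>_def)
      have wd: "d < w z" using True d by (simp add: w_def)
      have "\<beta> z * c \<le> fc z" unfolding fc using z t_bounds by (intro mult_left_mono) auto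
      moreover have "w z * c \<le> (2 * \<beta> z) * c" using wb c by (intro mult_right_mono) auto
      ultimately have wf: "w z * c \<le> 2 * fc z" by simp
      have "d * c < w z * c" using wd c by simp
      then have lev: "2 * (k * \<mu>) < fc z" using wf k by (simp add: \<mu> mult.commute)
      have fc0: "0 \<le> fc z" unfolding fc using t_bounds P_bounds by simp
      define y where "y = max 0 (v z - (\<kappa> + d))"
      have y: "v z - (\<kappa> + d) = y" "0 \<le> y" "y \<le> w z" using True d by (auto simp: y_def w_def)
      have "y * c \<le> 2 * fc z" using mult_right_mono[OF y(3), of c] wf c(1) by linarith
      then have yf: "y \<le> (2 / c) * fc z" using c by (simp add: field_simps)
      have "G (y / \<rho>) \<le> G ((2 / c) * (fc z / \<rho>))" using yf \<rho> by (intro G_mono) (simp add: field_simps)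
      also have "\<dots> \<le> (2 / c) powr g1 * G (fc z / \<rho>)" by (rule G_scale_le[OF c2])
      also have "\<dots> \<le> (2 / c) powr m * G (fc z / \<rho>)" using c2 by (intro mult_right_mono powr_mono) (auto simp: m_def)
      finally have 1: "G (y / \<rho>) \<le> (2 / c) powr m * G (fc z / \<rho>)" .
      have "y\<^sup>2 \<le> ((2 / c) * fc z)\<^sup>2" using yf y by (intro power_mono) auto
      also have "\<dots> = (2 / c) powr 2 * (fc z)\<^sup>2" using c by (simp add: power_mult_distrib power_divide powr_numeral)
      also have "\<dots> \<le> (2 / c) powr m * (fc z)\<^sup>2" using c2 by (intro mult_right_mono powr_mono) (auto simp: m_def)
      finally have "y\<^sup>2 * (H / k\<^sup>2) \<le> (2 / c) powr m * (fc z)\<^sup>2 * (H / k\<^sup>2)" using H by (intro mult_right_mono) auto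
      then have 2: "y\<^sup>2 / \<theta> \<le> (2 / c) powr m * ((fc z)\<^sup>2 / k\<^sup>2 * H)"
        by (simp add: th mult.assoc)
      have "G ((v z - (\<kappa> + d)) / \<rho>) + (max 0 (v z - (\<kappa> + d)))\<^sup>2 / \<theta> \<le> (2 / c) powr m * ?\<Psi> (fc z)"
        unfolding y_def[symmetric] using 1 2 y(1) by (simp add: algebra_simps)
      then have "ennreal (G ((v z - (\<kappa> + d)) / \<rho>) + (max 0 (v z - (\<kappa> + d)))\<^sup>2 / \<theta>) \<le> ennreal ((2 / c) powr m) * ennreal (?\<Psi> (fc z))"
        using H by (subst ennreal_mult[symmetric]) (auto intro!: ennreal_leI)
      then show ?thesis using lev True by simp
    next
      case False
      then have "z \<notin> N \<or> v z - (\<kappa> + d) \<le> 0" by auto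
      then have "z \<notin> N \<or> G ((v z - (\<kappa> + d)) / \<rho>) + (max 0 (v z - (\<kappa> + d)))\<^sup>2 / \<theta> = 0"
        using \<rho> by (auto simp: G_nonpos_arg divide_nonpos_pos)
      then show ?thesis by auto
    qed
  qed
  also have "\<dots> = ennreal ((2 / c) powr m) * (\<integral>\<^sup>+z. ennreal (?\<Psi> (fc z)) * indicator {z \<in> space lborel. 2 * (k * \<mu>) < fc z} z \<partial>lborel)"
    by (rule nn_integral_cmult) measurable
  also have "\<dots> \<le> ennreal ((2 / c) powr m) * ennreal (gain_const g0 g1 n * level_const \<nu> g1 q * (4 * s / \<omega>) powr (g0 / n) * \<mu> powr (- 2 * (g0 / n) - g1) * (s * \<rho> ^ n * k\<^sup>2))"
    by (rule mult_left_mono[OF main]) simp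
  finally show ?thesis unfolding m_def by (simp add: ennreal_mult')
qed

end

subsection \<open>Passing to the limit in the mollification\<close>

lemma conv_add:
  assumes \<kappa>: "mollifier r \<kappa>" and "integrable lborel f" "integrable lborel h"
  shows "conv \<kappa> (\<lambda>w. f w + h w) z = conv \<kappa> f z + conv \<kappa> h z"
  unfolding conv_def scaleR_add_right using conv_integrable[OF mollifier_kernel[OF \<kappa>]] assms
  by (intro Bochner_Integration.integral_add) auto

text \<open>Fatou's lemma, in a form where the uniform bound is available only for sufficiently late
  members of the sequence.\<close>

lemma nn_integral_le_limit:
  fixes X :: "nat \<Rightarrow> 'a \<Rightarrow> ennreal"
  assumes [measurable]: "\<And>m. X m \<in> borel_measurable M"
    and lim: "AE z in M. (\<lambda>m. X m z) \<longlonglongrightarrow> Y z" and C: "eventually (\<lambda>m. (\<integral>\<^sup>+z. X m z \<partial>M) \<le> C) sequentially"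
  shows "(\<integral>\<^sup>+z. Y z \<partial>M) \<le> C"
proof -
  have "(\<integral>\<^sup>+z. Y z \<partial>M) = (\<integral>\<^sup>+z. liminf (\<lambda>m. X m z) \<partial>M)"
    using lim by (intro nn_integral_cong_AE) (auto simp: lim_imp_Liminf)
  also have "\<dots> \<le> liminf (\<lambda>m. \<integral>\<^sup>+z. X m z \<partial>M)" by (rule nn_integral_liminf) measurable
  also have "\<dots> \<le> limsup (\<lambda>m. \<integral>\<^sup>+z. X m z \<partial>M)" by (rule Liminf_le_Limsup) simp
  also have "\<dots> \<le> C" by (rule Limsup_bounded[OF C])
  finally show ?thesis .
qed

text \<open>The interface between the weak formulation and the iteration. \<open>u\<close> and
  \<open>Du\<close> are defined and integrable on all of space-time; the equation survives only
  through its consequences for convolutions, at points of the closed cylinder and for mollifiers of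
  radius below \<open>\<delta>\<close>.\<close>

locale regularized = growth g0 g1 g for g0 g1 g +
  fixes \<nu> La \<rho> t0 \<theta> \<delta> :: real and x0 :: "real ^ 'n" and A :: "real ^ 'n \<Rightarrow> real ^ 'n"
    and u :: "(real ^ 'n) \<times> real \<Rightarrow> real" and Du :: "(real ^ 'n) \<times> real \<Rightarrow> real ^ 'n"
  assumes \<nu>: "0 < \<nu>" and La: "0 < La"
    and A_ell: "\<And>\<xi>. \<nu> * G (norm \<xi>) \<le> A \<xi> \<bullet> \<xi>" and A_bd: "\<And>\<xi>. norm (A \<xi>) \<le> La * g (norm \<xi>)"
    and A_cont: "continuous_on UNIV A"
    and u_int: "integrable lborel u" and u_nonneg: "\<And>z. 0 \<le> u z"
    and u2_int: "integrable lborel (\<lambda>z. (u z)\<^sup>2)" and Gu_int: "integrable lborel (\<lambda>z. G (u z))"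
    and Du_int: "integrable lborel Du" and GDu_int: "integrable lborel (\<lambda>z. G (norm (Du z)))"
    and ADu_int: "integrable lborel (\<lambda>z. A (Du z))"
    and \<rho>: "0 < \<rho>" and \<theta>: "0 < \<theta>" and \<delta>: "0 < \<delta>"
    and weak_grad: "\<And>r \<kappa> z i. mollifier r \<kappa> \<Longrightarrow> r < \<delta> \<Longrightarrow> z \<in> cball x0 \<rho> \<times> {t0 - \<theta>..t0} \<Longrightarrow>
      conv (\<lambda>y. grad \<kappa> y \<bullet> (axis i 1, 0)) u z = conv \<kappa> Du z $ i"
    and subsol: "\<And>r \<kappa> z. mollifier r \<kappa> \<Longrightarrow> r < \<delta> \<Longrightarrow> z \<in> cball x0 \<rho> \<times> {t0 - \<theta>..t0} \<Longrightarrow>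
      conv (\<lambda>y. grad \<kappa> y \<bullet> (0, 1)) u z \<le> (\<Sum>i\<in>UNIV. conv (\<lambda>y. grad \<kappa> y \<bullet> (axis i 1, 0)) (\<lambda>w. A (Du w)) z $ i)"
begin

abbreviation cylQ :: "((real ^ 'n) \<times> real) set" where "cylQ \<equiv> cball x0 \<rho> \<times> {t0 - \<theta>..t0}"

text \<open>The flux error of the energy estimate with the mollified function itself in place of its
  excess over a level. It dominates the error for all levels and subcylinders, so its convergence is
  shown only once.\<close>

definition err :: "real \<Rightarrow> ((real ^ 'n) \<times> real \<Rightarrow> real) \<Rightarrow> (real ^ 'n) \<times> real \<Rightarrow> real" where
  "err c \<kappa> z = norm (conv \<kappa> (\<lambda>w. A (Du w)) z - A (conv \<kappa> Du z)) * (norm (conv \<kappa> Du z) + c * conv \<kappa> u z)"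

text \<open>The excess over level \<open>a\<close>. The first term needs no positive part because
  \<open>G\<close> vanishes on negative arguments.\<close>

definition \<Psi> :: "real \<Rightarrow> real \<Rightarrow> real" where "\<Psi> a t = G ((t - a) / \<rho>) + (max 0 (t - a))\<^sup>2 / \<theta>"

lemma \<Psi>_nonneg: "0 \<le> \<Psi> a t" using \<theta> by (simp add: \<Psi>_def)

lemma \<Psi>_cont: "continuous_on S (\<Psi> a)"
  unfolding \<Psi>_def using \<rho> \<theta> by (intro continuous_intros continuous_on_compose2[OF G_cont[of UNIV]]) auto

lemma \<Psi>_measurable [measurable]: "\<Psi> a \<in> borel_measurable borel"
  by (rule borel_measurable_continuous_onI[OF \<Psi>_cont])

lemma \<Psi>_antimono: "a \<le> b \<Longrightarrow> \<Psi> b t \<le> \<Psi> a t"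
  unfolding \<Psi>_def using \<rho> \<theta> by (intro add_mono G_mono divide_right_mono power_mono) auto

text \<open>Adding the supporting lines of the two convex terms makes Jensen's inequality available:
  mollifying \<open>u\<close> is controlled by mollifying its excess.\<close>

lemma \<Psi>_support: "\<exists>c. \<forall>y. \<Psi> a x + c * (y - x) \<le> \<Psi> a y"
proof -
  obtain c where c: "\<And>b. G ((x - a) / \<rho>) + c * (b - (x - a) / \<rho>) \<le> G b" using G_support by blast
  let ?m = "max 0 (x - a)"
  have 1: "?m\<^sup>2 + 2 * ?m * (y - x) \<le> (max 0 (y - a))\<^sup>2" for y
  proof -
    have "?m\<^sup>2 + 2 * ?m * (max 0 (y - a) - ?m) \<le> (max 0 (y - a))\<^sup>2"
      using zero_le_power2[of "max 0 (y - a) - ?m"] by (simp add: power2_eq_square algebra_simps)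
    moreover have "?m * (y - x) \<le> ?m * (max 0 (y - a) - ?m)"
      by (cases "x \<le> a") (auto intro!: mult_left_mono)
    ultimately show ?thesis by linarith
  qed
  have "\<Psi> a x + (c / \<rho> + 2 * ?m / \<theta>) * (y - x) \<le> \<Psi> a y" for y
  proof -
    have "(y - a) / \<rho> - (x - a) / \<rho> = (y - x) / \<rho>" by (simp add: diff_divide_distrib)
    then have 2: "G ((x - a) / \<rho>) + c / \<rho> * (y - x) \<le> G ((y - a) / \<rho>)" using c[of "(y - a) / \<rho>"] by simp
    have "(?m\<^sup>2 + 2 * ?m * (y - x)) / \<theta> \<le> (max 0 (y - a))\<^sup>2 / \<theta>"
      by (rule divide_right_mono[OF 1]) (use \<theta> in simp)
    then have "?m\<^sup>2 / \<theta> + 2 * ?m / \<theta> * (y - x) \<le> (max 0 (y - a))\<^sup>2 / \<theta>" by (simp add: add_divide_distrib)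
    then show ?thesis using 2 unfolding \<Psi>_def distrib_right by linarith
  qed
  then show ?thesis by blast
qed

lemma \<Psi>_int:
  assumes "0 \<le> a"
  shows "integrable lborel (\<lambda>z. \<Psi> a (u z))"
proof (rule Bochner_Integration.integrable_bound)
  have [measurable]: "u \<in> borel_measurable lborel" using u_int by auto
  show "integrable lborel (\<lambda>z. (max 1 (1 / \<rho>)) powr g1 * G (u z) + (u z)\<^sup>2 / \<theta>)"
    using Gu_int u2_int by auto
  show "(\<lambda>z. \<Psi> a (u z)) \<in> borel_measurable lborel" by measurable
  show "AE z in lborel. norm (\<Psi> a (u z)) \<le> norm ((max 1 (1 / \<rho>)) powr g1 * G (u z) + (u z)\<^sup>2 / \<theta>)"
  proof (rule AE_I2)
    fix z
    have "\<Psi> a (u z) \<le> \<Psi> 0 (u z)" by (rule \<Psi>_antimono[OF assms])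
    also have "\<dots> \<le> (max 1 (1 / \<rho>)) powr g1 * G (u z) + (u z)\<^sup>2 / \<theta>"
      using G_scale_all[of "1 / \<rho>" "u z"] \<rho> u_nonneg[of z] by (simp add: \<Psi>_def)
    finally show "norm (\<Psi> a (u z)) \<le> norm ((max 1 (1 / \<rho>)) powr g1 * G (u z) + (u z)\<^sup>2 / \<theta>)"
      using \<Psi>_nonneg[of a "u z"] by simp
  qed
qed

text \<open>The abstract energy setting is instantiated with \<open>v = conv \<kappa> u\<close> and
  the mollified flux; all derivatives fall on the smooth kernel.\<close>

lemma mollified_step:
  fixes N :: "((real ^ 'n) \<times> real) set" and \<kappa> :: "(real ^ 'n) \<times> real \<Rightarrow> real" and k c s \<mu> a d r \<tau>0 r' :: real and q :: nat
  defines "\<omega> \<equiv> measure lborel (ball (0 :: real ^ 'n) 1)" and "n \<equiv> CARD('n)" and "C \<equiv> cball x0 r \<times> {\<tau>0..t0}"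
  assumes \<kappa>: "mollifier r' \<kappa>" "r' < \<delta>" and a: "0 \<le> a" and d: "0 < d" and r: "0 < r" "r \<le> \<rho>"
    and \<tau>: "\<tau>0 < t0" "t0 - \<tau>0 \<le> \<theta>" and q: "2 \<le> q" "g1 \<le> q" and g0n: "2 * real n / (real n + 2) < g0"
    and k: "0 < k" "\<theta> = k\<^sup>2 * inverse (G (k / \<rho>))" "d \<le> k"
    and c: "0 < c" "c \<le> 1" "N \<subseteq> C"
    "\<And>x t. (x, t) \<in> N \<Longrightarrow> c \<le> (max 0 ((r\<^sup>2 - (x - x0) \<bullet> (x - x0)) / \<rho>\<^sup>2)) ^ q * (max 0 ((t - \<tau>0) / \<theta>)) ^ q"
    and s: "0 < s" "4 * s \<le> \<omega> * \<mu>\<^sup>2" and \<mu>: "\<mu> = c * d / (4 * k)"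
    and e: "energy_const \<nu> La g1 q * (\<integral>z. indicator C z * \<Psi> a (conv \<kappa> u z) \<partial>lborel) +
      (\<integral>z. indicator cylQ z * err (2 * q / \<rho>) \<kappa> z \<partial>lborel) \<le> s * \<rho> ^ n * k\<^sup>2"
    and err_int: "integrable lborel (\<lambda>z. indicator cylQ z * err (2 * q / \<rho>) \<kappa> z)"
  shows "(\<integral>\<^sup>+z. ennreal (\<Psi> (a + d) (conv \<kappa> u z)) * indicator N z \<partial>lborel)
    \<le> ennreal ((2 / c) powr max g1 2 * (gain_const g0 g1 n * level_const \<nu> g1 q * (4 * s / \<omega>) powr (g0 / n)
        * \<mu> powr (- 2 * (g0 / n) - g1) * (s * \<rho> ^ n * k\<^sup>2)))"
proof -
  let ?L = "\<lambda>z h. conv (\<lambda>y. grad \<kappa> y \<bullet> h) u z"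
  define v where "v = conv \<kappa> u"
  \<comment> \<open>The gradient is defined by differentiating the kernel, hence smooth everywhere.
    It agrees with \<open>conv \<kappa> Du\<close> only on the cylinder, where the weak gradient
    identity is available; the error is compared only there.\<close>
  define V where "V z = (\<chi> i. ?L z (axis i 1, 0))" for z
  define vt where "vt z = ?L z (0, 1)" for z
  define F where "F = conv \<kappa> (\<lambda>w. A (Du w))"
  define F' where "F' z h = conv (\<lambda>y. grad \<kappa> y \<bullet> h) (\<lambda>w. A (Du w)) z" for z h
  note gk = kernel_inner[OF mollifier_grad_kernel[OF \<kappa>(1)]]
  have CQ: "C \<subseteq> cylQ" using r \<tau> by (auto simp: C_def)
  have D: "(v has_derivative ?L z) (at z)" for z
    unfolding v_def by (rule conv_has_derivative[OF \<kappa>(1) u_int])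
  have L: "?L z h = V z \<bullet> fst h + vt z * snd h" for z h
  proof -
    interpret linear "?L z" using D by (rule has_derivative_linear)
    obtain x t where h: "h = (x, t)" by (cases h)
    have "h = (\<Sum>i\<in>UNIV. (x $ i) *\<^sub>R (axis i 1, 0)) + t *\<^sub>R (0, 1)"
      by (simp add: h prod_eq_iff fst_sum snd_sum vec_eq_iff axis_def if_distrib cong: if_cong)
    then have "?L z h = (\<Sum>i\<in>UNIV. (x $ i) * ?L z (axis i 1, 0)) + t * ?L z (0, 1)"
      by (simp only: add sum scale real_scaleR_def)
    then show ?thesis by (simp add: h V_def vt_def inner_vec_def mult.commute)
  qed
  have V_Q: "V z = conv \<kappa> Du z" if "z \<in> cylQ" for z
    using weak_grad[OF \<kappa> that] by (simp add: V_def vec_eq_iff)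
  interpret E: energy g0 g1 g \<nu> La a d r \<rho> \<tau>0 t0 \<theta> q x0 A v vt V F F'
  proof
    show "(v has_derivative (\<lambda>h. V z \<bullet> fst h + vt z * snd h)) (at z)" for z
      using D[of z] unfolding L .
    show "continuous_on UNIV V"
      unfolding V_def by (intro continuous_on_vec_lambda conv_continuous[OF gk u_int])
    show "continuous_on UNIV vt"
      unfolding vt_def by (intro conv_continuous[OF gk u_int])
    show "(F has_derivative F' z) (at z)" for z
      unfolding F_def F'_def by (rule conv_has_derivative[OF \<kappa>(1) ADu_int])
    show "continuous_on UNIV (\<lambda>z. F' z h)" for h
      unfolding F'_def by (intro conv_continuous[OF gk ADu_int])
    show "vt (x, t) \<le> (\<Sum>i\<in>UNIV. F' (x, t) (axis i 1, 0) $ i)" if "norm (x - x0) \<le> r" "\<tau>0 \<le> t" "t \<le> t0" for x t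
      unfolding vt_def F'_def using that r \<tau> by (intro subsol[OF \<kappa>]) (auto simp: dist_norm norm_minus_commute)
  qed (use \<nu> La A_ell A_bd A_cont d r \<theta> \<tau> q in auto)
  have cyl: "E.cyl t0 = C" by (simp add: E.cyl_def C_def)
  have v0: "0 \<le> v z" for z unfolding v_def by (rule conv_nonneg[OF \<kappa>(1) u_nonneg])
  have "E.\<Psi>w z = \<Psi> a (v z)" for z
    using \<rho> by (cases "v z \<le> a") (auto simp: E.\<Psi>w_def E.w_def \<Psi>_def max_def G_nonpos_arg divide_nonpos_pos)
  then have 1: "E.I t0 E.\<Psi>w = (\<integral>z. indicator C z * \<Psi> a (conv \<kappa> u z) \<partial>lborel)"
    by (simp add: E.I_def cyl v_def)
  have ev: "E.\<epsilon> z \<le> err (2 * q / \<rho>) \<kappa> z" if "z \<in> C" for z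
  proof -
    have "2 * q / \<rho> * E.w z \<le> 2 * q / \<rho> * v z"
      using a v0[of z] \<rho> by (intro mult_left_mono) (auto simp: E.w_def)
    then have "norm (F z - A (V z)) * (norm (V z) + 2 * q / \<rho> * E.w z) \<le> norm (F z - A (V z)) * (norm (V z) + 2 * q / \<rho> * v z)"
      by (rule mult_left_mono[OF add_left_mono norm_ge_zero])
    moreover have "norm (F z - A (V z)) * (norm (V z) + 2 * q / \<rho> * v z) = err (2 * q / \<rho>) \<kappa> z"
      using V_Q[of z] CQ that by (auto simp: err_def F_def v_def)
    ultimately show ?thesis by (simp only: E.\<epsilon>_def)
  qed
  have er0: "0 \<le> err (2 * q / \<rho>) \<kappa> z" for z
    unfolding err_def using v0 \<rho> by (simp add: v_def)
  have 2: "E.I t0 E.\<epsilon> \<le> (\<integral>z. indicator cylQ z * err (2 * q / \<rho>) \<kappa> z \<partial>lborel)"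
    unfolding E.I_def
  proof (rule integral_mono[OF E.I_int[OF E.conts2(5)] err_int])
    fix z show "indicator (E.cyl t0) z *\<^sub>R E.\<epsilon> z \<le> indicator cylQ z * err (2 * q / \<rho>) \<kappa> z"
      unfolding cyl using ev[of z] er0[of z] CQ by (auto simp: indicator_def)
  qed
  have rhs: "E.rhs \<le> s * \<rho> ^ n * k\<^sup>2" unfolding E.rhs_def 1 using 2 e by linarith
  have "c \<le> E.P z" if "z \<in> N" for z
    using c(4)[of "fst z" "snd z"] that by (simp add: E.P_def E.X_def E.Y_def)
  then have "(\<integral>\<^sup>+z. ennreal (G ((v z - (a + d)) / \<rho>) + (max 0 (v z - (a + d)))\<^sup>2 / \<theta>) * indicator N z \<partial>lborel)
    \<le> ennreal ((2 / c) powr max g1 2 * (gain_const g0 g1 n * level_const \<nu> g1 q * (4 * s / \<omega>) powr (g0 / n)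
        * \<mu> powr (- 2 * (g0 / n) - g1) * (s * \<rho> ^ n * k\<^sup>2)))"
    unfolding \<omega>_def n_def
    by (intro E.truncation_step) (use g0n k c s \<mu> rhs cyl in \<open>auto simp: n_def \<omega>_def\<close>)
  then show ?thesis by (simp add: \<Psi>_def v_def)
qed

text \<open>Young's inequality separates each flux from the factor \<open>b\<close>, taken as
  \<open>norm (conv \<kappa> Du z)\<close> and as \<open>conv \<kappa> u z\<close>; Jensen's
  inequality then moves \<open>G\<close> inside the convolution. The outcome is the mollification of
  one fixed integrable function.\<close>

lemma err_bound:
  assumes \<kappa>: "mollifier r \<kappa>" and c: "0 \<le> c"
  shows "err c \<kappa> z \<le> 2 * La * g1 * (2 + c) * conv \<kappa> (\<lambda>w. G (norm (Du w)) + G (u w)) z"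
proof -
  have g1: "0 < g1" using g0_gt g0_le by simp
  let ?a = "norm (conv \<kappa> Du z)" and ?v = "conv \<kappa> u z"
  let ?GD = "conv \<kappa> (\<lambda>w. G (norm (Du w))) z" and ?GU = "conv \<kappa> (\<lambda>w. G (u w)) z"
  have nD: "integrable lborel (\<lambda>w. norm (Du w))" using Du_int by simp
  have Ga: "G ?a \<le> ?GD"
  proof -
    have "G ?a \<le> G (conv \<kappa> (\<lambda>w. norm (Du w)) z)" by (intro G_mono norm_conv_le[OF \<kappa>])
    also have "\<dots> \<le> ?GD"
      by (rule conv_jensen[OF \<kappa> nD GDu_int]) (use G_support in blast)
    finally show ?thesis .
  qed
  have Gv: "G ?v \<le> ?GU" by (rule conv_jensen[OF \<kappa> u_int Gu_int]) (use G_support in blast)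
  have v0: "0 \<le> ?v" by (rule conv_nonneg[OF \<kappa> u_nonneg])
  have F: "norm (conv \<kappa> (\<lambda>w. A (Du w)) z) * b \<le> La * g1 * (?GD + G b)" if b: "0 \<le> b" for b
  proof -
    have nA: "integrable lborel (\<lambda>w. norm (A (Du w)))" using ADu_int by simp
    have "norm (conv \<kappa> (\<lambda>w. A (Du w)) z) * b \<le> conv \<kappa> (\<lambda>w. norm (A (Du w))) z * b"
      using b by (intro mult_right_mono norm_conv_le[OF \<kappa>])
    also have "\<dots> = (\<integral>w. \<kappa> (z - w) * (0 + b * norm (A (Du w))) \<partial>lborel)"
      using conv_affine(2)[OF \<kappa> nA, of z 0 b] by (simp add: mult.commute)
    also have "\<dots> \<le> (\<integral>w. \<kappa> (z - w) * (La * g1 * G b + La * g1 * G (norm (Du w))) \<partial>lborel)"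
    proof (rule integral_mono[OF conv_affine(1)[OF \<kappa> nA] conv_affine(1)[OF \<kappa> GDu_int]])
      fix w
      have "b * norm (A (Du w)) \<le> b * (La * g (norm (Du w)))" by (intro mult_left_mono A_bd b)
      also have "\<dots> = La * (g (norm (Du w)) * b)" by simp
      also have "\<dots> \<le> La * (g1 * (1 * G (norm (Du w)) + G (b / 1)))"
        using La b by (intro mult_left_mono g_young) auto
      finally have "0 + b * norm (A (Du w)) \<le> La * g1 * G b + La * g1 * G (norm (Du w))" by (simp add: algebra_simps)
      then show "\<kappa> (z - w) * (0 + b * norm (A (Du w))) \<le> \<kappa> (z - w) * (La * g1 * G b + La * g1 * G (norm (Du w)))"
        using \<kappa> unfolding mollifier_def by (intro mult_left_mono) blast+
    qed
    also have "\<dots> = La * g1 * (?GD + G b)" unfolding conv_affine(2)[OF \<kappa> GDu_int] by (simp add: algebra_simps)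
    finally show ?thesis .
  qed
  have AV: "norm (A (conv \<kappa> Du z)) * b \<le> La * g1 * (?GD + G b)" if b: "0 \<le> b" for b
  proof -
    have "norm (A (conv \<kappa> Du z)) * b \<le> La * g ?a * b" by (intro mult_right_mono A_bd b)
    also have "\<dots> = La * (g ?a * b)" by simp
    also have "\<dots> \<le> La * (g1 * (1 * G ?a + G (b / 1)))" using La b by (intro mult_left_mono g_young) auto
    also have "\<dots> \<le> La * (g1 * (1 * ?GD + G (b / 1)))" using La g1 Ga by (intro mult_left_mono add_mono) auto
    finally show ?thesis by simp
  qed
  have R: "norm (conv \<kappa> (\<lambda>w. A (Du w)) z - A (conv \<kappa> Du z)) * b \<le> 2 * La * g1 * (?GD + G b)" if b: "0 \<le> b" for b
  proof -
    have "norm (conv \<kappa> (\<lambda>w. A (Du w)) z - A (conv \<kappa> Du z)) * b \<le>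
        (norm (conv \<kappa> (\<lambda>w. A (Du w)) z) + norm (A (conv \<kappa> Du z))) * b"
      by (intro mult_right_mono norm_triangle_ineq4 b)
    then show ?thesis using F[OF b] AV[OF b] by (simp add: algebra_simps)
  qed
  have GU0: "0 \<le> ?GU" "0 \<le> ?GD" by (auto intro: conv_nonneg[OF \<kappa>])
  have K: "0 \<le> 2 * La * g1" using La g1 by simp
  have "err c \<kappa> z = norm (conv \<kappa> (\<lambda>w. A (Du w)) z - A (conv \<kappa> Du z)) * ?a + c * (norm (conv \<kappa> (\<lambda>w. A (Du w)) z - A (conv \<kappa> Du z)) * ?v)"
    by (simp add: err_def algebra_simps)
  also have "\<dots> \<le> 2 * La * g1 * (?GD + G ?a) + c * (2 * La * g1 * (?GD + G ?v))"
    using c v0 by (intro add_mono mult_left_mono R) auto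
  also have "\<dots> \<le> 2 * La * g1 * (?GD + ?GD) + c * (2 * La * g1 * (?GD + ?GU))"
    using c K Ga Gv by (intro add_mono mult_left_mono) auto
  also have "\<dots> = 2 * La * g1 * (2 * ?GD + c * (?GD + ?GU))" by (simp add: algebra_simps)
  also have "\<dots> \<le> 2 * La * g1 * ((2 + c) * (?GD + ?GU))"
    using K GU0 by (intro mult_left_mono) (auto simp: algebra_simps)
  finally show ?thesis unfolding conv_add[OF \<kappa> GDu_int Gu_int] by (simp add: mult.assoc)
qed

text \<open>The three mollification errors are summed before a subsequence is extracted from their
  L^1 convergence, so the same subsequence converges almost everywhere for all three. The
  denominator \<open>m + 2\<close> keeps every radius strictly below
  \<open>\<delta>\<close>.\<close>

lemma mollifiers_exist:
  obtains \<kappa> r where "\<And>m::nat. mollifier (r m) (\<kappa> m)" "\<And>m. r m < \<delta>" "r \<longlonglongrightarrow> 0"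
    "AE z in lborel. (\<lambda>m. conv (\<kappa> m) u z) \<longlonglongrightarrow> u z"
    "AE z in lborel. (\<lambda>m. conv (\<kappa> m) Du z) \<longlonglongrightarrow> Du z"
    "AE z in lborel. (\<lambda>m. conv (\<kappa> m) (\<lambda>w. A (Du w)) z) \<longlonglongrightarrow> A (Du z)"
proof -
  define r where "r m = \<delta> / real (Suc (Suc m))" for m
  have r: "0 < r m" "r m < \<delta>" for m using \<delta> by (auto simp: r_def field_simps add_pos_nonneg)
  have r0: "r \<longlonglongrightarrow> 0"
  proof -
    have "(\<lambda>m. \<delta> * (1 / real (Suc (Suc m)))) \<longlonglongrightarrow> \<delta> * 0"
      by (intro tendsto_intros LIMSEQ_Suc[OF LIMSEQ_Suc[OF lim_1_over_n]])
    then show ?thesis by (simp add: r_def[abs_def])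
  qed
  have "\<exists>\<kappa> :: (real ^ 'n) \<times> real \<Rightarrow> real. mollifier (r m) \<kappa>" for m by (rule mollifier_exists[OF r(1)])
  then obtain \<kappa> :: "nat \<Rightarrow> (real ^ 'n) \<times> real \<Rightarrow> real" where \<kappa>: "\<And>m. mollifier (r m) (\<kappa> m)" by metis
  define U where "U m z = norm (conv (\<kappa> m) u z - u z) + norm (conv (\<kappa> m) Du z - Du z)
      + norm (conv (\<kappa> m) (\<lambda>w. A (Du w)) z - A (Du z))" for m z
  have i: "integrable lborel (\<lambda>z. norm (conv (\<kappa> m) f z - f z))" if "integrable lborel f" for m and f :: "_ \<Rightarrow> 'b::euclidean_space"
    by (intro integrable_norm Bochner_Integration.integrable_diff conv_integrable_lborel[OF \<kappa>] that)
  have iU: "integrable lborel (U m)" for m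
    unfolding U_def by (intro Bochner_Integration.integrable_add i u_int Du_int ADu_int)
  have "(\<lambda>m. \<integral>z. norm (U m z) \<partial>lborel) \<longlonglongrightarrow> 0"
  proof -
    have "(\<integral>z. norm (U m z) \<partial>lborel) = (\<integral>z. norm (conv (\<kappa> m) u z - u z) \<partial>lborel) + (\<integral>z. norm (conv (\<kappa> m) Du z - Du z) \<partial>lborel)
        + (\<integral>z. norm (conv (\<kappa> m) (\<lambda>w. A (Du w)) z - A (Du z)) \<partial>lborel)" for m
    proof -
      have "norm (U m z) = U m z" for z by (simp add: U_def)
      then show ?thesis
        using i[OF u_int, of m] i[OF Du_int, of m] i[OF ADu_int, of m] by (simp add: U_def)
    qed
    moreover have "(\<lambda>m. (\<integral>z. norm (conv (\<kappa> m) u z - u z) \<partial>lborel) + (\<integral>z. norm (conv (\<kappa> m) Du z - Du z) \<partial>lborel)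
        + (\<integral>z. norm (conv (\<kappa> m) (\<lambda>w. A (Du w)) z - A (Du z)) \<partial>lborel)) \<longlonglongrightarrow> 0 + 0 + 0"
      by (intro tendsto_add conv_tendsto_L1[OF \<kappa> r0] u_int Du_int ADu_int)
    ultimately show ?thesis by simp
  qed
  from tendsto_L1_AE_subseq[OF iU this] obtain p :: "nat \<Rightarrow> nat" where p: "strict_mono p"
    "AE z in lborel. (\<lambda>m. U (p m) z) \<longlonglongrightarrow> 0" by blast
  have lim: "(\<lambda>m. conv (\<kappa> (p m)) f z) \<longlonglongrightarrow> f z"
    if "(\<lambda>m. U (p m) z) \<longlonglongrightarrow> 0" "\<And>m. norm (conv (\<kappa> m) f z - f z) \<le> U m z" for f :: "_ \<Rightarrow> 'b::euclidean_space" and z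
  proof -
    have "(\<lambda>m. conv (\<kappa> (p m)) f z - f z) \<longlonglongrightarrow> 0"
      by (rule Lim_null_comparison[OF always_eventually that(1)]) (use that(2) in auto)
    then show ?thesis by (rule LIM_zero_cancel)
  qed
  show ?thesis
  proof (rule that[of "\<lambda>m. r (p m)" "\<lambda>m. \<kappa> (p m)"])
    show "mollifier (r (p m)) (\<kappa> (p m))" "r (p m) < \<delta>" for m using \<kappa> r by auto
    show "(\<lambda>m. r (p m)) \<longlonglongrightarrow> 0" using LIMSEQ_subseq_LIMSEQ[OF r0 p(1)] by (simp add: comp_def)
    show "AE z in lborel. (\<lambda>m. conv (\<kappa> (p m)) u z) \<longlonglongrightarrow> u z"
      using p(2) by eventually_elim (rule lim, auto simp: U_def)
    show "AE z in lborel. (\<lambda>m. conv (\<kappa> (p m)) Du z) \<longlonglongrightarrow> Du z"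
      using p(2) by eventually_elim (rule lim, auto simp: U_def)
    show "AE z in lborel. (\<lambda>m. conv (\<kappa> (p m)) (\<lambda>w. A (Du w)) z) \<longlonglongrightarrow> A (Du z)"
      using p(2) by eventually_elim (rule lim, auto simp: U_def)
  qed
qed

section \<open>Vanishing of the flux error and passage to the limit\<close>

lemma err_cont: "mollifier r \<kappa> \<Longrightarrow> continuous_on UNIV (err c \<kappa>)"
  unfolding err_def
  by (intro continuous_intros continuous_on_compose2[OF A_cont] conv_continuous[OF mollifier_kernel] u_int Du_int ADu_int) auto

lemma cylQ_compact: "compact cylQ"
  by (intro compact_Times compact_cball compact_Icc)

lemma err_int: "mollifier r \<kappa> \<Longrightarrow> integrable lborel (\<lambda>z. indicator cylQ z * err c \<kappa> z)"
  using borel_integrable_compact[OF cylQ_compact continuous_on_subset[OF err_cont subset_UNIV]] by simp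

text \<open>The pointwise limit is zero because \<open>A\<close> is continuous, so both fluxes tend
  to \<open>A (Du z)\<close>; the majorants from the pointwise bound vary with \<open>m\<close> but
  converge in L^1.\<close>

lemma err_tendsto:
  assumes \<kappa>: "\<And>m::nat. mollifier (r m) (\<kappa> m)" and r: "r \<longlonglongrightarrow> 0" and c: "0 \<le> c"
    and u: "AE z in lborel. (\<lambda>m. conv (\<kappa> m) u z) \<longlonglongrightarrow> u z"
    and Du: "AE z in lborel. (\<lambda>m. conv (\<kappa> m) Du z) \<longlonglongrightarrow> Du z"
    and ADu: "AE z in lborel. (\<lambda>m. conv (\<kappa> m) (\<lambda>w. A (Du w)) z) \<longlonglongrightarrow> A (Du z)"
  shows "(\<lambda>m. \<integral>z. indicator cylQ z * err c (\<kappa> m) z \<partial>lborel) \<longlonglongrightarrow> 0"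
proof -
  let ?h = "\<lambda>w. G (norm (Du w)) + G (u w)"
  define K where "K = 2 * La * g1 * (2 + c)"
  have K: "0 \<le> K" using La g0_gt g0_le c by (simp add: K_def)
  have h: "integrable lborel ?h" using GDu_int Gu_int by simp
  show ?thesis
  proof (rule L1_dominated_limit[where Z = "\<lambda>m z. K * conv (\<kappa> m) ?h z" and ?Z0.0 = "\<lambda>z. K * ?h z"])
    show "(\<lambda>z. indicator cylQ z * err c (\<kappa> m) z) \<in> borel_measurable lborel" for m
      using err_int[OF \<kappa>] by (rule borel_measurable_integrable)
    show "integrable lborel (\<lambda>z. K * conv (\<kappa> m) ?h z)" for m
      by (intro integrable_mult_right conv_integrable_lborel[OF \<kappa> h])
    show "integrable lborel (\<lambda>z. K * ?h z)" using h by (rule integrable_mult_right)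
    show "AE z in lborel. 0 \<le> indicator cylQ z * err c (\<kappa> m) z \<and> indicator cylQ z * err c (\<kappa> m) z \<le> K * conv (\<kappa> m) ?h z" for m
    proof (rule AE_I2)
      fix z
      have e0: "0 \<le> err c (\<kappa> m) z"
        unfolding err_def by (intro mult_nonneg_nonneg add_nonneg_nonneg norm_ge_zero c conv_nonneg[OF \<kappa> u_nonneg])
      moreover have "err c (\<kappa> m) z \<le> K * conv (\<kappa> m) ?h z" unfolding K_def by (rule err_bound[OF \<kappa> c])
      ultimately show "0 \<le> indicator cylQ z * err c (\<kappa> m) z \<and> indicator cylQ z * err c (\<kappa> m) z \<le> K * conv (\<kappa> m) ?h z"
        by (auto simp: indicator_def)
    qed
    show "AE z in lborel. (\<lambda>m. indicator cylQ z * err c (\<kappa> m) z) \<longlonglongrightarrow> 0"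
      using u Du ADu
    proof eventually_elim
      case (elim z)
      have "(\<lambda>m. A (conv (\<kappa> m) Du z)) \<longlonglongrightarrow> A (Du z)"
        by (rule continuous_on_tendsto_compose[OF A_cont elim(2)]) auto
      then have "(\<lambda>m. indicator cylQ z * (norm (conv (\<kappa> m) (\<lambda>w. A (Du w)) z - A (conv (\<kappa> m) Du z)) * (norm (conv (\<kappa> m) Du z) + c * conv (\<kappa> m) u z)))
          \<longlonglongrightarrow> indicator cylQ z * (norm (A (Du z) - A (Du z)) * (norm (Du z) + c * u z))"
        by (intro tendsto_intros elim)
      then show ?case by (simp add: err_def)
    qed
    have "(\<lambda>m. K * (\<integral>z. norm (conv (\<kappa> m) ?h z - ?h z) \<partial>lborel)) \<longlonglongrightarrow> K * 0"
      by (intro tendsto_intros conv_tendsto_L1[OF \<kappa> r h])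
    then show "(\<lambda>m. \<integral>z. norm (K * conv (\<kappa> m) ?h z - K * ?h z) \<partial>lborel) \<longlonglongrightarrow> 0"
      using K by (simp add: right_diff_distrib[symmetric] abs_mult)
  qed
qed

text \<open>The strict inequality assumed for \<open>b\<close> leaves room for the two error terms,
  so the mollified estimate applies for all large \<open>m\<close>; Fatou's lemma carries it over to
  \<open>u\<close>.\<close>

lemma subsolution_step:
  fixes N :: "((real ^ 'n) \<times> real) set" and k c s \<mu> a d r \<tau>0 b :: real and q :: nat
  defines "\<omega> \<equiv> measure lborel (ball (0 :: real ^ 'n) 1)" and "n \<equiv> CARD('n)" and "C \<equiv> cball x0 r \<times> {\<tau>0..t0}"
  assumes a: "0 \<le> a" and d: "0 < d" and r: "0 < r" "r \<le> \<rho>"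
    and \<tau>: "\<tau>0 < t0" "t0 - \<tau>0 \<le> \<theta>" and q: "2 \<le> q" "g1 \<le> q" and g0n: "2 * real n / (real n + 2) < g0"
    and k: "0 < k" "\<theta> = k\<^sup>2 * inverse (G (k / \<rho>))" "d \<le> k"
    and c: "0 < c" "c \<le> 1" "N \<subseteq> C" "N \<in> sets borel"
    "\<And>x t. (x, t) \<in> N \<Longrightarrow> c \<le> (max 0 ((r\<^sup>2 - (x - x0) \<bullet> (x - x0)) / \<rho>\<^sup>2)) ^ q * (max 0 ((t - \<tau>0) / \<theta>)) ^ q"
    and s: "0 < s" "4 * s \<le> \<omega> * \<mu>\<^sup>2" and \<mu>: "\<mu> = c * d / (4 * k)"
    and b: "(\<integral>\<^sup>+z. ennreal (\<Psi> a (u z)) * indicator C z \<partial>lborel) \<le> ennreal b" "0 \<le> b"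
    "energy_const \<nu> La g1 q * b < s * \<rho> ^ n * k\<^sup>2"
  shows "(\<integral>\<^sup>+z. ennreal (\<Psi> (a + d) (u z)) * indicator N z \<partial>lborel)
    \<le> ennreal ((2 / c) powr max g1 2 * (gain_const g0 g1 n * level_const \<nu> g1 q * (4 * s / \<omega>) powr (g0 / n)
        * \<mu> powr (- 2 * (g0 / n) - g1) * (s * \<rho> ^ n * k\<^sup>2)))"
proof -
  define E where "E = energy_const \<nu> La g1 q"
  have g1: "0 < g1" using g0_gt g0_le by simp
  have E: "0 \<le> E" using La g1 by (simp add: E_def energy_const_def)
  obtain \<kappa> r' where \<kappa>: "\<And>m::nat. mollifier (r' m) (\<kappa> m)" "\<And>m. r' m < \<delta>" "r' \<longlonglongrightarrow> 0"
    and lim: "AE z in lborel. (\<lambda>m. conv (\<kappa> m) u z) \<longlonglongrightarrow> u z"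
    "AE z in lborel. (\<lambda>m. conv (\<kappa> m) Du z) \<longlonglongrightarrow> Du z"
    "AE z in lborel. (\<lambda>m. conv (\<kappa> m) (\<lambda>w. A (Du w)) z) \<longlonglongrightarrow> A (Du z)"
    by (rule mollifiers_exist) blast
  have Cc: "compact C" unfolding C_def by (intro compact_Times compact_cball compact_Icc)
  then have [measurable]: "C \<in> sets borel" by (rule borel_compact)
  have [measurable]: "u \<in> borel_measurable borel" using u_int by auto
  have vm: "conv (\<kappa> m) u \<in> borel_measurable borel" for m
    by (rule borel_measurable_continuous_onI[OF conv_continuous[OF mollifier_kernel[OF \<kappa>(1)] u_int]])
  let ?D = "\<lambda>m. \<integral>z. norm (conv (\<kappa> m) (\<lambda>w. \<Psi> a (u w)) z - \<Psi> a (u z)) \<partial>lborel"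
  have iC: "integrable lborel (\<lambda>z. indicator C z * \<Psi> a (u z))"
    by (rule Bochner_Integration.integrable_bound[OF \<Psi>_int[OF a]]) (auto simp: indicator_def)
  have uC: "(\<integral>z. indicator C z * \<Psi> a (u z) \<partial>lborel) \<le> b"
  proof -
    have "ennreal (\<integral>z. indicator C z * \<Psi> a (u z) \<partial>lborel) = (\<integral>\<^sup>+z. ennreal (indicator C z * \<Psi> a (u z)) \<partial>lborel)"
      using \<Psi>_nonneg by (subst nn_integral_eq_integral[OF iC]) auto
    also have "\<dots> = (\<integral>\<^sup>+z. ennreal (\<Psi> a (u z)) * indicator C z \<partial>lborel)"
      by (intro nn_integral_cong) (auto simp: indicator_def)
    also have "\<dots> \<le> ennreal b" by (rule b(1))
    finally show ?thesis using b(2) by simp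
  qed
  \<comment> \<open>Jensen's inequality bounds the excess of the mollified function by the mollified
    excess, which differs from the excess of \<open>u\<close> by an L^1 error tending to
    zero.\<close>
  have J: "(\<integral>z. indicator C z * \<Psi> a (conv (\<kappa> m) u z) \<partial>lborel) \<le> b + ?D m" for m
  proof -
    have i1: "integrable lborel (\<lambda>z. norm (conv (\<kappa> m) (\<lambda>w. \<Psi> a (u w)) z - \<Psi> a (u z)))"
      by (intro integrable_norm Bochner_Integration.integrable_diff conv_integrable_lborel[OF \<kappa>(1)] \<Psi>_int a)
    have "(\<integral>z. indicator C z * \<Psi> a (conv (\<kappa> m) u z) \<partial>lborel) \<le>
        (\<integral>z. indicator C z * \<Psi> a (u z) + norm (conv (\<kappa> m) (\<lambda>w. \<Psi> a (u w)) z - \<Psi> a (u z)) \<partial>lborel)"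
    proof (rule integral_mono)
      have "continuous_on C (\<lambda>z. \<Psi> a (conv (\<kappa> m) u z))"
        by (rule continuous_on_compose2[OF \<Psi>_cont[of UNIV] conv_continuous[OF mollifier_kernel[OF \<kappa>(1)] u_int]]) auto
      from borel_integrable_compact[OF Cc this]
      show "integrable lborel (\<lambda>z. indicator C z * \<Psi> a (conv (\<kappa> m) u z))" by simp
      show "integrable lborel (\<lambda>z. indicator C z * \<Psi> a (u z) + norm (conv (\<kappa> m) (\<lambda>w. \<Psi> a (u w)) z - \<Psi> a (u z)))"
        using iC i1 by simp
      fix z
      have "\<Psi> a (conv (\<kappa> m) u z) \<le> conv (\<kappa> m) (\<lambda>w. \<Psi> a (u w)) z"
        by (rule conv_jensen[OF \<kappa>(1) u_int \<Psi>_int[OF a] \<Psi>_support])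
      then show "indicator C z * \<Psi> a (conv (\<kappa> m) u z) \<le>
          indicator C z * \<Psi> a (u z) + norm (conv (\<kappa> m) (\<lambda>w. \<Psi> a (u w)) z - \<Psi> a (u z))"
        by (auto simp: indicator_def)
    qed
    also have "\<dots> = (\<integral>z. indicator C z * \<Psi> a (u z) \<partial>lborel) + ?D m" using iC i1 by simp
    finally show ?thesis using uC by linarith
  qed
  let ?e = "\<lambda>m. \<integral>z. indicator cylQ z * err (2 * q / \<rho>) (\<kappa> m) z \<partial>lborel"
  have "(\<lambda>m. E * (b + ?D m) + ?e m) \<longlonglongrightarrow> E * (b + 0) + 0"
    using \<rho> by (intro tendsto_intros conv_tendsto_L1[OF \<kappa>(1,3) \<Psi>_int[OF a]] err_tendsto[OF \<kappa>(1,3) _ lim]) auto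
  then have "eventually (\<lambda>m. E * (b + ?D m) + ?e m < s * \<rho> ^ n * k\<^sup>2) sequentially"
    by (rule order_tendstoD(2)) (use b(3) in \<open>simp add: E_def\<close>)
  then have ev: "eventually (\<lambda>m. (\<integral>\<^sup>+z. ennreal (\<Psi> (a + d) (conv (\<kappa> m) u z)) * indicator N z \<partial>lborel)
    \<le> ennreal ((2 / c) powr max g1 2 * (gain_const g0 g1 n * level_const \<nu> g1 q * (4 * s / \<omega>) powr (g0 / n)
        * \<mu> powr (- 2 * (g0 / n) - g1) * (s * \<rho> ^ n * k\<^sup>2)))) sequentially"
  proof eventually_elim
    case (elim m)
    have "E * (\<integral>z. indicator C z * \<Psi> a (conv (\<kappa> m) u z) \<partial>lborel) \<le> E * (b + ?D m)"
      by (rule mult_left_mono[OF J E])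
    then have le: "E * (\<integral>z. indicator C z * \<Psi> a (conv (\<kappa> m) u z) \<partial>lborel) + ?e m \<le> s * \<rho> ^ n * k\<^sup>2"
      using elim by linarith
    show ?case
      unfolding \<omega>_def n_def
      by (rule mollified_step[OF \<kappa>(1,2) a d r \<tau> q g0n[unfolded n_def] k c(1,2) c(3)[unfolded C_def] c(5) s(1) s(2)[unfolded \<omega>_def] \<mu>
            le[unfolded E_def C_def n_def] err_int[OF \<kappa>(1)]])
  qed
  show ?thesis
  proof (rule nn_integral_le_limit[OF _ _ ev])
    show "(\<lambda>z. ennreal (\<Psi> (a + d) (conv (\<kappa> m) u z)) * indicator N z) \<in> borel_measurable lborel" for m
      using vm[of m] c(4) by measurable
    show "AE z in lborel. (\<lambda>m. ennreal (\<Psi> (a + d) (conv (\<kappa> m) u z)) * indicator N z) \<longlonglongrightarrow> ennreal (\<Psi> (a + d) (u z)) * indicator N z"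
      using lim(1)
    proof eventually_elim
      case (elim z)
      have "(\<lambda>m. \<Psi> (a + d) (conv (\<kappa> m) u z)) \<longlonglongrightarrow> \<Psi> (a + d) (u z)"
        by (rule continuous_on_tendsto_compose[OF \<Psi>_cont[of UNIV] elim]) auto
      then show ?case by (cases "z \<in> N") (auto intro!: tendsto_ennrealI)
    qed
  qed
qed

end

subsection \<open>The De Giorgi iteration\<close>

text \<open>
  \<open>cut_size q j\<close> is the lower bound on the next cylinder for the cutoff of step \<open>j\<close>, and \<open>gap_size q j\<close>
  is the relative height \<open>\<mu>\<close> in \<open>truncation_step\<close> for consecutive levels \<open>k (1 - 2\<^sup>-\<^sup>j)\<close>.
\<close>

definition cut_size :: "nat \<Rightarrow> nat \<Rightarrow> real" where "cut_size q j = (1 / 2) ^ ((2 * j + 4) * q)"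
definition gap_size :: "nat \<Rightarrow> nat \<Rightarrow> real" where "gap_size q j = (1 / 2) ^ ((2 * j + 4) * q + j + 3)"

text \<open>\<open>cut_size\<close> and \<open>gap_size\<close> are geometric in \<open>j\<close>,
  so the step inequality splits into a part independent of \<open>j\<close> and a ratio raised to
  the power \<open>j\<close>. It holds once \<open>b * R powr \<alpha> <= 1\<close> and
  \<open>M * \<sigma> powr \<alpha> <= R\<close>; \<open>R\<close> is fixed first and
  \<open>\<sigma>\<close> afterwards.\<close>

lemma iteration_constants:
  fixes \<alpha> E K m p :: real and q :: nat
  assumes \<alpha>: "0 < \<alpha>" and E: "0 < E" and K: "0 < K"
  shows "\<exists>\<sigma> R. 0 < \<sigma> \<and> \<sigma> < 1 \<and> 0 < R \<and> R < 1 \<and>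
    (\<forall>j. 8 * E * \<sigma> * R ^ j \<le> (gap_size q j)\<^sup>2) \<and>
    (\<forall>j. (2 / cut_size q j) powr m * (K * (8 * E * \<sigma> * R ^ j) powr \<alpha> * gap_size q j powr (- p) * (2 * E * \<sigma> * R ^ j)) \<le> \<sigma> * R ^ Suc j)"
proof -
  \<comment> \<open>Local names: initial values and ratios of \<open>cut_size\<close> and
    \<open>gap_size\<close>. Here \<open>g0\<close> and \<open>g1\<close> are not the growth
    exponents.\<close>
  define c0 c1 g0 g1 :: real where "c0 = (1 / 2) ^ (4 * q)" and "c1 = (1 / 2) ^ (2 * q)"
    and "g0 = (1 / 2) ^ (4 * q + 3)" and "g1 = (1 / 2) ^ (2 * q + 1)"
  have pos: "0 < c0" "0 < c1" "0 < g0" "0 < g1" by (auto simp: c0_def c1_def g0_def g1_def)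
  have cut: "cut_size q j = c0 * c1 ^ j" for j
    by (simp add: cut_size_def c0_def c1_def power_add[symmetric] power_mult[symmetric] algebra_simps)
  have gap: "gap_size q j = g0 * g1 ^ j" for j
    unfolding gap_size_def g0_def g1_def power_mult[symmetric] power_add[symmetric] by (simp add: algebra_simps)
  define b where "b = (1 / c1) powr m * g1 powr (- p)"
  define M where "M = (2 / c0) powr m * K * (8 * E) powr \<alpha> * g0 powr (- p) * (2 * E)"
  have b: "0 < b" using pos by (simp add: b_def)
  have M: "0 < M" using pos E K by (simp add: M_def)
  \<comment> \<open>The second bound keeps the ratio of successive step factors at most 1; the third
    lets \<open>R^j\<close> decay at least as fast as the square of \<open>gap_size\<close>.\<close>
  define R where "R = min (1 / 2) (min ((1 / b) powr (1 / \<alpha>)) (g1\<^sup>2))"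
  define \<sigma> where "\<sigma> = min (1 / 2) (min ((R / M) powr (1 / \<alpha>)) (g0\<^sup>2 / (8 * E)))"
  have R: "0 < R" "R < 1" "R \<le> g1\<^sup>2" using pos b by (auto simp: R_def)
  have \<sigma>: "0 < \<sigma>" "\<sigma> < 1" "8 * E * \<sigma> \<le> g0\<^sup>2"
  proof -
    show "0 < \<sigma>" "\<sigma> < 1" using pos R M E by (auto simp: \<sigma>_def)
    have "\<sigma> \<le> g0\<^sup>2 / (8 * E)" by (simp add: \<sigma>_def)
    then show "8 * E * \<sigma> \<le> g0\<^sup>2" using E by (simp add: field_simps)
  qed
  have Rb: "b * R powr \<alpha> \<le> 1"
  proof -
    have "R powr \<alpha> \<le> ((1 / b) powr (1 / \<alpha>)) powr \<alpha>" using R \<alpha> by (intro powr_mono2) (auto simp: R_def)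
    also have "\<dots> = 1 / b" using \<alpha> b by (simp add: powr_powr)
    finally show ?thesis using b by (simp add: field_simps)
  qed
  have \<sigma>M: "M * \<sigma> powr \<alpha> \<le> R"
  proof -
    have "\<sigma> powr \<alpha> \<le> ((R / M) powr (1 / \<alpha>)) powr \<alpha>" using \<sigma> \<alpha> by (intro powr_mono2) (auto simp: \<sigma>_def)
    also have "\<dots> = R / M" using \<alpha> M R by (simp add: powr_powr)
    finally show ?thesis using M by (simp add: field_simps)
  qed
  have powr_pow: "(x ^ j) powr y = (x powr y) ^ j" if "0 < x" for x y :: real and j
    using that by (simp add: powr_realpow[symmetric] powr_powr mult.commute)
  show ?thesis
  proof (rule exI[of _ \<sigma>], rule exI[of _ R], intro conjI allI)
    fix j
    have "8 * E * \<sigma> * R ^ j \<le> g0\<^sup>2 * (g1\<^sup>2) ^ j"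
      using R \<sigma> E by (intro mult_mono power_mono) auto
    also have "\<dots> = (gap_size q j)\<^sup>2" by (simp add: gap power_mult_distrib power_mult[symmetric] mult.commute)
    finally show "8 * E * \<sigma> * R ^ j \<le> (gap_size q j)\<^sup>2" .
    have e1: "(2 / cut_size q j) powr m = (2 / c0) powr m * ((1 / c1) powr m) ^ j"
    proof -
      have "2 / cut_size q j = (2 / c0) * (1 / c1) ^ j" by (simp add: cut power_divide)
      moreover have "((2 / c0) * (1 / c1) ^ j) powr m = (2 / c0) powr m * ((1 / c1) ^ j) powr m"
        by (rule powr_mult)
      moreover have "((1 / c1) ^ j) powr m = ((1 / c1) powr m) ^ j" using pos by (intro powr_pow) auto
      ultimately show ?thesis by (simp only:)
    qed
    have e2: "(8 * E * \<sigma> * R ^ j) powr \<alpha> = (8 * E) powr \<alpha> * \<sigma> powr \<alpha> * (R powr \<alpha>) ^ j"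
      using E \<sigma> R by (simp add: powr_mult powr_pow)
    have e3: "gap_size q j powr (- p) = g0 powr (- p) * (g1 powr (- p)) ^ j"
      using pos by (simp add: gap powr_mult powr_pow)
    have "(2 / cut_size q j) powr m * (K * (8 * E * \<sigma> * R ^ j) powr \<alpha> * gap_size q j powr (- p) * (2 * E * \<sigma> * R ^ j))
        = (M * \<sigma> powr \<alpha>) * (b * R powr \<alpha>) ^ j * (\<sigma> * R ^ j)"
      unfolding e1 e2 e3 M_def b_def power_mult_distrib by (simp only: ac_simps)
    also have "\<dots> \<le> R * 1 * (\<sigma> * R ^ j)"
      using \<sigma>M Rb \<sigma> R b M by (intro mult_mono power_le_one) auto
    finally show "(2 / cut_size q j) powr m * (K * (8 * E * \<sigma> * R ^ j) powr \<alpha> * gap_size q j powr (- p) * (2 * E * \<sigma> * R ^ j)) \<le> \<sigma> * R ^ Suc j"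
      by (simp add: mult.left_commute)
  qed (use \<sigma> R in auto)
qed

context regularized
begin

text \<open>The induction maintains that the excess over level \<open>kk j\<close> on
  \<open>Q j\<close> is at most \<open>\<sigma> * R^j\<close> times the unit
  \<open>\<omega> * \<rho>^n * k^2\<close>. The hypotheses on \<open>\<sigma>\<close> and
  \<open>R\<close> say precisely that one truncation step preserves this decay.\<close>

lemma de_giorgi_iteration:
  fixes k \<sigma> R :: real and q :: nat
  defines "\<omega> \<equiv> measure lborel (ball (0 :: real ^ 'n) 1)" and "n \<equiv> CARD('n)" and "E \<equiv> energy_const \<nu> La g1 q"
  assumes q: "2 \<le> q" "g1 \<le> q" and g0n: "2 * real n / (real n + 2) < g0"
    and k: "0 < k" "\<theta> = k\<^sup>2 * inverse (G (k / \<rho>))"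
    and \<sigma>: "0 < \<sigma>" and R: "0 < R" "R < 1"
    and c1: "\<And>j. 8 * E * \<sigma> * R ^ j \<le> (gap_size q j)\<^sup>2"
    and c2: "\<And>j. (2 / cut_size q j) powr max g1 2 * ((gain_const g0 g1 n * level_const \<nu> g1 q) * (8 * E * \<sigma> * R ^ j) powr (g0 / n)
      * gap_size q j powr (- (2 * (g0 / n) + g1)) * (2 * E * \<sigma> * R ^ j)) \<le> \<sigma> * R ^ Suc j"
    and init: "(\<integral>\<^sup>+z. ennreal (\<Psi> 0 (u z)) * indicator cylQ z \<partial>lborel) \<le> ennreal (\<sigma> * \<omega> * \<rho> ^ n * k\<^sup>2)"
  shows "AE z in lborel. z \<in> cball x0 (\<rho> / 2) \<times> {t0 - \<theta> / 2..t0} \<longrightarrow> u z \<le> k"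
proof -
  \<comment> \<open>Relative size of the cylinders: \<open>p 0 = 1\<close> is the full one, the
    limit is one half, and consecutive values differ by \<open>(1/2)^(j + 2)\<close>.\<close>
  define p :: "nat \<Rightarrow> real" where "p j = 1 / 2 + (1 / 2) ^ Suc j" for j :: nat
  define Q where "Q j = cball x0 (\<rho> * p j) \<times> {t0 - \<theta> * p j..t0}" for j
  define kk where "kk j = k * (1 - (1 / 2) ^ j)" for j :: nat
  have \<omega>: "0 < \<omega>" unfolding \<omega>_def using content_ball_pos[of 1 "0 :: real ^ 'n"] by simp
  have g1: "0 < g1" using g0_gt g0_le by simp
  have E: "1 \<le> E" using La g1 by (simp add: E_def energy_const_def)
  have p: "1 / 2 < p j" "p j \<le> 1" "p j - p (Suc j) = (1 / 2) ^ (j + 2)" for j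
    using power_le_one[of "1 / 2 :: real" j] by (auto simp: p_def)
  have Q_meas: "Q j \<in> sets borel" for j
    unfolding Q_def by (intro borel_compact compact_Times compact_cball compact_Icc)
  have main: "(\<integral>\<^sup>+z. ennreal (\<Psi> (kk j) (u z)) * indicator (Q j) z \<partial>lborel) \<le> ennreal (\<sigma> * \<omega> * R ^ j * \<rho> ^ n * k\<^sup>2)" for j
  proof (induction j)
    case 0
    then show ?case using init by (simp add: kk_def Q_def p_def)
  next
    case (Suc j)
    define d where "d = k * (1 / 2) ^ Suc j"
    \<comment> \<open>The factor 2 turns the energy bound \<open>E * b\<close> into a strict
      inequality, leaving room for the mollification error.\<close>
    define s where "s = 2 * E * \<sigma> * \<omega> * R ^ j"
    have kS: "kk (Suc j) = kk j + d" by (simp add: kk_def d_def algebra_simps)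
    have d: "0 < d" "d \<le> k"
      using k power_le_one[of "1 / 2 :: real" "Suc j"] unfolding d_def by (auto intro!: mult_left_le simp del: power_Suc)
    have s: "0 < s" using E \<sigma> \<omega> R by (simp add: s_def)
    \<comment> \<open>\<open>d / (4 k)\<close> equals \<open>(1/2)^(j + 3)\<close>, which explains
      the extra exponent in \<open>gap_size\<close>.\<close>
    have gap: "gap_size q j = cut_size q j * d / (4 * k)"
      using k by (simp add: gap_size_def cut_size_def d_def power_add power3_eq_cube field_simps)
    have step: "(\<integral>\<^sup>+z. ennreal (\<Psi> (kk j + d) (u z)) * indicator (Q (Suc j)) z \<partial>lborel)
      \<le> ennreal ((2 / cut_size q j) powr max g1 2 * (gain_const g0 g1 n * level_const \<nu> g1 q * (4 * s / \<omega>) powr (g0 / n)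
        * gap_size q j powr (- 2 * (g0 / n) - g1) * (s * \<rho> ^ n * k\<^sup>2)))"
      unfolding \<omega>_def n_def
    proof (rule subsolution_step[where r = "\<rho> * p j" and ?\<tau>0.0 = "t0 - \<theta> * p j" and b = "\<sigma> * \<omega> * R ^ j * \<rho> ^ n * k\<^sup>2", OF _ d(1)])
      show "0 \<le> kk j" using k by (simp add: kk_def power_le_one)
      show "0 < \<rho> * p j" "\<rho> * p j \<le> \<rho>" using \<rho> p[of j] by (auto intro!: mult_left_le mult_pos_pos)
      show "t0 - \<theta> * p j < t0" "t0 - (t0 - \<theta> * p j) \<le> \<theta>" using \<theta> p[of j] by (auto intro!: mult_left_le mult_pos_pos)
      show "2 * real CARD('n) / (real CARD('n) + 2) < g0" using g0n by (simp add: n_def)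
      show "0 < cut_size q j" "cut_size q j \<le> 1" by (auto simp: cut_size_def power_le_one)
      have pm: "p (Suc j) \<le> p j" using p(3)[of j] zero_le_power[of "1 / 2 :: real" "j + 2"] by linarith
      have "\<rho> * p (Suc j) \<le> \<rho> * p j" "\<theta> * p (Suc j) \<le> \<theta> * p j" using \<rho> \<theta> pm by (auto intro!: mult_left_mono)
      then show "Q (Suc j) \<subseteq> cball x0 (\<rho> * p j) \<times> {t0 - \<theta> * p j..t0}" unfolding Q_def by auto
      show "cut_size q j \<le> (max 0 (((\<rho> * p j)\<^sup>2 - (x - x0) \<bullet> (x - x0)) / \<rho>\<^sup>2)) ^ q * (max 0 ((t - (t0 - \<theta> * p j)) / \<theta>)) ^ q"
        if "(x, t) \<in> Q (Suc j)" for x t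
      proof -
        have x: "norm (x - x0) \<le> \<rho> * p (Suc j)" and t: "t0 - \<theta> * p (Suc j) \<le> t"
          using that by (auto simp: Q_def dist_norm norm_minus_commute)
        define h :: real where "h = (1 / 2) ^ (j + 2)"
        have h: "0 \<le> h" "p j - p (Suc j) = h" using p(3) by (auto simp: h_def)
        have "(norm (x - x0))\<^sup>2 \<le> (\<rho> * p (Suc j))\<^sup>2" using x by (intro power_mono) auto
        then have "\<rho>\<^sup>2 * ((p j)\<^sup>2 - (p (Suc j))\<^sup>2) \<le> (\<rho> * p j)\<^sup>2 - (x - x0) \<bullet> (x - x0)"
          by (simp add: power2_norm_eq_inner power_mult_distrib algebra_simps)
        \<comment> \<open>Both relative sizes exceed one half, so their sum is at least 1 and the
          difference of squares is at least the difference \<open>h\<close>.\<close>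
        moreover have "h \<le> (p j)\<^sup>2 - (p (Suc j))\<^sup>2"
        proof -
          have "h * 1 \<le> h * (p j + p (Suc j))" using h p(1)[of j] p(1)[of "Suc j"] by (intro mult_left_mono) auto
          also have "\<dots> = (p j)\<^sup>2 - (p (Suc j))\<^sup>2" unfolding h(2)[symmetric] by (simp add: power2_eq_square algebra_simps)
          finally show ?thesis by simp
        qed
        ultimately have "\<rho>\<^sup>2 * h \<le> (\<rho> * p j)\<^sup>2 - (x - x0) \<bullet> (x - x0)"
          by (meson mult_left_mono order_trans zero_le_power2)
        then have a1: "h \<le> max 0 (((\<rho> * p j)\<^sup>2 - (x - x0) \<bullet> (x - x0)) / \<rho>\<^sup>2)"
          using \<rho> by (simp add: le_max_iff_disj field_simps)
        have "\<theta> * (p j - p (Suc j)) \<le> t - (t0 - \<theta> * p j)" using t by (simp add: algebra_simps)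
        then have a2: "h \<le> max 0 ((t - (t0 - \<theta> * p j)) / \<theta>)"
          using \<theta> h by (simp add: le_max_iff_disj field_simps)
        have "cut_size q j = h ^ q * h ^ q"
        proof -
          have "(2 * j + 4) * q = (j + 2) * q + (j + 2) * q" by (simp add: algebra_simps)
          then show ?thesis unfolding cut_size_def h_def power_mult[symmetric] power_add[symmetric] by (simp only:)
        qed
        also have "\<dots> \<le> (max 0 (((\<rho> * p j)\<^sup>2 - (x - x0) \<bullet> (x - x0)) / \<rho>\<^sup>2)) ^ q * (max 0 ((t - (t0 - \<theta> * p j)) / \<theta>)) ^ q"
          using h a1 a2 by (intro mult_mono power_mono) auto
        finally show ?thesis .
      qed
      have "4 * s = \<omega> * (8 * E * \<sigma> * R ^ j)" by (simp add: s_def)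
      also have "\<dots> \<le> \<omega> * (gap_size q j)\<^sup>2" using c1[of j] \<omega> by (intro mult_left_mono) auto
      finally show "4 * s \<le> measure lborel (ball (0 :: real ^ 'n) 1) * (gap_size q j)\<^sup>2" by (simp add: \<omega>_def)
      show "(\<integral>\<^sup>+z. ennreal (\<Psi> (kk j) (u z)) * indicator (cball x0 (\<rho> * p j) \<times> {t0 - \<theta> * p j..t0}) z \<partial>lborel) \<le> ennreal (\<sigma> * \<omega> * R ^ j * \<rho> ^ n * k\<^sup>2)"
        using Suc unfolding Q_def .
      have B: "0 < \<sigma> * \<omega> * R ^ j * \<rho> ^ n * k\<^sup>2" using \<sigma> \<omega> R \<rho> k by simp
      then show "0 \<le> \<sigma> * \<omega> * R ^ j * \<rho> ^ n * k\<^sup>2" by simp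
      have "0 < E * (\<sigma> * \<omega> * R ^ j * \<rho> ^ n * k\<^sup>2)" using mult_pos_pos[OF _ B, of E] E by simp
      then show "energy_const \<nu> La g1 q * (\<sigma> * \<omega> * R ^ j * \<rho> ^ n * k\<^sup>2) < s * \<rho> ^ CARD('n) * k\<^sup>2"
        unfolding s_def E_def[symmetric] n_def[symmetric] by (simp add: algebra_simps)
    qed (use q k d s gap Q_meas in auto)
    have bound: "(2 / cut_size q j) powr max g1 2 * (gain_const g0 g1 n * level_const \<nu> g1 q * (4 * s / \<omega>) powr (g0 / n)
        * gap_size q j powr (- 2 * (g0 / n) - g1) * (s * \<rho> ^ n * k\<^sup>2)) \<le> (\<sigma> * R ^ Suc j) * (\<omega> * \<rho> ^ n * k\<^sup>2)"
    proof -
      have "4 * s / \<omega> = 8 * E * \<sigma> * R ^ j" using \<omega> by (simp add: s_def)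
      moreover have "- 2 * (g0 / n) - g1 = - (2 * (g0 / n) + g1)" by simp
      moreover have "s * \<rho> ^ n * k\<^sup>2 = (2 * E * \<sigma> * R ^ j) * (\<omega> * \<rho> ^ n * k\<^sup>2)" by (simp add: s_def)
      moreover have "0 \<le> \<omega> * \<rho> ^ n * k\<^sup>2" using \<omega> \<rho> by simp
      ultimately show ?thesis using mult_right_mono[OF c2[of j], of "\<omega> * \<rho> ^ n * k\<^sup>2"] by (simp only: mult.assoc)
    qed
    show ?case unfolding kS using order_trans[OF step ennreal_leI[OF bound]] by (simp only: ac_simps)
  qed
  define N where "N = cball x0 (\<rho> / 2) \<times> {t0 - \<theta> / 2..t0}"
  have [measurable]: "u \<in> borel_measurable borel" using u_int by auto
  have N[measurable]: "N \<in> sets borel" unfolding N_def by (intro borel_compact compact_Times compact_cball compact_Icc)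
  \<comment> \<open>The half cylinder lies in every \<open>Q j\<close> and the level
    \<open>k\<close> lies above every \<open>kk j\<close>, so the excess over \<open>k\<close> is
    bounded by every term of a sequence tending to zero.\<close>
  have le: "(\<integral>\<^sup>+z. ennreal (\<Psi> k (u z)) * indicator N z \<partial>lborel) \<le> ennreal (\<sigma> * \<omega> * R ^ j * \<rho> ^ n * k\<^sup>2)" for j
  proof -
    have "N \<subseteq> Q j"
    proof -
      have "\<rho> / 2 \<le> \<rho> * p j" "\<theta> / 2 \<le> \<theta> * p j"
        using \<rho> \<theta> p(1)[of j] mult_left_mono[of "1 / 2" "p j" \<rho>] mult_left_mono[of "1 / 2" "p j" \<theta>] by auto
      then show ?thesis unfolding Q_def N_def by auto
    qed
    moreover have "kk j \<le> k" using k by (simp add: kk_def mult_left_le)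
    ultimately have "(\<integral>\<^sup>+z. ennreal (\<Psi> k (u z)) * indicator N z \<partial>lborel) \<le> (\<integral>\<^sup>+z. ennreal (\<Psi> (kk j) (u z)) * indicator (Q j) z \<partial>lborel)"
      by (intro nn_integral_mono mult_mono ennreal_leI \<Psi>_antimono) (auto simp: indicator_def)
    then show ?thesis using main[of j] by (rule order_trans)
  qed
  have "(\<lambda>j. ennreal (\<sigma> * \<omega> * R ^ j * \<rho> ^ n * k\<^sup>2)) \<longlonglongrightarrow> ennreal (\<sigma> * \<omega> * 0 * \<rho> ^ n * k\<^sup>2)"
    using R by (intro tendsto_ennrealI tendsto_intros LIMSEQ_power_zero) auto
  then have "(\<integral>\<^sup>+z. ennreal (\<Psi> k (u z)) * indicator N z \<partial>lborel) \<le> 0"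
    by (intro LIMSEQ_le_const[of "\<lambda>j. ennreal (\<sigma> * \<omega> * R ^ j * \<rho> ^ n * k\<^sup>2)"]) (use le in auto)
  then have "(\<integral>\<^sup>+z. ennreal (\<Psi> k (u z)) * indicator N z \<partial>lborel) = 0" by simp
  then have "AE z in lborel. ennreal (\<Psi> k (u z)) * indicator N z = 0"
    by (subst (asm) nn_integral_0_iff_AE) auto
  then show ?thesis
    unfolding N_def[symmetric]
  proof eventually_elim
    case (elim z)
    show ?case
    proof
      assume z: "z \<in> N"
      then have "\<Psi> k (u z) \<le> 0" using elim by (simp add: ennreal_eq_0_iff indicator_def split: if_splits)
      moreover have "(max 0 (u z - k))\<^sup>2 / \<theta> \<le> \<Psi> k (u z)" by (simp add: \<Psi>_def)
      ultimately have "(max 0 (u z - k))\<^sup>2 / \<theta> \<le> 0" by linarith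
      then have "max 0 (u z - k) = 0" using \<theta> by (simp add: divide_le_0_iff)
      then show "u z \<le> k" by simp
    qed
  qed
qed

end

subsection \<open>Weak subsolutions and mollification\<close>

lemma borel_measurable_completion_AE:
  assumes f: "f \<in> measurable (completion M) N" and ae: "AE x in M. f x = h x" and h: "\<And>x. x \<in> space M \<Longrightarrow> h x \<in> space N"
  shows "h \<in> measurable (completion M) N"
proof (rule measurableI)
  show "h x \<in> space N" if "x \<in> space (completion M)" for x using that h by simp
  show "h -` S \<inter> space (completion M) \<in> sets (completion M)" if S: "S \<in> sets N" for S
  proof (rule completion.in_sets_AE)
    show "f -` S \<inter> space (completion M) \<in> sets (completion M)" using f S by (rule measurable_sets)
    have "AE x in completion M. f x = h x" using ae by (rule AE_completion)
    then show "AE x in completion M. x \<in> f -` S \<inter> space (completion M) \<longleftrightarrow> x \<in> h -` S \<inter> space (completion M)"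
      by eventually_elim auto
  qed auto
qed

text \<open>The weak formulation integrates over restrictions of the completed measure, whereas
  convolution and Fubini are carried out for Borel functions and \<open>lborel\<close>. Completeness
  supplies the measurability of \<open>f\<close> from its agreement with \<open>f0\<close>.\<close>

lemma lebesgue_on_Borel_representative:
  fixes f :: "'a::euclidean_space \<Rightarrow> 'b::euclidean_space"
  assumes S: "S \<in> sets borel" and f0: "f0 \<in> borel_measurable borel"
    and ae: "AE x in lborel. indicator S x *\<^sub>R f x = f0 x"
  shows "integral\<^sup>L (lebesgue_on S) f = integral\<^sup>L lborel f0" "integrable (lebesgue_on S) f \<longleftrightarrow> integrable lborel f0"
proof -
  have f0m: "f0 \<in> borel_measurable lborel" "f0 \<in> borel_measurable lebesgue"
    using f0 by (auto intro: measurable_completion)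
  have ae': "AE x in lebesgue. indicator S x *\<^sub>R f x = f0 x" using ae by (rule AE_completion)
  have m: "(\<lambda>x. indicator S x *\<^sub>R f x) \<in> borel_measurable lebesgue"
  proof (rule borel_measurable_completion_AE[OF f0m(2)])
    show "AE x in lborel. f0 x = indicator S x *\<^sub>R f x" using ae by eventually_elim simp
  qed simp
  have S': "S \<inter> space lebesgue \<in> sets lebesgue" using S by simp
  have "integral\<^sup>L (lebesgue_on S) f = (\<integral>x. indicator S x *\<^sub>R f x \<partial>lebesgue)"
    by (rule integral_restrict_space[OF S'])
  also have "\<dots> = integral\<^sup>L lebesgue f0" by (rule integral_cong_AE[OF m f0m(2) ae'])
  also have "\<dots> = integral\<^sup>L lborel f0" by (rule integral_completion[OF f0m(1)])
  finally show "integral\<^sup>L (lebesgue_on S) f = integral\<^sup>L lborel f0" .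
  have "integrable (lebesgue_on S) f \<longleftrightarrow> integrable lebesgue (\<lambda>x. indicator S x *\<^sub>R f x)"
    by (rule integrable_restrict_space[OF S'])
  also have "\<dots> \<longleftrightarrow> integrable lebesgue f0" by (rule integrable_cong_AE[OF m f0m(2) ae'])
  also have "\<dots> \<longleftrightarrow> integrable lborel f0" by (rule integrable_completion[OF f0m(1)])
  finally show "integrable (lebesgue_on S) f \<longleftrightarrow> integrable lborel f0" .
qed

lemma nn_integral_lebesgue_on:
  assumes S: "S \<in> sets borel" and ae: "AE x in lborel. f x * indicator S x = f0 x"
  shows "(\<integral>\<^sup>+x. f x \<partial>lebesgue_on S) = (\<integral>\<^sup>+x. f0 x \<partial>lborel)"
proof -
  have "(\<integral>\<^sup>+x. f x \<partial>lebesgue_on S) = (\<integral>\<^sup>+x. f x * indicator S x \<partial>lebesgue)"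
    by (rule nn_integral_restrict_space) (use S in simp)
  also have "\<dots> = (\<integral>\<^sup>+x. f x * indicator S x \<partial>lborel)" by (rule nn_integral_completion)
  also have "\<dots> = (\<integral>\<^sup>+x. f0 x \<partial>lborel)" by (rule nn_integral_cong_AE[OF ae])
  finally show ?thesis .
qed

lemma Borel_representative_real:
  fixes f :: "'a::euclidean_space \<Rightarrow> real"
  assumes S: "S \<in> sets borel" and f: "f \<in> borel_measurable (lebesgue_on S)"
  shows "\<exists>f0\<in>borel_measurable borel. AE x in lborel. x \<in> S \<longrightarrow> f x = f0 x"
proof -
  have "(\<lambda>x. if x \<in> S then f x else 0) \<in> borel_measurable lebesgue"
    using f S by (subst (asm) measurable_restrict_space_iff[where c = 0]) auto
  from completion_ex_borel_measurable_real[OF this] obtain f0 where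
    f0: "f0 \<in> borel_measurable lborel" "AE x in lborel. (if x \<in> S then f x else 0) = f0 x" by blast
  have "AE x in lborel. x \<in> S \<longrightarrow> f x = f0 x" using f0(2) by eventually_elim auto
  then show ?thesis using f0(1) by auto
qed

text \<open>Representatives are chosen coordinate by coordinate; multiplying by the indicator makes
  the extension by zero hold everywhere, not merely almost everywhere.\<close>

lemma Borel_representative:
  fixes f :: "'a::euclidean_space \<Rightarrow> 'b::euclidean_space"
  assumes S: "S \<in> sets borel" and f: "f \<in> borel_measurable (lebesgue_on S)"
  obtains f0 where "f0 \<in> borel_measurable borel" "\<And>x. x \<notin> S \<Longrightarrow> f0 x = 0" "AE x in lborel. x \<in> S \<longrightarrow> f x = f0 x"
proof -
  have "\<forall>b\<in>Basis. \<exists>h. h \<in> borel_measurable borel \<and> (AE x in lborel. x \<in> S \<longrightarrow> f x \<bullet> b = h x)"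
  proof
    fix b :: 'b assume "b \<in> Basis"
    then have "(\<lambda>x. f x \<bullet> b) \<in> borel_measurable (lebesgue_on S)" using f by simp
    from Borel_representative_real[OF S this]
    show "\<exists>h. h \<in> borel_measurable borel \<and> (AE x in lborel. x \<in> S \<longrightarrow> f x \<bullet> b = h x)" by blast
  qed
  from bchoice[OF this] obtain h where h: "\<And>b. b \<in> Basis \<Longrightarrow> h b \<in> borel_measurable borel"
    "\<And>b. b \<in> Basis \<Longrightarrow> AE x in lborel. x \<in> S \<longrightarrow> f x \<bullet> b = h b x" by blast
  define f0 where "f0 x = indicator S x *\<^sub>R (\<Sum>b\<in>Basis. h b x *\<^sub>R b)" for x
  have "f0 \<in> borel_measurable borel"
    unfolding f0_def using h(1) S
    by (intro borel_measurable_scaleR borel_measurable_sum borel_measurable_indicator borel_measurable_const) auto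
  moreover have "AE x in lborel. \<forall>b\<in>Basis. x \<in> S \<longrightarrow> f x \<bullet> b = h b x"
    by (intro AE_finite_allI h(2)) auto
  then have "AE x in lborel. x \<in> S \<longrightarrow> f x = f0 x"
  proof eventually_elim
    case (elim x)
    show ?case
    proof
      assume x: "x \<in> S"
      have "f0 x = (\<Sum>b\<in>Basis. (f x \<bullet> b) *\<^sub>R b)" using x elim by (simp add: f0_def)
      then show "f x = f0 x" by (simp add: euclidean_representation)
    qed
  qed
  moreover have "f0 x = 0" if "x \<notin> S" for x using that by (simp add: f0_def)
  ultimately show ?thesis using that by blast
qed

text \<open>Tonelli's theorem for a Borel null set containing the exceptional set.\<close>

lemma AE_slice_snd:
  fixes Q :: "'a::euclidean_space \<times> 'b::euclidean_space \<Rightarrow> bool"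
  assumes "AE z in lborel. Q z"
  shows "AE t in lborel. AE x in lborel. Q (x, t)"
proof -
  obtain N where N: "{z \<in> space lborel. \<not> Q z} \<subseteq> N" "emeasure lborel N = 0" "N \<in> sets lborel"
    using AE_E[OF assms] by blast
  have m: "(\<lambda>z. indicator N z :: ennreal) \<in> borel_measurable (lborel \<Otimes>\<^sub>M lborel)"
    unfolding lborel_prod using N(3) by simp
  have "(\<integral>\<^sup>+t. (\<integral>\<^sup>+x. indicator N (x, t) \<partial>lborel) \<partial>lborel) = 0"
    using lborel_pair.nn_integral_snd[OF m] N(2,3) by (simp add: lborel_prod)
  then have "AE t in lborel. (\<integral>\<^sup>+x. indicator N (x, t) \<partial>lborel) = 0"
    by (subst (asm) nn_integral_0_iff_AE) (use m in measurable)
  then show ?thesis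
  proof eventually_elim
    case (elim t)
    have "(\<lambda>x. indicator N (x, t) :: ennreal) \<in> borel_measurable lborel" using m by measurable
    then have "AE x in lborel. (indicator N (x, t) :: ennreal) = 0"
      using elim by (subst (asm) nn_integral_0_iff_AE) auto
    then show ?case
      by eventually_elim (use N(1) in \<open>auto simp: indicator_def split: if_splits\<close>)
  qed
qed

section \<open>Mollifiers as test functions\<close>

lemma Ck_slice: "Ck k f \<Longrightarrow> Ck k (\<lambda>y. f (y, s))"
proof (induction k arbitrary: f)
  case 0 then show ?case by (auto intro!: continuous_intros intro: continuous_on_compose2)
next
  case (Suc k)
  have 1: "((\<lambda>y. (y, s)) has_derivative (\<lambda>h. (h, 0))) (at y)" for y
    by (auto intro!: derivative_eq_intros)
  have "((\<lambda>y. f (y, s)) has_derivative (\<lambda>h. frechet_derivative f (at (y, s)) (h, 0))) (at y)" for y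
    by (rule has_derivative_compose[OF 1 Ck_SucE(1)[OF Suc.prems]])
  then show ?case
  proof (rule Ck_SucI)
    fix b :: 'a assume "b \<in> Basis"
    then have "(b, 0) \<in> (Basis :: ('a \<times> 'b) set)" by (simp add: Basis_prod_def)
    then show "Ck k (\<lambda>y. frechet_derivative f (at (y, s)) (b, 0))"
      by (intro Suc.IH[of "\<lambda>z. frechet_derivative f (at z) (b, 0)"] Ck_SucE(2)[OF Suc.prems])
  qed
qed

lemma test_functions_mollifier:
  assumes \<kappa>: "mollifier r \<kappa>" and S: "cball z r \<subseteq> E"
  shows "(\<lambda>w. \<kappa> (z - w)) \<in> test_functions E"
proof -
  have sub: "{w. \<kappa> (z - w) \<noteq> 0} \<subseteq> cball z r"
    using \<kappa> by (auto simp: mollifier_def dist_norm less_imp_le)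
  then have "closure {w. \<kappa> (z - w) \<noteq> 0} \<subseteq> cball z r" by (rule closure_minimal) simp
  moreover have "compact (closure {w. \<kappa> (z - w) \<noteq> 0})"
    using sub by (meson bounded_cball bounded_subset compact_closure)
  ultimately show ?thesis using \<kappa> S by (auto simp: test_functions_def mollifier_def intro: Ck_reflect)
qed

text \<open>Weak spatial gradients are given for each time separately, so the reflected mollifier
  has to be admissible on each slice; its slice support is no larger than the projected
  ball.\<close>

lemma test_functions_mollifier_slice:
  fixes z :: "'a::euclidean_space \<times> real"
  assumes \<kappa>: "mollifier r \<kappa>" and S: "cball (fst z) r \<subseteq> D"
  shows "(\<lambda>y. \<kappa> (z - (y, s))) \<in> test_functions D"
proof -
  have "norm (fst z - y) < r" if "\<kappa> (z - (y, s)) \<noteq> 0" for y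
  proof -
    have "norm (fst (z - (y, s))) \<le> norm (z - (y, s))" by (metis norm_fst_le prod.collapse)
    also have "\<dots> < r" using \<kappa> that unfolding mollifier_def by blast
    finally show ?thesis by simp
  qed
  then have sub: "{y. \<kappa> (z - (y, s)) \<noteq> 0} \<subseteq> cball (fst z) r"
    by (auto simp: dist_norm less_imp_le)
  then have "closure {y. \<kappa> (z - (y, s)) \<noteq> 0} \<subseteq> cball (fst z) r" by (rule closure_minimal) simp
  moreover have "compact (closure {y. \<kappa> (z - (y, s)) \<noteq> 0})"
    using sub by (meson bounded_cball bounded_subset compact_closure)
  moreover have "Ck k (\<lambda>y. \<kappa> (z - (y, s)))" for k
    using Ck_slice[OF Ck_reflect, of k \<kappa> z s] \<kappa> by (simp add: mollifier_def)
  ultimately show ?thesis using S by (auto simp: test_functions_def)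
qed

lemma mollifier_reflect_deriv:
  fixes z :: "(real ^ 'n) \<times> real"
  assumes \<kappa>: "mollifier r \<kappa>"
  shows "deriv (\<lambda>s. \<kappa> (z - (x, s))) t = - (grad \<kappa> (z - (x, t)) \<bullet> (0, 1))"
    and "gradient (\<lambda>y. \<kappa> (z - (y, t))) x = - fst (grad \<kappa> (z - (x, t)))"
proof -
  have Ck: "Ck k \<kappa>" for k using \<kappa> by (simp add: mollifier_def)
  have 1: "((\<lambda>w. z - w) has_derivative (\<lambda>h. - h)) (at w)" for w
    by (auto intro!: derivative_eq_intros)
  have "((\<lambda>w. \<kappa> (z - w)) has_derivative (\<lambda>h. grad \<kappa> (z - w) \<bullet> (- h))) (at w)" for w
    by (rule has_derivative_compose[OF 1 grad_deriv[OF Ck]])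
  moreover have "grad \<kappa> (z - w) \<bullet> (- h) = - fst (grad \<kappa> (z - w)) \<bullet> fst h + (- snd (grad \<kappa> (z - w))) * snd h" for w h
    by (simp add: inner_prod_def)
  ultimately have D: "((\<lambda>w. \<kappa> (z - w)) has_derivative (\<lambda>h. - fst (grad \<kappa> (z - w)) \<bullet> fst h + (- snd (grad \<kappa> (z - w))) * snd h)) (at w)" for w
    by (simp only:)
  show "deriv (\<lambda>s. \<kappa> (z - (x, s))) t = - (grad \<kappa> (z - (x, t)) \<bullet> (0, 1))"
    using DERIV_imp_deriv[OF has_derivative_slices(1)[OF D]] by (simp add: inner_prod_def)
  have "frechet_derivative (\<lambda>y. \<kappa> (z - (y, t))) (at x) = (\<lambda>h. - fst (grad \<kappa> (z - (x, t))) \<bullet> h)"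
    by (rule frechet_derivative_at[OF has_derivative_slices(2)[OF D], symmetric])
  then show "gradient (\<lambda>y. \<kappa> (z - (y, t))) x = - fst (grad \<kappa> (z - (x, t)))"
    by (simp add: gradient_def vec_eq_iff inner_axis)
qed

lemma lborel_integral_snd:
  fixes f :: "'a::euclidean_space \<times> 'b::euclidean_space \<Rightarrow> 'c::{banach, second_countable_topology}"
  assumes "integrable lborel f"
  shows "(\<integral>s. (\<integral>y. f (y, s) \<partial>lborel) \<partial>lborel) = integral\<^sup>L lborel f"
    and "(\<lambda>s. \<integral>y. f (y, s) \<partial>lborel) \<in> borel_measurable lborel"
proof -
  have i: "integrable (lborel \<Otimes>\<^sub>M lborel) (case_prod (\<lambda>y s. f (y, s)))"
    using assms by (simp add: lborel_prod case_prod_eta)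
  show "(\<integral>s. (\<integral>y. f (y, s) \<partial>lborel) \<partial>lborel) = integral\<^sup>L lborel f"
    using lborel_pair.integral_snd[OF i] by (simp add: lborel_prod case_prod_eta)
  show "(\<lambda>s. \<integral>y. f (y, s) \<partial>lborel) \<in> borel_measurable lborel"
    using lborel_pair.integrable_snd[OF i] by (rule borel_measurable_integrable)
qed

text \<open>Almost every slice is tested with the reflected mollifier, and the identities are
  integrated in time by Fubini. The minus sign of reflection cancels the one in the definition of
  the weak gradient.\<close>

lemma weak_gradient_conv:
  fixes u0 :: "(real ^ 'n) \<times> real \<Rightarrow> real" and Du0 :: "(real ^ 'n) \<times> real \<Rightarrow> real ^ 'n"
  assumes D: "D \<in> sets borel" and W: "AE t in lebesgue_on {t1<..<t2}. W11 D (\<lambda>x. u (x, t)) (\<lambda>x. Du (x, t))"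
    and u0: "integrable lborel u0" "integrable lborel Du0" "\<And>w. w \<notin> D \<times> {t1<..<t2} \<Longrightarrow> u0 w = 0 \<and> Du0 w = 0"
    and ae: "AE w in lborel. w \<in> D \<times> {t1<..<t2} \<longrightarrow> u w = u0 w \<and> Du w = Du0 w"
    and \<kappa>: "mollifier r \<kappa>" and z: "cball (fst z) r \<subseteq> D"
  shows "conv (\<lambda>y. grad \<kappa> y \<bullet> (axis i 1, 0)) u0 z = conv \<kappa> Du0 z $ i"
proof -
  define \<Gamma> where "\<Gamma> w = fst (grad \<kappa> (z - w))" for w
  have gk: "kernel r (grad \<kappa>)" by (rule mollifier_grad_kernel[OF \<kappa>])
  obtain C where C: "0 < C" "\<And>z. norm (grad \<kappa> z) \<le> C" using kernel_bound[OF gk] by blast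
  have \<Gamma>C: "norm (\<Gamma> w) \<le> C" for w
  proof -
    have "norm (fst a) \<le> norm a" for a :: "(real ^ 'n) \<times> real" by (metis norm_fst_le prod.collapse)
    then show ?thesis unfolding \<Gamma>_def using C(2) order_trans by blast
  qed
  have "continuous_on UNIV (grad \<kappa>)" using gk by (simp add: kernel_def)
  then have "continuous_on UNIV \<Gamma>"
    unfolding \<Gamma>_def
    by (intro continuous_on_fst continuous_on_compose2[of UNIV "grad \<kappa>" UNIV "\<lambda>w. z - w"]) (auto intro: continuous_intros)
  then have \<Gamma>m: "\<Gamma> \<in> borel_measurable borel" by (rule borel_measurable_continuous_onI)
  have um: "u0 \<in> borel_measurable borel" "Du0 \<in> borel_measurable borel" using u0 by auto
  have \<kappa>c: "continuous_on UNIV \<kappa>" using mollifier_kernel[OF \<kappa>] by (simp add: kernel_def)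
  have \<kappa>m: "\<kappa> \<in> borel_measurable borel" by (rule borel_measurable_continuous_onI[OF \<kappa>c])
  have i1: "integrable lborel (\<lambda>w. u0 w *\<^sub>R \<Gamma> w)"
  proof (rule Bochner_Integration.integrable_bound)
    show "integrable lborel (\<lambda>w. C * u0 w)" using u0 by simp
    show "(\<lambda>w. u0 w *\<^sub>R \<Gamma> w) \<in> borel_measurable lborel" using um \<Gamma>m by measurable
    show "AE w in lborel. norm (u0 w *\<^sub>R \<Gamma> w) \<le> norm (C * u0 w)"
      using \<Gamma>C C(1) by (auto simp: abs_mult mult.commute[of C] intro!: mult_left_mono)
  qed
  have i2: "integrable lborel (\<lambda>w. \<kappa> (z - w) *\<^sub>R Du0 w)"
    by (rule conv_integrable[OF mollifier_kernel[OF \<kappa>] u0(2)])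
  have W': "AE s in lborel. s \<in> {t1<..<t2} \<longrightarrow> W11 D (\<lambda>x. u (x, s)) (\<lambda>x. Du (x, s))"
    using W by (subst (asm) AE_restrict_space_iff) (auto simp: AE_completion_iff)
  have slice: "AE s in lborel. (\<integral>y. u0 (y, s) *\<^sub>R \<Gamma> (y, s) \<partial>lborel) = (\<integral>y. \<kappa> (z - (y, s)) *\<^sub>R Du0 (y, s) \<partial>lborel)"
    using W' AE_slice_snd[OF ae]
  proof eventually_elim
    case (elim s)
    show ?case
    proof (cases "s \<in> {t1<..<t2}")
      case True
      have W: "W11 D (\<lambda>x. u (x, s)) (\<lambda>x. Du (x, s))" using elim True by simp
      have um': "(\<lambda>y. u0 (y, s)) \<in> borel_measurable borel" "(\<lambda>y. Du0 (y, s)) \<in> borel_measurable borel"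
        "(\<lambda>y. \<Gamma> (y, s)) \<in> borel_measurable borel"
        using um \<Gamma>m by (auto intro: measurable_compose[OF _ um(1)] measurable_compose[OF _ um(2)] measurable_compose[OF _ \<Gamma>m] simp: borel_prod[symmetric])
      have \<kappa>m': "(\<lambda>y. \<kappa> (z - (y, s))) \<in> borel_measurable borel"
        by (intro borel_measurable_continuous_onI continuous_on_compose2[OF \<kappa>c] continuous_intros) auto
      have tst: "(\<lambda>y. \<kappa> (z - (y, s))) \<in> test_functions D"
        by (rule test_functions_mollifier_slice[OF \<kappa> z])
      have "(LINT x|lebesgue_on D. u (x, s) *\<^sub>R gradient (\<lambda>y. \<kappa> (z - (y, s))) x) = - (LINT x|lebesgue_on D. \<kappa> (z - (x, s)) *\<^sub>R Du (x, s))"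
        using W tst unfolding W11_def by blast
      moreover have "(LINT x|lebesgue_on D. u (x, s) *\<^sub>R gradient (\<lambda>y. \<kappa> (z - (y, s))) x) = (\<integral>y. u0 (y, s) *\<^sub>R (- \<Gamma> (y, s)) \<partial>lborel)"
      proof (rule lebesgue_on_Borel_representative(1)[OF D])
        show "(\<lambda>y. u0 (y, s) *\<^sub>R - \<Gamma> (y, s)) \<in> borel_measurable borel"
          using um' by (intro borel_measurable_scaleR borel_measurable_uminus)
        show "AE x in lborel. indicator D x *\<^sub>R u (x, s) *\<^sub>R gradient (\<lambda>y. \<kappa> (z - (y, s))) x = u0 (x, s) *\<^sub>R - \<Gamma> (x, s)"
          using elim(2)
        proof eventually_elim
          case (elim x)
          then show ?case using True u0(3)[of "(x, s)"] mollifier_reflect_deriv(2)[OF \<kappa>, of z s x]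
            by (cases "x \<in> D") (auto simp: \<Gamma>_def)
        qed
      qed
      moreover have "(LINT x|lebesgue_on D. \<kappa> (z - (x, s)) *\<^sub>R Du (x, s)) = (\<integral>y. \<kappa> (z - (y, s)) *\<^sub>R Du0 (y, s) \<partial>lborel)"
      proof (rule lebesgue_on_Borel_representative(1)[OF D])
        show "(\<lambda>y. \<kappa> (z - (y, s)) *\<^sub>R Du0 (y, s)) \<in> borel_measurable borel"
          using um' \<kappa>m' by (intro borel_measurable_scaleR)
        show "AE x in lborel. indicator D x *\<^sub>R \<kappa> (z - (x, s)) *\<^sub>R Du (x, s) = \<kappa> (z - (x, s)) *\<^sub>R Du0 (x, s)"
          using elim(2) by eventually_elim (use True u0(3) in \<open>auto simp: indicator_def\<close>)
      qed
      ultimately show ?thesis by simp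
    qed (use u0(3) in auto)
  qed
  have "(\<integral>w. u0 w *\<^sub>R \<Gamma> w \<partial>lborel) = (\<integral>s. (\<integral>y. u0 (y, s) *\<^sub>R \<Gamma> (y, s) \<partial>lborel) \<partial>lborel)"
    using lborel_integral_snd(1)[OF i1] by simp
  also have "\<dots> = (\<integral>s. (\<integral>y. \<kappa> (z - (y, s)) *\<^sub>R Du0 (y, s) \<partial>lborel) \<partial>lborel)"
    by (rule integral_cong_AE[OF lborel_integral_snd(2)[OF i1] lborel_integral_snd(2)[OF i2] slice])
  also have "\<dots> = conv \<kappa> Du0 z"
    using lborel_integral_snd(1)[OF i2] by (simp add: conv_def)
  finally have eq: "(\<integral>w. u0 w *\<^sub>R \<Gamma> w \<partial>lborel) = conv \<kappa> Du0 z" .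
  have "conv (\<lambda>y. grad \<kappa> y \<bullet> (axis i 1, 0)) u0 z = (\<integral>w. (u0 w *\<^sub>R \<Gamma> w) $ i \<partial>lborel)"
    unfolding conv_def by (intro Bochner_Integration.integral_cong refl) (simp add: \<Gamma>_def inner_prod_def inner_axis)
  also have "\<dots> = (\<integral>w. u0 w *\<^sub>R \<Gamma> w \<partial>lborel) $ i"
    by (rule integral_bounded_linear[OF bounded_linear_vec_nth i1])
  finally show ?thesis unfolding eq .
qed

text \<open>The reflected mollifier \<open>w \<mapsto> \<kappa> (z - w)\<close> is nonnegative and
  supported in \<open>K\<close>, hence admissible in the weak formulation; reflection reverses the
  sign of both derivatives.\<close>

lemma subsolution_conv:
  fixes u0 :: "(real ^ 'n) \<times> real \<Rightarrow> real" and Du0 :: "(real ^ 'n) \<times> real \<Rightarrow> real ^ 'n"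
  assumes K: "K \<in> sets borel" "K \<subseteq> \<Omega> \<times> {0<..<T}" and \<Omega>: "\<Omega> \<in> sets borel"
    and sub: "\<forall>\<eta>\<in>test_functions (\<Omega> \<times> {0<..<T}). (\<forall>z. 0 \<le> \<eta> z) \<longrightarrow>
           - (LINT (x, t)|lebesgue_on (\<Omega> \<times> {0<..<T}). u (x, t) * deriv (\<lambda>s. \<eta> (x, s)) t)
           + (LINT (x, t)|lebesgue_on (\<Omega> \<times> {0<..<T}).
                A (Du (x, t)) \<bullet> gradient (\<lambda>y. \<eta> (y, t)) x) \<le> 0"
    and u0: "integrable lborel u0" "Du0 \<in> borel_measurable borel" "\<And>w. w \<notin> K \<Longrightarrow> u0 w = 0 \<and> Du0 w = 0"
    and A: "continuous_on UNIV A" "integrable lborel (\<lambda>w. A (Du0 w))"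
    and ae: "AE w in lborel. w \<in> K \<longrightarrow> u w = u0 w \<and> Du w = Du0 w"
    and \<kappa>: "mollifier r \<kappa>" and z: "cball z r \<subseteq> K"
  shows "conv (\<lambda>y. grad \<kappa> y \<bullet> (0, 1)) u0 z \<le> (\<Sum>i\<in>UNIV. conv (\<lambda>y. grad \<kappa> y \<bullet> (axis i 1, 0)) (\<lambda>w. A (Du0 w)) z $ i)"
proof -
  let ?\<Omega> = "\<Omega> \<times> {0<..<T}" and ?\<eta> = "\<lambda>w. \<kappa> (z - w)"
  have \<Omega>m: "?\<Omega> \<in> sets borel" using \<Omega> by (simp add: borel_prod[symmetric])
  have gk: "kernel r (grad \<kappa>)" by (rule mollifier_grad_kernel[OF \<kappa>])
  have gm: "(\<lambda>w. grad \<kappa> (z - w)) \<in> borel_measurable borel"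
    using gk unfolding kernel_def
    by (intro borel_measurable_continuous_onI continuous_on_compose2[of UNIV "grad \<kappa>" UNIV "\<lambda>w. z - w"]) (auto intro: continuous_intros)
  have um: "u0 \<in> borel_measurable borel" using u0 by auto
  have Am: "(\<lambda>w. A (Du0 w)) \<in> borel_measurable borel" using A(2) by auto
  have g0: "grad \<kappa> (z - w) = 0" if "w \<notin> K" for w
    using gk z that unfolding kernel_def by (metis dist_norm mem_cball subsetD)
  have tst: "?\<eta> \<in> test_functions ?\<Omega>" by (rule test_functions_mollifier[OF \<kappa>]) (use z K in auto)
  have "- (LINT (x, t)|lebesgue_on ?\<Omega>. u (x, t) * deriv (\<lambda>s. ?\<eta> (x, s)) t)
           + (LINT (x, t)|lebesgue_on ?\<Omega>. A (Du (x, t)) \<bullet> gradient (\<lambda>y. ?\<eta> (y, t)) x) \<le> 0"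
  proof (rule mp[OF bspec[OF sub tst]])
    show "\<forall>w. 0 \<le> \<kappa> (z - w)" using \<kappa> unfolding mollifier_def by blast
  qed
  moreover have "(LINT (x, t)|lebesgue_on ?\<Omega>. u (x, t) * deriv (\<lambda>s. ?\<eta> (x, s)) t) = (\<integral>w. u0 w * - (grad \<kappa> (z - w) \<bullet> (0, 1)) \<partial>lborel)"
  proof (rule lebesgue_on_Borel_representative(1)[OF \<Omega>m])
    show "(\<lambda>w. u0 w * - (grad \<kappa> (z - w) \<bullet> (0, 1))) \<in> borel_measurable borel"
      using um gm by measurable
    show "AE w in lborel. indicator ?\<Omega> w *\<^sub>R (case w of (x, t) \<Rightarrow> u (x, t) * deriv (\<lambda>s. ?\<eta> (x, s)) t) = u0 w * - (grad \<kappa> (z - w) \<bullet> (0, 1))"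
      using ae
    proof eventually_elim
      case (elim w)
      obtain x t where w: "w = (x, t)" by (cases w)
      have d: "deriv (\<lambda>s. ?\<eta> (x, s)) t = - (grad \<kappa> (z - w) \<bullet> (0, 1))"
        unfolding w by (rule mollifier_reflect_deriv(1)[OF \<kappa>])
      show ?case
      proof (cases "w \<in> K")
        case True
        then show ?thesis using elim K(2) d w by auto
      next
        case False
        then show ?thesis using g0[OF False] u0(3)[OF False] d w by simp
      qed
    qed
  qed
  moreover have "(LINT (x, t)|lebesgue_on ?\<Omega>. A (Du (x, t)) \<bullet> gradient (\<lambda>y. ?\<eta> (y, t)) x) = (\<integral>w. A (Du0 w) \<bullet> - fst (grad \<kappa> (z - w)) \<partial>lborel)"
  proof (rule lebesgue_on_Borel_representative(1)[OF \<Omega>m])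
    have "(\<lambda>w. fst (grad \<kappa> (z - w))) \<in> borel_measurable borel"
      using gm by (rule measurable_compose) (simp add: borel_prod[symmetric])
    then show "(\<lambda>w. A (Du0 w) \<bullet> - fst (grad \<kappa> (z - w))) \<in> borel_measurable borel"
      using Am by (intro borel_measurable_inner borel_measurable_uminus)
    show "AE w in lborel. indicator ?\<Omega> w *\<^sub>R (case w of (x, t) \<Rightarrow> A (Du (x, t)) \<bullet> gradient (\<lambda>y. ?\<eta> (y, t)) x) = A (Du0 w) \<bullet> - fst (grad \<kappa> (z - w))"
      using ae
    proof eventually_elim
      case (elim w)
      obtain x t where w: "w = (x, t)" by (cases w)
      have d: "gradient (\<lambda>y. ?\<eta> (y, t)) x = - fst (grad \<kappa> (z - w))"
        unfolding w by (rule mollifier_reflect_deriv(2)[OF \<kappa>])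
      show ?case
      proof (cases "w \<in> K")
        case True
        then show ?thesis using elim K(2) d w by auto
      next
        case False
        then show ?thesis using g0[OF False] d w by simp
      qed
    qed
  qed
  moreover have "(\<integral>w. u0 w * - (grad \<kappa> (z - w) \<bullet> (0, 1)) \<partial>lborel) = - conv (\<lambda>y. grad \<kappa> y \<bullet> (0, 1)) u0 z"
    unfolding conv_def by (simp add: mult.commute)
  moreover have "(\<integral>w. A (Du0 w) \<bullet> - fst (grad \<kappa> (z - w)) \<partial>lborel) =
      - (\<Sum>i\<in>UNIV. conv (\<lambda>y. grad \<kappa> y \<bullet> (axis i 1, 0)) (\<lambda>w. A (Du0 w)) z $ i)"
  proof -
    have i: "integrable lborel (\<lambda>w. (grad \<kappa> (z - w) \<bullet> (axis i 1, 0)) *\<^sub>R A (Du0 w))" for i :: 'n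
      by (rule conv_integrable[OF kernel_inner[OF gk] A(2)])
    have i': "integrable lborel (\<lambda>w. ((grad \<kappa> (z - w) \<bullet> (axis i 1, 0)) *\<^sub>R A (Du0 w)) $ i)" for i :: 'n
      by (rule integrable_bounded_linear[OF bounded_linear_vec_nth i])
    have "(\<Sum>i\<in>UNIV. conv (\<lambda>y. grad \<kappa> y \<bullet> (axis i 1, 0)) (\<lambda>w. A (Du0 w)) z $ i) =
        (\<Sum>i\<in>UNIV. \<integral>w. ((grad \<kappa> (z - w) \<bullet> (axis i 1, 0)) *\<^sub>R A (Du0 w)) $ i \<partial>lborel)"
      unfolding conv_def by (intro sum.cong refl integral_bounded_linear[OF bounded_linear_vec_nth i, symmetric])
    also have "\<dots> = (\<integral>w. (\<Sum>i\<in>UNIV. ((grad \<kappa> (z - w) \<bullet> (axis i 1, 0)) *\<^sub>R A (Du0 w)) $ i) \<partial>lborel)"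
      by (rule Bochner_Integration.integral_sum[symmetric]) (rule i')
    also have "\<dots> = (\<integral>w. A (Du0 w) \<bullet> fst (grad \<kappa> (z - w)) \<partial>lborel)"
      by (intro Bochner_Integration.integral_cong refl) (simp add: inner_prod_def inner_axis, simp add: inner_vec_def mult.commute)
    finally show ?thesis by simp
  qed
  ultimately show ?thesis by linarith
qed

text \<open>The bound on almost every slice is integrated over the bounded time interval.\<close>

lemma square_integrable:
  fixes u0 :: "(real ^ 'n) \<times> real \<Rightarrow> real"
  assumes D: "D \<in> sets borel" and L: "Linf_L2 D t1 t2 u"
    and u0: "u0 \<in> borel_measurable borel" "\<And>w. w \<notin> D \<times> {t1<..<t2} \<Longrightarrow> u0 w = 0"
    and ae: "AE w in lborel. w \<in> D \<times> {t1<..<t2} \<longrightarrow> u w = u0 w"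
  shows "integrable lborel (\<lambda>w. (u0 w)\<^sup>2)"
proof (rule integrableI_bounded)
  show m: "(\<lambda>w. (u0 w)\<^sup>2) \<in> borel_measurable lborel" using u0 by simp
  obtain M where M: "AE t in lebesgue_on {t1<..<t2}. (\<integral>\<^sup>+x. ennreal ((u (x, t))\<^sup>2) \<partial>lebesgue_on D) \<le> ennreal M"
    using L unfolding Linf_L2_def by auto
  have M': "AE t in lborel. t \<in> {t1<..<t2} \<longrightarrow> (\<integral>\<^sup>+x. ennreal ((u (x, t))\<^sup>2) \<partial>lebesgue_on D) \<le> ennreal M"
    using M by (subst (asm) AE_restrict_space_iff) (auto simp: AE_completion_iff)
  have m2: "(\<lambda>w. ennreal ((u0 w)\<^sup>2)) \<in> borel_measurable (lborel \<Otimes>\<^sub>M lborel)"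
    unfolding lborel_prod using u0 by simp
  have "(\<integral>\<^sup>+w. ennreal (norm ((u0 w)\<^sup>2)) \<partial>lborel) = (\<integral>\<^sup>+t. (\<integral>\<^sup>+x. ennreal ((u0 (x, t))\<^sup>2) \<partial>lborel) \<partial>lborel)"
    using lborel_pair.nn_integral_snd[OF m2] by (simp add: lborel_prod)
  also have "\<dots> \<le> (\<integral>\<^sup>+t. ennreal M * indicator {t1<..<t2} t \<partial>lborel)"
  proof (rule nn_integral_mono_AE)
    show "AE t in lborel. (\<integral>\<^sup>+x. ennreal ((u0 (x, t))\<^sup>2) \<partial>lborel) \<le> ennreal M * indicator {t1<..<t2} t"
      using M' AE_slice_snd[OF ae]
    proof eventually_elim
      case (elim t)
      show ?case
      proof (cases "t \<in> {t1<..<t2}")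
        case True
        have "(\<integral>\<^sup>+x. ennreal ((u (x, t))\<^sup>2) \<partial>lebesgue_on D) = (\<integral>\<^sup>+x. ennreal ((u0 (x, t))\<^sup>2) \<partial>lborel)"
        proof (rule nn_integral_lebesgue_on[OF D])
          show "AE x in lborel. ennreal ((u (x, t))\<^sup>2) * indicator D x = ennreal ((u0 (x, t))\<^sup>2)"
            using elim(2) by eventually_elim (use True u0(2) in \<open>auto simp: indicator_def\<close>)
        qed
        then show ?thesis using elim(1) True by simp
      qed (use u0(2) in simp)
    qed
  qed
  also have "\<dots> = ennreal M * emeasure lborel {t1<..<t2}" by (rule nn_integral_cmult_indicator) simp
  also have "\<dots> < \<infinity>"
    using emeasure_bounded_finite[of "{t1<..<t2}"] by (simp add: ennreal_mult_less_top)
  finally show "(\<integral>\<^sup>+w. ennreal (norm ((u0 w)\<^sup>2)) \<partial>lborel) < \<infinity>" .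
qed

lemma LG_integrable:
  fixes u0 :: "'a::euclidean_space \<Rightarrow> 'b::euclidean_space"
  assumes K: "K \<in> sets borel" and L: "LG G K u" and G: "G \<in> borel_measurable borel" "G 0 = 0" "\<And>s. 0 \<le> G s"
    and u0: "u0 \<in> borel_measurable borel" "\<And>w. w \<notin> K \<Longrightarrow> u0 w = 0"
    and ae: "AE w in lborel. w \<in> K \<longrightarrow> u w = u0 w"
  shows "integrable lborel (\<lambda>w. G (norm (u0 w)))"
proof (rule integrableI_bounded)
  show "(\<lambda>w. G (norm (u0 w))) \<in> borel_measurable lborel" using G(1) u0(1) by measurable
  have "(\<integral>\<^sup>+w. ennreal (G (norm (u w))) \<partial>lebesgue_on K) = (\<integral>\<^sup>+w. ennreal (norm (G (norm (u0 w)))) \<partial>lborel)"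
  proof (rule nn_integral_lebesgue_on[OF K])
    show "AE w in lborel. ennreal (G (norm (u w))) * indicator K w = ennreal (norm (G (norm (u0 w))))"
      using ae by eventually_elim (use G u0(2) in \<open>auto simp: indicator_def\<close>)
  qed
  then show "(\<integral>\<^sup>+w. ennreal (norm (G (norm (u0 w)))) \<partial>lborel) < \<infinity>" using L by (simp add: LG_def)
qed

text \<open>A point outside the smaller ball is projected radially onto its sphere, which moves it
  by at most \<open>e\<close>.\<close>

lemma cball_enlarge:
  fixes x0 :: "'a::real_normed_vector"
  assumes "0 < \<rho>" "0 < e" "y \<in> cball x0 (\<rho> + e)"
  shows "\<exists>x\<in>cball x0 \<rho>. y \<in> cball x e"
proof (cases "y \<in> cball x0 \<rho>")
  case True then show ?thesis using assms by (intro bexI[of _ y]) auto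
next
  case False
  define N where "N = norm (y - x0)"
  have N: "\<rho> < N" "N \<le> \<rho> + e" "0 < N" using False assms by (auto simp: N_def dist_norm norm_minus_commute)
  define x where "x = x0 + (\<rho> / N) *\<^sub>R (y - x0)"
  have "norm (x - x0) = \<rho>" using N assms by (simp add: x_def N_def[symmetric])
  moreover have "norm (y - x) = N - \<rho>"
  proof -
    have "y - x = (1 - \<rho> / N) *\<^sub>R (y - x0)" by (simp add: x_def algebra_simps)
    then have "norm (y - x) = \<bar>1 - \<rho> / N\<bar> * N" by (simp add: N_def)
    also have "\<dots> = (1 - \<rho> / N) * N" using N by (simp add: abs_of_nonneg)
    also have "\<dots> = N - \<rho>" using N by (simp add: left_diff_distrib)
    finally show ?thesis .
  qed
  ultimately show ?thesis
    using N by (intro bexI[of _ x]) (auto simp: dist_norm norm_minus_commute)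
qed

text \<open>\<open>cylinder_contained\<close> permits a final time \<open>T\<close>, but here
  \<open>t0 < T\<close>. Together with \<open>0 < t0 - \<theta>\<close> this leaves room on both
  sides in time, so the closed cylinder has a compactly contained neighbourhood in which
  mollification is possible.\<close>

lemma cylinder_neighbourhood:
  fixes \<Omega> :: "'a::euclidean_space set"
  assumes \<Omega>: "open \<Omega>" and T: "t0 < T" and \<rho>: "0 < \<rho>" and \<theta>: "0 < \<theta>"
    and cyl: "cylinder_contained (ball x0 \<rho>) (t0 - \<theta>) t0 \<Omega> T"
  obtains D t1 t2 \<delta> where "open D" "bounded D" "t1 < t2" "0 < \<delta>"
    "compactly_contained (D \<times> {t1<..<t2}) (\<Omega> \<times> {0<..<T})"
    "\<And>z. z \<in> cball x0 \<rho> \<times> {t0 - \<theta>..t0} \<Longrightarrow> cball (fst z) \<delta> \<subseteq> D \<and> cball z \<delta> \<subseteq> D \<times> {t1<..<t2}"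
proof -
  have c: "cball x0 \<rho> \<subseteq> \<Omega>" and t: "0 < t0 - \<theta>"
    using cyl \<rho> by (auto simp: cylinder_contained_def compactly_contained_def)
  obtain e where e: "0 < e" "(\<Union>x\<in>cball x0 \<rho>. cball x e) \<subseteq> \<Omega>"
    using compact_subset_open_imp_cball_epsilon_subset[OF compact_cball \<Omega> c] by blast
  define D where "D = ball x0 (\<rho> + e)"
  define t1 where "t1 = (t0 - \<theta>) / 2"
  define t2 where "t2 = (t0 + T) / 2"
  \<comment> \<open>Half the smallest of three margins: \<open>e\<close> in space,
    \<open>t2 - t0\<close> above, and \<open>t1\<close> below, the latter being also the gap
    \<open>t0 - \<theta> - t1\<close>.\<close>
  define \<delta> where "\<delta> = min e (min t1 (t2 - t0)) / 2"
  have tt: "0 < t1" "t1 < t0 - \<theta>" "t0 < t2" "t2 < T" using t T \<theta> by (auto simp: t1_def t2_def)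
  have \<delta>: "0 < \<delta>" "\<delta> < e" "\<delta> < t1" "\<delta> < t2 - t0" using e tt by (auto simp: \<delta>_def)
  have t1': "t1 = t0 - \<theta> - t1" by (simp add: t1_def field_simps)
  have cD: "closure D \<subseteq> \<Omega>"
  proof
    fix y assume "y \<in> closure D"
    then have "y \<in> cball x0 (\<rho> + e)" using \<rho> e by (simp add: D_def)
    then show "y \<in> \<Omega>" using cball_enlarge[OF \<rho> e(1)] e(2) by blast
  qed
  have "compactly_contained (D \<times> {t1<..<t2}) (\<Omega> \<times> {0<..<T})"
  proof -
    have "closure (D \<times> {t1<..<t2}) = closure D \<times> {t1..t2}" using tt \<theta> by (simp add: closure_Times)
    moreover have "compact (closure D \<times> {t1..t2})" using \<rho> e by (intro compact_Times) (auto simp: D_def)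
    moreover have "closure D \<times> {t1..t2} \<subseteq> \<Omega> \<times> {0<..<T}" using cD tt by auto
    ultimately show ?thesis by (simp add: compactly_contained_def)
  qed
  moreover have "cball (fst z) \<delta> \<subseteq> D \<and> cball z \<delta> \<subseteq> D \<times> {t1<..<t2}" if z: "z \<in> cball x0 \<rho> \<times> {t0 - \<theta>..t0}" for z
  proof -
    have "dist x0 (fst z) \<le> \<rho>" and s: "t0 - \<theta> \<le> snd z" "snd z \<le> t0" using z by auto
    have A: "y \<in> D" if "dist (fst z) y \<le> \<delta>" for y
      using dist_triangle[of x0 y "fst z"] \<open>dist x0 (fst z) \<le> \<rho>\<close> that \<delta> by (simp add: D_def)
    moreover have "w \<in> D \<times> {t1<..<t2}" if w: "dist z w \<le> \<delta>" for w
    proof -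
      have "dist (fst z) (fst w) \<le> \<delta>" "dist (snd z) (snd w) \<le> \<delta>"
        using dist_fst_le[of z w] dist_snd_le[of z w] w by auto
      then have "\<bar>snd z - snd w\<bar> \<le> \<delta>" "fst w \<in> D" using A by (auto simp: dist_real_def)
      then have "fst w \<in> D" "t1 < snd w" "snd w < t2" using s \<delta> t1' by auto
      then show ?thesis by (cases w) auto
    qed
    ultimately show ?thesis by auto
  qed
  ultimately show ?thesis
    using that[of D t1 t2 \<delta>] tt \<theta> \<delta>(1) by (auto simp: D_def)
qed

text \<open>On the neighbourhood \<open>K\<close> of the cylinder \<open>u\<close> has all global
  integrability, so Borel representatives vanishing outside \<open>K\<close> satisfy the
  requirements of \<open>regularized\<close>. The flux constant is the one from integrating
  \<open>DA\<close> along rays.\<close>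

lemma subsolution_regularized:
  fixes \<Omega> :: "(real ^ 'n) set" and u :: "(real ^ 'n) \<times> real \<Rightarrow> real"
  assumes gr: "growth g0 g1 g" and \<nu>: "0 < \<nu>" and L: "0 < L" and A: "vector_field_structure \<nu> L g A"
    and \<Omega>: "open \<Omega>" and T: "t0 < T" and \<rho>: "0 < \<rho>" and \<theta>: "0 < \<theta>"
    and cyl: "cylinder_contained (ball x0 \<rho>) (t0 - \<theta>) t0 \<Omega> T"
    and sub: "weak_subsolution (primitive g) A \<Omega> T u"
    and nonneg: "AE z in lebesgue_on (\<Omega> \<times> {0<..<T}). 0 \<le> u z"
  obtains \<delta> u0 Du0 where "regularized g0 g1 g \<nu> (L / (g0 - 1)) \<rho> t0 \<theta> \<delta> x0 A u0 Du0"
    "AE z in lborel. z \<in> cball x0 \<rho> \<times> {t0 - \<theta>..t0} \<longrightarrow> u z = u0 z"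
    "u \<in> borel_measurable (lebesgue_on (cball x0 \<rho> \<times> {t0 - \<theta>..t0}))"
proof -
  interpret growth g0 g1 g by (rule gr)
  obtain Du where V: "V2G_loc (primitive g) \<Omega> T u Du" and weak: "\<forall>\<eta>\<in>test_functions (\<Omega> \<times> {0<..<T}). (\<forall>z. 0 \<le> \<eta> z) \<longrightarrow>
           - (LINT (x, t)|lebesgue_on (\<Omega> \<times> {0<..<T}). u (x, t) * deriv (\<lambda>s. \<eta> (x, s)) t)
           + (LINT (x, t)|lebesgue_on (\<Omega> \<times> {0<..<T}).
                A (Du (x, t)) \<bullet> gradient (\<lambda>y. \<eta> (y, t)) x) \<le> 0"
    using sub unfolding weak_subsolution_def by blast
  obtain D t1 t2 \<delta> where D: "open D" "bounded D" "t1 < t2" "0 < \<delta>"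
    and DK: "compactly_contained (D \<times> {t1<..<t2}) (\<Omega> \<times> {0<..<T})"
    and nb: "\<And>z. z \<in> cball x0 \<rho> \<times> {t0 - \<theta>..t0} \<Longrightarrow> cball (fst z) \<delta> \<subseteq> D \<and> cball z \<delta> \<subseteq> D \<times> {t1<..<t2}"
    by (rule cylinder_neighbourhood[OF \<Omega> T \<rho> \<theta> cyl]) blast
  define K where "K = D \<times> {t1<..<t2}"
  let ?Q = "cball x0 \<rho> \<times> {t0 - \<theta>..t0}"
  have Km: "K \<in> sets borel" and Dm: "D \<in> sets borel" and \<Omega>m: "\<Omega> \<in> sets borel"
    using D \<Omega> by (auto simp: K_def intro!: borel_open open_Times)
  have K\<Omega>: "K \<subseteq> \<Omega> \<times> {0<..<T}"
  proof -
    have "closure (D \<times> {t1<..<t2}) \<subseteq> \<Omega> \<times> {0<..<T}"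
      using DK by (simp only: compactly_contained_def)
    with closure_subset show ?thesis unfolding K_def by (rule subset_trans)
  qed
  have QK: "?Q \<subseteq> K"
  proof
    fix z assume "z \<in> ?Q"
    moreover have "z \<in> cball z \<delta>" using D(4) by simp
    ultimately show "z \<in> K" using nb unfolding K_def by blast
  qed
  have V2: "V2G (primitive g) D t1 t2 u Du" using V D DK unfolding V2G_loc_def by blast
  then have Lu: "LG (primitive g) K u" "LG (primitive g) K Du" and L2: "Linf_L2 D t1 t2 u"
    and iu: "integrable (lebesgue_on K) u" "integrable (lebesgue_on K) Du"
    and W: "AE t in lebesgue_on {t1<..<t2}. W11 D (\<lambda>x. u (x, t)) (\<lambda>x. Du (x, t))"
    unfolding V2G_def VG_def L1_W11_def K_def by auto
  have um: "u \<in> borel_measurable (lebesgue_on K)" "Du \<in> borel_measurable (lebesgue_on K)" using iu by auto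
  obtain h where h: "h \<in> borel_measurable borel" "\<And>w. w \<notin> K \<Longrightarrow> h w = 0" "AE w in lborel. w \<in> K \<longrightarrow> u w = h w"
    using Borel_representative[OF Km um(1)] by blast
  obtain Du0 where Du0: "Du0 \<in> borel_measurable borel" "\<And>w. w \<notin> K \<Longrightarrow> Du0 w = 0" "AE w in lborel. w \<in> K \<longrightarrow> Du w = Du0 w"
    using Borel_representative[OF Km um(2)] by blast
  \<comment> \<open>The positive part turns nonnegativity almost everywhere into nonnegativity
    everywhere without changing the class of \<open>u\<close> on \<open>K\<close>.\<close>
  define u0 where "u0 w = max 0 (h w)" for w
  have \<Omega>Tm: "\<Omega> \<times> {0<..<T} \<in> sets borel" using \<Omega> by (intro borel_open open_Times) auto
  have nn: "AE w in lborel. w \<in> \<Omega> \<times> {0<..<T} \<longrightarrow> 0 \<le> u w"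
    using nonneg \<Omega>Tm by (subst (asm) AE_restrict_space_iff) (auto simp: AE_completion_iff)
  have u0: "u0 \<in> borel_measurable borel" "\<And>w. w \<notin> K \<Longrightarrow> u0 w = 0"
    using h(1,2) unfolding u0_def[abs_def] by auto
  have u0ae: "AE w in lborel. w \<in> K \<longrightarrow> u w = u0 w"
    using h(3) nn by eventually_elim (use K\<Omega> in \<open>auto simp: u0_def\<close>)
  have ae: "AE w in lborel. w \<in> K \<longrightarrow> u w = u0 w \<and> Du w = Du0 w"
    using u0ae Du0(3) by eventually_elim auto
  have ui: "integrable lborel u0"
  proof (subst lebesgue_on_Borel_representative(2)[OF Km u0(1), symmetric])
    show "AE w in lborel. indicator K w *\<^sub>R u w = u0 w"
      using u0ae by eventually_elim (use u0(2) in \<open>auto simp: indicator_def\<close>)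
  qed (rule iu(1))
  have Di: "integrable lborel Du0"
  proof (subst lebesgue_on_Borel_representative(2)[OF Km Du0(1), symmetric])
    show "AE w in lborel. indicator K w *\<^sub>R Du w = Du0 w"
      using Du0(3) by eventually_elim (use Du0(2) in \<open>auto simp: indicator_def\<close>)
  qed (rule iu(2))
  have u2: "integrable lborel (\<lambda>w. (u0 w)\<^sup>2)"
    by (rule square_integrable[OF Dm L2 u0(1)]) (use u0(2) u0ae in \<open>auto simp: K_def\<close>)
  have u0n: "0 \<le> u0 w" for w by (simp add: u0_def)
  have Gu: "integrable lborel (\<lambda>w. G (u0 w))"
    using LG_integrable[OF Km Lu(1) G_measurable G_zero G_nonneg u0 u0ae] u0n by simp
  have GDu: "integrable lborel (\<lambda>w. G (norm (Du0 w)))"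
    by (rule LG_integrable[OF Km Lu(2) G_measurable G_zero G_nonneg Du0])
  note Ab = vector_field_bounds[OF A \<nu> L]
  have La: "0 < L / (g0 - 1)" using L g0_gt by simp
  have Ac: "continuous_on UNIV A" by (rule Ab(3))
  have ADm: "(\<lambda>w. A (Du0 w)) \<in> borel_measurable borel"
    using Du0(1) by (rule measurable_compose[OF _ borel_measurable_continuous_onI[OF Ac]])
  have AD: "integrable lborel (\<lambda>w. A (Du0 w))"
  proof (rule Bochner_Integration.integrable_bound)
    have "bounded K" using D by (simp add: K_def bounded_Times)
    then have "integrable lborel (indicator K :: _ \<Rightarrow> real)"
      using Km by (intro integrable_real_indicator emeasure_bounded_finite) auto
    \<comment> \<open>Young's inequality with second factor 1 bounds the flux by
      \<open>G (norm Du0) + G 1\<close> on \<open>K\<close>, which is bounded; outside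
      \<open>K\<close> the flux is \<open>A 0 = 0\<close>.\<close>
    then show "integrable lborel (\<lambda>w. L / (g0 - 1) * g1 * (G (norm (Du0 w)) + G 1 * indicator K w))"
      using GDu by (intro integrable_mult_right Bochner_Integration.integrable_add) auto
    show "AE w in lborel. norm (A (Du0 w)) \<le> norm (L / (g0 - 1) * g1 * (G (norm (Du0 w)) + G 1 * indicator K w))"
    proof (rule AE_I2)
      fix w
      have g1p: "0 < g1" using g0_gt g0_le by simp
      show "norm (A (Du0 w)) \<le> norm (L / (g0 - 1) * g1 * (G (norm (Du0 w)) + G 1 * indicator K w))"
      proof (cases "w \<in> K")
        case True
        have "norm (A (Du0 w)) \<le> L / (g0 - 1) * (g (norm (Du0 w)) * 1)" using Ab(2)[of "Du0 w"] by simp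
        also have "\<dots> \<le> L / (g0 - 1) * (g1 * (1 * G (norm (Du0 w)) + G (1 / 1)))"
          using La by (intro mult_left_mono g_young) auto
        also have "\<dots> = L / (g0 - 1) * g1 * (G (norm (Du0 w)) + G 1)" by (simp add: mult.assoc)
        also have "\<dots> \<le> norm (L / (g0 - 1) * g1 * (G (norm (Du0 w)) + G 1))"
          unfolding real_norm_def by (rule abs_ge_self)
        finally show ?thesis using True by simp
      next
        case False
        then show ?thesis using Du0(2) Ab(4) by simp
      qed
    qed
  qed (use ADm in simp)
  have "regularized g0 g1 g \<nu> (L / (g0 - 1)) \<rho> t0 \<theta> \<delta> x0 A u0 Du0"
  proof
    show "conv (\<lambda>y. grad \<kappa> y \<bullet> (axis i 1, 0)) u0 z = conv \<kappa> Du0 z $ i"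
      if "mollifier r \<kappa>" "r < \<delta>" "z \<in> ?Q" for r \<kappa> z i
    proof (rule weak_gradient_conv[OF Dm W ui Di _ _ that(1)])
      show "u0 w = 0 \<and> Du0 w = 0" if "w \<notin> D \<times> {t1<..<t2}" for w using that u0(2) Du0(2) by (simp add: K_def)
      show "AE w in lborel. w \<in> D \<times> {t1<..<t2} \<longrightarrow> u w = u0 w \<and> Du w = Du0 w" using ae by (simp add: K_def)
      show "cball (fst z) r \<subseteq> D" using nb[OF that(3)] that(2) subset_cball[of r \<delta> "fst z"] by (meson less_imp_le subset_trans)
    qed
    show "conv (\<lambda>y. grad \<kappa> y \<bullet> (0, 1)) u0 z \<le> (\<Sum>i\<in>UNIV. conv (\<lambda>y. grad \<kappa> y \<bullet> (axis i 1, 0)) (\<lambda>w. A (Du0 w)) z $ i)"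
      if "mollifier r \<kappa>" "r < \<delta>" "z \<in> ?Q" for r \<kappa> z
    proof (rule subsolution_conv[OF Km K\<Omega> \<Omega>m weak ui Du0(1) _ Ac AD ae that(1)])
      show "u0 w = 0 \<and> Du0 w = 0" if "w \<notin> K" for w using that u0(2) Du0(2) by simp
      show "cball z r \<subseteq> K" using nb[OF that(3)] that(2) subset_cball[of r \<delta> z] unfolding K_def by (meson less_imp_le subset_trans)
    qed
  qed (use \<nu> La Ab(1,2) Ac ui u0n u2 Gu Di GDu AD \<rho> \<theta> D(4) in auto)
  moreover have "AE z in lborel. z \<in> ?Q \<longrightarrow> u z = u0 z" using u0ae by eventually_elim (use QK in auto)
  moreover have "u \<in> borel_measurable (lebesgue_on ?Q)" by (rule measurable_restrict_mono[OF um(1) QK])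
  ultimately show ?thesis by (rule that)
qed

text \<open>The frontier of a convex set is a null set.\<close>

lemma AE_closed_cylinder:
  fixes x0 :: "'a::euclidean_space" and t1 t2 \<rho> :: real
  assumes "0 < \<rho>" "t1 < t2"
  shows "AE z in lborel. z \<in> cball x0 \<rho> \<times> {t1..t2} \<longrightarrow> z \<in> ball x0 \<rho> \<times> {t1<..<t2}"
proof -
  let ?S = "ball x0 \<rho> \<times> {t1<..<t2}"
  have "negligible (frontier ?S)" by (intro negligible_convex_frontier convex_Times) auto
  then have "frontier ?S \<in> null_sets lebesgue" by (simp add: negligible_iff_null_sets)
  then have "AE z in lborel. z \<notin> frontier ?S"
    using AE_not_in[of "frontier ?S" lebesgue] by (simp add: AE_completion_iff)
  then show ?thesis
  proof eventually_elim
    case (elim z)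
    have "closure ?S = cball x0 \<rho> \<times> {t1..t2}" using assms by (simp add: closure_Times)
    moreover have "interior ?S = ?S" by (intro interior_open open_Times) auto
    ultimately show ?case using elim by (auto simp: frontier_def)
  qed
qed

lemma measure_cylinder:
  fixes x0 :: "real ^ 'n"
  assumes "0 < \<rho>" "t1 < t2"
  shows "measure lebesgue (ball x0 \<rho> \<times> {t1<..<t2}) = measure lborel (ball (0 :: real ^ 'n) 1) * \<rho> ^ CARD('n) * (t2 - t1)"
proof -
  have "ball x0 \<rho> \<times> {t1<..<t2} \<in> sets lborel" by (simp add: borel_open open_Times)
  then have "measure lebesgue (ball x0 \<rho> \<times> {t1<..<t2}) = measure lborel (ball x0 \<rho> \<times> {t1<..<t2})" by simp
  also have "\<dots> = enn2real (emeasure (lborel \<Otimes>\<^sub>M lborel) (ball x0 \<rho> \<times> {t1<..<t2}))"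
    by (simp add: measure_def lborel_prod)
  also have "\<dots> = measure lborel (ball x0 \<rho>) * (t2 - t1)"
    using assms by (subst lborel.emeasure_pair_measure_Times) (auto simp: enn2real_mult measure_def)
  also have "measure lborel (ball x0 \<rho>) = \<rho> ^ CARD('n) * measure lborel (ball (0 :: real ^ 'n) 1)"
    using content_ball_conv_unit_ball[of \<rho> x0] assms by simp
  finally show ?thesis by simp
qed

text \<open>The constants entering \<open>iteration_constants\<close> are built from n, g0, g1,
  \<nu> and L alone, so \<open>\<sigma>\<close> is fixed before the domain, the growth function, the
  vector field and the subsolution are introduced.\<close>

theorem lemma4p1:
  fixes g0 g1 \<nu> L :: real
  assumes "CARD('n::finite) \<ge> 2"
    and "2 * real CARD('n) / (real CARD('n) + 2) < g0" and "g0 \<le> g1"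
    and "0 < \<nu>" and "\<nu> \<le> 1" and "1 \<le> L"
  shows "\<exists>\<sigma>. 0 < \<sigma> \<and> \<sigma> < 1 \<and>
    (\<forall>(\<Omega> :: (real ^ 'n) set) (T :: real) (g :: real \<Rightarrow> real) (A :: real ^ 'n \<Rightarrow> real ^ 'n)
      (u :: (real ^ 'n) \<times> real \<Rightarrow> real) (x0 :: real ^ 'n) (t0 :: real)
      (k :: real) (\<rho> :: real) (\<theta> :: real).
      bounded_domain \<Omega> \<longrightarrow> 0 < T \<longrightarrow>
      growth_function g0 g1 g \<longrightarrow> vector_field_structure \<nu> L g A \<longrightarrow>
      (x0, t0) \<in> \<Omega> \<times> {0<..<T} \<longrightarrow> 0 < k \<longrightarrow> 0 < \<rho> \<longrightarrow> 0 < \<theta> \<longrightarrow>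
      cylinder_contained (ball x0 \<rho>) (t0 - \<theta>) t0 \<Omega> T \<longrightarrow>
      \<theta> = k\<^sup>2 * inverse (primitive g (k / \<rho>)) \<longrightarrow>
      weak_subsolution (primitive g) A \<Omega> T u \<longrightarrow>
      (AE z in lebesgue_on (\<Omega> \<times> {0<..<T}). 0 \<le> u z) \<longrightarrow>
      1 / measure lebesgue (ball x0 \<rho> \<times> {t0 - \<theta><..<t0}) *
        (LINT z|lebesgue_on (ball x0 \<rho> \<times> {t0 - \<theta><..<t0}).
           primitive g (u z / \<rho>) + (u z)\<^sup>2 / \<theta>)
        \<le> \<sigma> * primitive g (k / \<rho>) \<longrightarrow>
      esssup (lebesgue_on (ball x0 (\<rho> / 2) \<times> {t0 - \<theta> / 2<..<t0})) (\<lambda>z. ereal (u z)) \<le> ereal k)"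
proof -
  define n where "n = CARD('n)"
  define \<omega> where "\<omega> = measure lborel (ball (0 :: real ^ 'n) 1)"
  \<comment> \<open>At least 2, so that the cutoff is continuously differentiable, and at least
    \<open>g1\<close>, as the absorption of the cross term requires.\<close>
  define q where "q = nat \<lceil>g1\<rceil> + 2"
  define La where "La = L / (g0 - 1)"
  have n2: "2 \<le> n" using assms(1) by (simp add: n_def)
  have "1 \<le> 2 * real n / (real n + 2)" using n2 by (simp add: field_simps)
  then have g0: "1 < g0" using assms(2) unfolding n_def[symmetric] by linarith
  have g0n: "2 * real n / (real n + 2) < g0" using assms(2) by (simp add: n_def)
  have g1: "0 < g1" using g0 assms(3) by simp
  have q: "2 \<le> q" "g1 \<le> q" using real_nat_ceiling_ge[of g1] by (auto simp: q_def)
  have La: "0 < La" using g0 assms(6) by (simp add: La_def)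
  have \<omega>: "0 < \<omega>" unfolding \<omega>_def using content_ball_pos[of 1 "0 :: real ^ 'n"] by simp
  have E: "0 < energy_const \<nu> La g1 q" using La g1 by (simp add: energy_const_def add_pos_nonneg)
  have "0 < level_const \<nu> g1 q" using assms(4) by (simp add: level_const_def add_pos_nonneg)
  then have K: "0 < gain_const g0 g1 n * level_const \<nu> g1 q"
    using n2 g0 g0n by (intro mult_pos_pos gain_const_pos) auto
  have \<alpha>: "0 < g0 / real n" using n2 g0 by simp
  from iteration_constants[OF \<alpha> E K, of q "max g1 2" "2 * (g0 / real n) + g1"] obtain \<sigma> R where
    \<sigma>: "0 < \<sigma>" "\<sigma> < 1" and R: "0 < R" "R < 1"
    and c1: "\<And>j. 8 * energy_const \<nu> La g1 q * \<sigma> * R ^ j \<le> (gap_size q j)\<^sup>2"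
    and c2: "\<And>j. (2 / cut_size q j) powr max g1 2 * ((gain_const g0 g1 n * level_const \<nu> g1 q) *
      (8 * energy_const \<nu> La g1 q * \<sigma> * R ^ j) powr (g0 / real n) * gap_size q j powr (- (2 * (g0 / real n) + g1)) *
      (2 * energy_const \<nu> La g1 q * \<sigma> * R ^ j)) \<le> \<sigma> * R ^ Suc j"
    by blast
  show ?thesis
  proof (intro exI[of _ \<sigma>] conjI allI impI \<sigma>)
    fix \<Omega> :: "(real ^ 'n) set" and T g A u x0 t0 k \<rho> \<theta>
    assume \<Omega>: "bounded_domain \<Omega>" and T: "0 < T" and gf: "growth_function g0 g1 g" and A: "vector_field_structure \<nu> L g A"
      and z0: "(x0, t0) \<in> \<Omega> \<times> {0<..<T}" and k: "0 < k" and \<rho>: "0 < \<rho>" and \<theta>: "0 < \<theta>"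
      and cyl: "cylinder_contained (ball x0 \<rho>) (t0 - \<theta>) t0 \<Omega> T" and \<theta>k: "\<theta> = k\<^sup>2 * inverse (primitive g (k / \<rho>))"
      and sub: "weak_subsolution (primitive g) A \<Omega> T u" and nonneg: "AE z in lebesgue_on (\<Omega> \<times> {0<..<T}). 0 \<le> u z"
      and small: "1 / measure lebesgue (ball x0 \<rho> \<times> {t0 - \<theta><..<t0}) *
        (LINT z|lebesgue_on (ball x0 \<rho> \<times> {t0 - \<theta><..<t0}). primitive g (u z / \<rho>) + (u z)\<^sup>2 / \<theta>) \<le> \<sigma> * primitive g (k / \<rho>)"
    have gr: "growth g0 g1 g" using g0 assms(3) gf by (simp add: growth_def)
    have L: "0 < L" using assms(6) by simp
    obtain \<delta> u0 Du0 where reg: "regularized g0 g1 g \<nu> (L / (g0 - 1)) \<rho> t0 \<theta> \<delta> x0 A u0 Du0"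
      and ae: "AE z in lborel. z \<in> cball x0 \<rho> \<times> {t0 - \<theta>..t0} \<longrightarrow> u z = u0 z"
      and um: "u \<in> borel_measurable (lebesgue_on (cball x0 \<rho> \<times> {t0 - \<theta>..t0}))"
      using subsolution_regularized[OF gr assms(4) L A _ _ \<rho> \<theta> cyl sub nonneg] \<Omega> z0
      by (auto simp: bounded_domain_def)
    interpret reg: regularized g0 g1 g \<nu> La \<rho> t0 \<theta> \<delta> x0 A u0 Du0 using reg unfolding La_def .
    let ?S = "ball x0 \<rho> \<times> {t0 - \<theta><..<t0}"
    have Sm: "?S \<in> sets borel" by (intro borel_open open_Times) auto
    define f0 where "f0 z = indicator ?S z * reg.\<Psi> 0 (u0 z)" for z
    have u0m: "u0 \<in> borel_measurable borel" using reg.u_int by auto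
    have f0i: "integrable lborel f0"
      unfolding f0_def
      by (rule Bochner_Integration.integrable_bound[OF reg.\<Psi>_int[of 0]]) (use Sm u0m in \<open>auto simp: indicator_def\<close>)
    have f0m: "f0 \<in> borel_measurable borel" using f0i by auto
    have "(LINT z|lebesgue_on ?S. primitive g (u z / \<rho>) + (u z)\<^sup>2 / \<theta>) = integral\<^sup>L lborel f0"
    proof (rule lebesgue_on_Borel_representative(1)[OF Sm f0m])
      show "AE z in lborel. indicator ?S z *\<^sub>R (primitive g (u z / \<rho>) + (u z)\<^sup>2 / \<theta>) = f0 z"
        using ae
      proof eventually_elim
        case (elim z)
        show ?case
        proof (cases "z \<in> ?S")
          case True
          then have "z \<in> cball x0 \<rho> \<times> {t0 - \<theta>..t0}" by auto
          then have "u z = u0 z" using elim by simp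
          then show ?thesis using True reg.u_nonneg[of z] by (simp add: f0_def reg.\<Psi>_def)
        qed (simp add: f0_def)
      qed
    qed
    then have s2: "1 / measure lebesgue ?S * integral\<^sup>L lborel f0 \<le> \<sigma> * primitive g (k / \<rho>)" using small by simp
    have mS: "measure lebesgue ?S = \<omega> * \<rho> ^ n * \<theta>"
      using measure_cylinder[of \<rho> "t0 - \<theta>" t0 x0] \<rho> \<theta> by (simp add: \<omega>_def n_def)
    have mS0: "0 < \<omega> * \<rho> ^ n * \<theta>" using \<omega> \<rho> \<theta> by simp
    have H: "0 < primitive g (k / \<rho>)" using growth.G_pos[OF gr] k \<rho> by simp
    have "integral\<^sup>L lborel f0 \<le> \<sigma> * primitive g (k / \<rho>) * (\<omega> * \<rho> ^ n * \<theta>)"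
      using s2 mS0 unfolding mS by (simp add: pos_divide_le_eq)
    also have "\<dots> = \<sigma> * \<omega> * \<rho> ^ n * k\<^sup>2"
    proof -
      \<comment> \<open>The intrinsic relation turns smallness of the average into the initial bound
        of the iteration in the unit \<open>\<omega> * \<rho>^n * k^2\<close>.\<close>
      have "primitive g (k / \<rho>) * \<theta> = k\<^sup>2" using H by (simp add: \<theta>k)
      then show ?thesis by (metis mult.assoc mult.commute)
    qed
    finally have int_le: "integral\<^sup>L lborel f0 \<le> \<sigma> * \<omega> * \<rho> ^ n * k\<^sup>2" .
    have init: "(\<integral>\<^sup>+z. ennreal (reg.\<Psi> 0 (u0 z)) * indicator (cball x0 \<rho> \<times> {t0 - \<theta>..t0}) z \<partial>lborel) \<le> ennreal (\<sigma> * \<omega> * \<rho> ^ n * k\<^sup>2)"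
    proof -
      have "AE z in lborel. z \<in> cball x0 \<rho> \<times> {t0 - \<theta>..t0} \<longrightarrow> z \<in> ?S"
        by (rule AE_closed_cylinder) (use \<rho> \<theta> in auto)
      then have "(\<integral>\<^sup>+z. ennreal (reg.\<Psi> 0 (u0 z)) * indicator (cball x0 \<rho> \<times> {t0 - \<theta>..t0}) z \<partial>lborel) \<le> (\<integral>\<^sup>+z. ennreal (f0 z) \<partial>lborel)"
        by (intro nn_integral_mono_AE, elim eventually_mono) (auto simp: f0_def indicator_def)
      also have "\<dots> = ennreal (integral\<^sup>L lborel f0)"
        by (rule nn_integral_eq_integral[OF f0i]) (use reg.\<Psi>_nonneg in \<open>auto simp: f0_def\<close>)
      also have "\<dots> \<le> ennreal (\<sigma> * \<omega> * \<rho> ^ n * k\<^sup>2)" by (rule ennreal_leI[OF int_le])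
      finally show ?thesis .
    qed
    have bound: "AE z in lborel. z \<in> cball x0 (\<rho> / 2) \<times> {t0 - \<theta> / 2..t0} \<longrightarrow> u0 z \<le> k"
      by (rule reg.de_giorgi_iteration[OF q g0n[unfolded n_def] k \<theta>k \<sigma>(1) R c1 c2[unfolded n_def] init[unfolded \<omega>_def n_def]])
    let ?N = "ball x0 (\<rho> / 2) \<times> {t0 - \<theta> / 2<..<t0}"
    have NQ: "?N \<subseteq> cball x0 \<rho> \<times> {t0 - \<theta>..t0}" using \<rho> \<theta> by auto
    have Nm: "?N \<in> sets borel" by (intro borel_open open_Times) auto
    show "esssup (lebesgue_on ?N) (\<lambda>z. ereal (u z)) \<le> ereal k"
    proof (rule esssup_I)
      have "u \<in> borel_measurable (lebesgue_on ?N)" by (rule measurable_restrict_mono[OF um NQ])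
      then show "(\<lambda>z. ereal (u z)) \<in> borel_measurable (lebesgue_on ?N)" by simp
      have "AE z in lborel. z \<in> ?N \<longrightarrow> ereal (u z) \<le> ereal k"
        using bound ae
      proof eventually_elim
        case (elim z)
        show ?case
        proof
          assume z: "z \<in> ?N"
          then have "u z = u0 z" using elim(2) NQ by blast
          moreover have "z \<in> cball x0 (\<rho> / 2) \<times> {t0 - \<theta> / 2..t0}" using z by auto
          ultimately show "ereal (u z) \<le> ereal k" using elim(1) by simp
        qed
      qed
      then show "AE z in lebesgue_on ?N. ereal (u z) \<le> ereal k"
        using Nm by (subst AE_restrict_space_iff) (auto simp: AE_completion_iff)
    qed
  qed
qed

end
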